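(* Let $\Gamma=\mathrm{PSL}_2(\mathbf{Z})$ and let $\chi:\bar\Gamma_0(2)\to\mathbf{C}^\times$ be a character of finite order with $\chi(\bar U)=\lambda$ a primitive $n$-th root of unity ($n\ge 1$) and $\chi(\bar V)=\varepsilon\in\{\pm1\}$. Let $k$ be an integer and let $f\in M_k(\bar\Gamma_0(2),\chi)$ be a nonzero holomorphic modular form whose Fourier coefficients are algebraic numbers. If $p$ is a prime dividing $n$, then the powers of $p$ dividing the denominators of the Fourier coefficients of $f$ are unbounded in each of the following cases: $p\ge 5$; $p=3$ and $9\mid n$; $p=2$ and $16\mid n$. In particular, the following are equivalent: (a) $f$ has bounded denominators; (b) $n\mid 24$; (c) $f$ is a congruence modular form.
   Context: For a matrix or subgroup $M$ of $\mathrm{SL}_2(\mathbf{Z})$, $\bar M$ denotes its image in $\Gamma=\mathrm{PSL}_2(\mathbf{Z})$; $\bar\Gamma_0(2)$ is the image of $\Gamma_0(2)$. Here $U=\begin{pmatrix}1&0\\2&1\end{pmatrix}$, $T=\begin{pmatrix}1&1\\0&1\end{pmatrix}$, $V=TU^{-1}=\begin{pmatrix}-1&1\\-2&1\end{pmatrix}$ (so $\bar V$ has order 2). $M_k(\bar\Gamma_0(2),\chi)$ is the space of holomorphic functions $f$ on the upper half-plane with $(f|_k\gamma)(\tau):=(c\tau+d)^{-k}f(\gamma\tau)=\chi(\gamma)f(\tau)$ for all $\gamma=\begin{pmatrix}a&b\\c&d\end{pmatrix}$ representing elements of $\bar\Gamma_0(2)$, and holomorphic at all cusps; such $f$ has a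 Fourier expansion $\sum_{m\ge0}c_m q^{m/(2n)}$, $q=e^{2\pi i\tau}$. "The powers of $p$ dividing the denominators are unbounded" means: for every integer $N\ge0$ there is a coefficient $c_m$ such that $p^Nc_m$ is not integral at some prime above $p$. "Bounded denominators" means there is a nonzero integer $D$ with all $Dc_m$ algebraic integers. A congruence modular form is one invariant under $|_k$ of some congruence subgroup. *)

theory Defs
  imports
    "HOL-Complex_Analysis.Complex_Analysis"
    "HOL-Number_Theory.Cong"
    "HOL-Algebra.Ideal"
begin

definition SL2Z :: "(int^2^2) monoid" where
  "SL2Z = \<lparr>carrier = {A. det A = 1}, mult = (**), one = mat 1\<rparr>"

definition PSL2Z :: "(int^2^2) set monoid" where
  "PSL2Z = SL2Z Mod {mat 1, - mat 1}"

text \<open>The image \<open>{A, - A}\<close> of a matrix in the quotient.\<close>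

definition bar :: "int^2^2 \<Rightarrow> (int^2^2) set" where
  "bar A = {mat 1, - mat 1} #>\<^bsub>SL2Z\<^esub> A"

definition Gamma0 :: "nat \<Rightarrow> (int^2^2) set" where
  "Gamma0 N = {A \<in> carrier SL2Z. int N dvd A $ 2 $ 1}"

definition principal_Gamma :: "nat \<Rightarrow> (int^2^2) set" where
  "principal_Gamma N =
     {A \<in> carrier SL2Z. \<forall>i j. [A $ i $ j = mat 1 $ i $ j] (mod int N)}"

definition congruence_subgroup :: "(int^2^2) set \<Rightarrow> bool" where
  "congruence_subgroup G \<longleftrightarrow> subgroup G SL2Z \<and> (\<exists>N\<ge>1. principal_Gamma N \<subseteq> G)"

definition barGamma0_2 :: "(int^2^2) set monoid" where
  "barGamma0_2 = PSL2Z\<lparr>carrier := bar ` Gamma0 2\<rparr>"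

definition mat_U :: "int^2^2" where
  "mat_U = vector [vector [1, 0], vector [2, 1]]"

definition mat_V :: "int^2^2" where
  "mat_V = vector [vector [-1, 1], vector [-2, 1]]"

definition complex_units :: "complex monoid" where
  "complex_units = \<lparr>carrier = UNIV - {0}, mult = (*), one = 1\<rparr>"

definition finite_order_character :: "('g, 'b) monoid_scheme \<Rightarrow> ('g \<Rightarrow> complex) \<Rightarrow> bool" where
  "finite_order_character G chi \<longleftrightarrow>
     chi \<in> hom G complex_units \<and> (\<exists>m>0. \<forall>g\<in>carrier G. chi g ^ m = 1)"

definition primitive_root_of_unity :: "nat \<Rightarrow> complex \<Rightarrow> bool" where
  "primitive_root_of_unity n z \<longleftrightarrow> n > 0 \<and> z ^ n = 1 \<and> (\<forall>m. 0 < m \<and> m < n \<longrightarrow> z ^ m \<noteq> 1)"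

definition upper_half_plane :: "complex set" where
  "upper_half_plane = {\<tau>. Im \<tau> > 0}"

definition slash :: "int \<Rightarrow> int^2^2 \<Rightarrow> (complex \<Rightarrow> complex) \<Rightarrow> complex \<Rightarrow> complex" where
  "slash k A f \<tau> =
     (of_int (A $ 2 $ 1) * \<tau> + of_int (A $ 2 $ 2)) powi (- k) *
     f ((of_int (A $ 1 $ 1) * \<tau> + of_int (A $ 1 $ 2)) /
        (of_int (A $ 2 $ 1) * \<tau> + of_int (A $ 2 $ 2)))"

text \<open>\<open>f(\<tau>) = \<Sum>m. c m * q ^ (m / h)\<close> with \<open>q = exp (2 \<pi> \<i> \<tau>)\<close>; for \<open>h > 0\<close>
  the coefficients \<open>c\<close> are uniquely determined by \<open>f\<close> and \<open>h\<close>.\<close>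

definition has_fourier_expansion :: "(complex \<Rightarrow> complex) \<Rightarrow> nat \<Rightarrow> (nat \<Rightarrow> complex) \<Rightarrow> bool" where
  "has_fourier_expansion f h c \<longleftrightarrow>
     (\<forall>\<tau>\<in>upper_half_plane.
        (\<lambda>m. c m * exp (2 * of_real pi * \<i> * \<tau> * of_nat m / of_nat h)) sums f \<tau>)"

text \<open>Every cusp is \<open>A \<infinity>\<close> for some \<open>A\<close> in \<open>SL\<^sub>2(\<int>)\<close>, and the behaviour of \<open>f\<close> there is
  that of \<open>slash k A f\<close> at infinity.\<close>

definition holomorphic_at_cusps :: "int \<Rightarrow> (complex \<Rightarrow> complex) \<Rightarrow> bool" where
  "holomorphic_at_cusps k f \<longleftrightarrow>
     (\<forall>A\<in>carrier SL2Z. \<exists>h>0. \<exists>c. has_fourier_expansion (slash k A f) h c)"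

definition modular_forms_Gamma0_2 ::
    "int \<Rightarrow> ((int^2^2) set \<Rightarrow> complex) \<Rightarrow> (complex \<Rightarrow> complex) set" where
  "modular_forms_Gamma0_2 k chi =
     {f. f holomorphic_on upper_half_plane \<and>
         (\<forall>A\<in>carrier SL2Z. bar A \<in> carrier barGamma0_2 \<longrightarrow>
            (\<forall>\<tau>\<in>upper_half_plane. slash k A f \<tau> = chi (bar A) * f \<tau>)) \<and>
         holomorphic_at_cusps k f}"

definition congruence_modular_form :: "int \<Rightarrow> (complex \<Rightarrow> complex) \<Rightarrow> bool" where
  "congruence_modular_form k f \<longleftrightarrow>
     f holomorphic_on upper_half_plane \<and> holomorphic_at_cusps k f \<and>
     (\<exists>G. congruence_subgroup G \<and>
        (\<forall>A\<in>G. \<forall>\<tau>\<in>upper_half_plane. slash k A f \<tau> = f \<tau>))"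

definition algebraic_integer_ring :: "complex ring" where
  "algebraic_integer_ring =
     \<lparr>carrier = {x. algebraic_int x}, mult = (*), one = 1, zero = 0, add = (+)\<rparr>"

text \<open>Integrality at a prime is taken in the ring of all algebraic integers, which avoids
  choosing a number field: for a number field \<open>K\<close> containing \<open>x\<close>, every prime of \<open>K\<close> is the
  contraction of some prime \<open>P\<close> of this ring, and \<open>x\<close> is integral at \<open>P\<close> iff it is
  integral at the contraction of \<open>P\<close> to \<open>K\<close>.\<close>

definition prime_above :: "nat \<Rightarrow> complex set \<Rightarrow> bool" where
  "prime_above p P \<longleftrightarrow> primeideal P algebraic_integer_ring \<and> of_nat p \<in> P"

definition integral_at :: "complex set \<Rightarrow> complex \<Rightarrow> bool" where
  "integral_at P x \<longleftrightarrow>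
     (\<exists>a b. algebraic_int a \<and> algebraic_int b \<and> b \<notin> P \<and> x = a / b)"

definition unbounded_denominators_at :: "nat \<Rightarrow> (nat \<Rightarrow> complex) \<Rightarrow> bool" where
  "unbounded_denominators_at p c \<longleftrightarrow>
     (\<forall>N::nat. \<exists>m P. prime_above p P \<and> \<not> integral_at P (of_nat p ^ N * c m))"

definition bounded_denominators :: "(nat \<Rightarrow> complex) \<Rightarrow> bool" where
  "bounded_denominators c \<longleftrightarrow> (\<exists>D::int. D \<noteq> 0 \<and> (\<forall>m. algebraic_int (of_int D * c m)))"

end

(* Let h = q^-1 (E(q)/E(q^2))^24 with E(q) = prod (1 - q^m) be the Hauptmodul of Gamma_0(2) and
   write lam = exp(2 pi i a/n) with a coprime to n. Multiplying f by h^(a/n), by a power of a theta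
   product and by powers of h and of an Eisenstein series of weight 2 yields a Gamma_0(2)-invariant
   function of weight 0, which is a polynomial in h. (The Eisenstein series absorbs a sign;
   its zero in the upper half-plane is harmless, as only its q-expansion has to be inverted.) Up to a power of q this
   gives f = Z C Y, where Z = (E(q)/E(q^2))^(-24a/n), C is a unit of Z[[q]] and Y is a
   series which is integral after multiplication by an integer, because triangularity makes the
   coefficients of the polynomial algebraic. Now Z^n is integral, and the linear coefficient 24a/n
   of Z is p-integral for all p exactly if n divides 24. If p divides its denominator, then
   Y cannot clear the denominators of Z: bounded denominators of Z C Y would make Z almost integral
   at a prime P above p, hence all powers of 24a/n would have bounded P-denominators.
   A character of Gamma_0(2) is trivial on a principal congruence subgroup iff lam^24 = 1: the eta
   multiplier gives an explicit formula on such characters, and conversely conjugating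
   T by diagonal matrices modulo M gives chi(T)^(a^2) = chi(T) for all units a modulo M. *)
theory Submission
  imports Defs "Jordan_Normal_Form.Char_Poly"
begin

text \<open>The series Y cannot simply be divided out of Z C Y, since its lowest coefficient need
  not be a unit at P. Only almost integrality of Z is available, with a power of a multiple of Y as
  multiplier. It leads to a contradiction because a nonzero algebraic number is not divisible by
  every power of p. In the ring of all algebraic integers P is not finitely generated and there is
  no discrete valuation to quote, so this is proved by passing to a rational integer. The number 24
  has two sources: the exponent in h, and the fact that 24 is the largest modulus all of whose units
  have square 1. The weight is even because -1 acts trivially; hence a power of a weight two form
  can cancel it. Fractional powers of h and of eta are taken through holomorphic logarithms on the
  upper half-plane. The inversion of log eta comes from the reflection formula of the digamma
  function by way of E_2. With the Fricke involution W one has U = W T^-1 W, so behaviour under U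
  and at the cusp 0 is read off from translation of tau -> F(W tau).\<close>

section \<open>Algebraic integers\<close>

text \<open>The characteristic polynomial of an integer matrix is monic with integer coefficients.
  In module terms, the \<open>v j\<close> generate a finite Z-module stable under multiplication by
  \<open>x\<close>.\<close>

lemma algebraic_int_eigenvalue:
  fixes x :: complex and v :: "nat \<Rightarrow> complex" and A :: "nat \<Rightarrow> nat \<Rightarrow> int"
  assumes eq: "\<And>i. i < N \<Longrightarrow> x * v i = (\<Sum>j<N. of_int (A i j) * v j)"
    and i0: "i0 < N" "v i0 \<noteq> 0"
  shows "algebraic_int x"
proof -
  define B :: "int mat" where "B = Matrix.mat N N (\<lambda>(i,j). A i j)"
  define Bc :: "complex mat" where "Bc = map_mat of_int B"
  define u where "u = Matrix.vec N v"
  have B: "B \<in> carrier_mat N N" by (simp add: B_def)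
  then have Bc: "Bc \<in> carrier_mat N N" by (simp add: Bc_def)
  have "eigenvector Bc u x"
    unfolding eigenvector_def
  proof (intro conjI)
    show "u \<in> carrier_vec (dim_row Bc)" using Bc by (simp add: u_def)
    show "u \<noteq> 0\<^sub>v (dim_row Bc)"
    proof
      assume "u = 0\<^sub>v (dim_row Bc)"
      then have "vec_index u i0 = 0" using i0 Bc by simp
      then show False using i0 by (simp add: u_def)
    qed
    show "Bc *\<^sub>v u = x \<cdot>\<^sub>v u"
    proof (rule Matrix.eq_vecI)
      show "dim_vec (Bc *\<^sub>v u) = dim_vec (x \<cdot>\<^sub>v u)" using Bc by (simp add: u_def)
      fix i assume "i < dim_vec (x \<cdot>\<^sub>v u)"
      then have i: "i < N" by (simp add: u_def)
      have "vec_index (Bc *\<^sub>v u) i = (\<Sum>j<N. of_int (A i j) * v j)"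
        using i by (simp add: Bc_def B_def u_def scalar_prod_def lessThan_atLeast0)
      then show "vec_index (Bc *\<^sub>v u) i = vec_index (x \<cdot>\<^sub>v u) i"
        using eq[OF i] i by (simp add: u_def)
    qed
  qed
  then have "poly (char_poly Bc) x = 0"
    using eigenvalue_root_char_poly[OF Bc] by (auto simp: eigenvalue_def)
  moreover have "char_poly Bc = of_int_poly (char_poly B)"
    unfolding Bc_def by (rule of_int_hom.char_poly_hom[OF B])
  ultimately have "poly (of_int_poly (char_poly B)) x = 0" by simp
  then show ?thesis
    unfolding algebraic_int_altdef_ipoly using degree_monic_char_poly[OF B] by auto
qed

lemma algebraic_int_eigenvalue':
  fixes x :: complex and v :: "'i \<Rightarrow> complex" and A :: "'i \<Rightarrow> 'i \<Rightarrow> int"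
  assumes fin: "finite I"
    and eq: "\<And>i. i \<in> I \<Longrightarrow> x * v i = (\<Sum>j\<in>I. of_int (A i j) * v j)"
    and i0: "i0 \<in> I" "v i0 \<noteq> 0"
  shows "algebraic_int x"
proof -
  obtain b where b: "bij_betw b {..<card I} I"
    using ex_bij_betw_nat_finite[OF fin] by (auto simp: lessThan_atLeast0)
  obtain k where k: "k < card I" "b k = i0"
    using b i0 unfolding bij_betw_def by (metis imageE lessThan_iff)
  show ?thesis
  proof (rule algebraic_int_eigenvalue[where v = "v \<circ> b" and A = "\<lambda>i j. A (b i) (b j)"])
    fix i assume "i < card I"
    then have "b i \<in> I" using b by (auto simp: bij_betw_def)
    then show "x * (v \<circ> b) i = (\<Sum>j<card I. of_int (A (b i) (b j)) * (v \<circ> b) j)"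
      using eq sum.reindex_bij_betw[OF b, of "\<lambda>j. of_int (A (b i) j) * v j"] by simp
  qed (use k i0 in auto)
qed

text \<open>A monic relation makes the span of the powers below \<open>N\<close> stable under
  \<open>y\<close>. The companion matrix is returned too, because sums and products of algebraic
  integers are built from two such matrices.\<close>

lemma algebraic_int_power_relation:
  fixes y :: complex
  assumes y: "y ^ N = (\<Sum>i<N. of_int (g i) * y ^ i)" and N: "N > 0"
  shows "algebraic_int y"
    and "\<exists>A :: nat \<Rightarrow> nat \<Rightarrow> int. \<forall>i<N. y * y ^ i = (\<Sum>j<N. of_int (A i j) * y ^ j)"
proof -
  define A where "A i j = (if Suc i < N then (if j = Suc i then 1 else 0) else g j)" for i j
  have eq: "y * y ^ i = (\<Sum>j<N. of_int (A i j) * y ^ j)" if "i < N" for i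
  proof (cases "Suc i < N")
    case True
    then have "(\<Sum>j<N. of_int (A i j) * y ^ j) = (\<Sum>j<N. if j = Suc i then y ^ j else 0)"
      by (intro sum.cong) (auto simp: A_def)
    with True show ?thesis by simp
  next
    case False
    with that have "Suc i = N" by simp
    with y show ?thesis by (auto simp: A_def power_Suc[symmetric] simp del: power_Suc)
  qed
  then show "\<exists>A :: nat \<Rightarrow> nat \<Rightarrow> int. \<forall>i<N. y * y ^ i = (\<Sum>j<N. of_int (A i j) * y ^ j)" by blast
  show "algebraic_int y"
    by (rule algebraic_int_eigenvalue[of N, where v = "\<lambda>i. y ^ i" and A = A and ?i0.0 = 0])
      (use eq N in auto)
qed

lemma algebraic_int_companion:
  fixes a :: complex
  assumes "algebraic_int a"
  obtains N and A :: "nat \<Rightarrow> nat \<Rightarrow> int" where "N > 0"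
    and "\<And>i. i < N \<Longrightarrow> a * a ^ i = (\<Sum>j<N. of_int (A i j) * a ^ j)"
proof -
  obtain p where p: "poly (of_int_poly p) a = 0" "lead_coeff p = 1"
    using assms unfolding algebraic_int_altdef_ipoly by blast
  have N: "degree p > 0"
  proof (rule ccontr)
    assume "\<not> degree p > 0"
    then obtain c where "p = [:c:]" using degree_eq_zeroE by blast
    then show False using p by auto
  qed
  have "0 = (\<Sum>i\<le>degree p. of_int (coeff p i) * a ^ i)"
    using p by (simp add: poly_altdef)
  also have "\<dots> = (\<Sum>i<degree p. of_int (coeff p i) * a ^ i) + a ^ degree p"
    using p(2) by (simp add: lessThan_Suc_atMost[symmetric])
  finally have "a ^ degree p = (\<Sum>i<degree p. of_int (- coeff p i) * a ^ i)"
    by (simp add: sum_negf add_eq_0_iff)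
  from algebraic_int_power_relation(2)[OF this N] that N show ?thesis by blast
qed

text \<open>The monomials \<open>a ^ i * b ^ j\<close> span a module stable under both numbers:
  \<open>a + b\<close> is an eigenvalue of the Kronecker sum of the companion matrices, and
  \<open>a * b\<close> of their Kronecker product.\<close>

lemma
  fixes a b :: complex
  assumes "algebraic_int a" "algebraic_int b"
  shows algebraic_int_add: "algebraic_int (a + b)"
    and algebraic_int_mult: "algebraic_int (a * b)"
proof -
  obtain N A where N: "N > 0"
    and A: "\<And>i. i < N \<Longrightarrow> a * a ^ i = (\<Sum>j<N. of_int (A i j) * a ^ j)"
    using algebraic_int_companion[OF assms(1)] by metis
  obtain M B where M: "M > 0"
    and B: "\<And>i. i < M \<Longrightarrow> b * b ^ i = (\<Sum>j<M. of_int (B i j) * b ^ j)"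
    using algebraic_int_companion[OF assms(2)] by metis
  let ?I = "{..<N} \<times> {..<M}"
  let ?v = "\<lambda>(i, j). a ^ i * b ^ j"
  let ?S = "\<lambda>(i, j) (i', j'). (if j' = j then A i i' else 0) + (if i' = i then B j j' else 0)"
  let ?P = "\<lambda>(i, j) (i', j'). A i i' * B j j'"
  show "algebraic_int (a + b)"
  proof (rule algebraic_int_eigenvalue'[of ?I _ ?v ?S "(0, 0)"])
    fix ij assume "ij \<in> ?I"
    then obtain i j where ij: "ij = (i, j)" "i < N" "j < M" by auto
    have "(\<Sum>x\<in>?I. of_int (?S ij x) * ?v x)
        = (\<Sum>i'<N. \<Sum>j'<M. (if j' = j then of_int (A i i') * a ^ i' * b ^ j' else 0)
             + (if i' = i then of_int (B j j') * a ^ i' * b ^ j' else 0))"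
      unfolding sum.cartesian_product by (intro sum.cong) (auto simp: ij ring_distribs)
    also have "\<dots> = (\<Sum>i'<N. \<Sum>j'<M. if j' = j then of_int (A i i') * a ^ i' * b ^ j' else 0)
        + (\<Sum>i'<N. \<Sum>j'<M. if i' = i then of_int (B j j') * a ^ i' * b ^ j' else 0)"
      by (simp add: sum.distrib)
    also have "(\<Sum>i'<N. \<Sum>j'<M. if i' = i then of_int (B j j') * a ^ i' * b ^ j' else 0)
        = (\<Sum>j'<M. \<Sum>i'<N. if i' = i then of_int (B j j') * a ^ i' * b ^ j' else 0)"
      by (rule sum.swap)
    also have "(\<Sum>i'<N. \<Sum>j'<M. if j' = j then of_int (A i i') * a ^ i' * b ^ j' else 0)
        = (a * a ^ i) * b ^ j"
      using ij by (simp add: A sum_distrib_right del: power_Suc)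
    also have "(\<Sum>j'<M. \<Sum>i'<N. if i' = i then of_int (B j j') * a ^ i' * b ^ j' else 0)
        = a ^ i * (b * b ^ j)"
      using ij by (simp add: B sum_distrib_left mult_ac)
    finally show "(a + b) * ?v ij = (\<Sum>x\<in>?I. of_int (?S ij x) * ?v x)"
      by (simp add: ij algebra_simps)
  qed (use N M in auto)
  show "algebraic_int (a * b)"
  proof (rule algebraic_int_eigenvalue'[of ?I _ ?v ?P "(0, 0)"])
    fix ij assume "ij \<in> ?I"
    then obtain i j where ij: "ij = (i, j)" "i < N" "j < M" by auto
    have "a * b * ?v ij = (a * a ^ i) * (b * b ^ j)" by (simp add: ij)
    also have "\<dots> = (\<Sum>i'<N. \<Sum>j'<M. (of_int (A i i') * a ^ i') * (of_int (B j j') * b ^ j'))"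
      using ij A[of i] B[of j] by (simp add: sum_product)
    also have "\<dots> = (\<Sum>x\<in>?I. of_int (?P ij x) * ?v x)"
      unfolding sum.cartesian_product by (intro sum.cong) (auto simp: ij)
    finally show "a * b * ?v ij = (\<Sum>x\<in>?I. of_int (?P ij x) * ?v x)" .
  qed (use N M in auto)
qed

lemma algebraic_int_power: "algebraic_int (a :: complex) \<Longrightarrow> algebraic_int (a ^ k)"
  by (induction k) (auto intro: algebraic_int_mult algebraic_int_1)

text \<open>Multiplying an integer relation of degree \<open>N\<close> for \<open>x\<close> by the
  power \<open>N - 1\<close> of its leading coefficient \<open>l\<close> gives a monic relation for
  \<open>l * x\<close>. Conversely, if \<open>p\<close> kills \<open>d * x\<close>, then p(d X)
  kills \<open>x\<close>.\<close>

lemma algebraic_iff_int_multiple: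
  fixes x :: complex
  shows "algebraic x \<longleftrightarrow> (\<exists>d::int. d \<noteq> 0 \<and> algebraic_int (of_int d * x))"
proof
  assume "algebraic x"
  then obtain p :: "int poly" where p: "poly (of_int_poly p) x = 0" "p \<noteq> 0"
    by (elim algebraicE')
  define N l where "N = degree p" and "l = lead_coeff p"
  have l: "l \<noteq> 0" using p by (simp add: l_def)
  have N: "N > 0"
  proof (rule ccontr)
    assume "\<not> N > 0"
    then have "degree p = 0" by (simp add: N_def)
    then obtain c where "p = [:c:]" by (rule degree_eq_zeroE)
    then show False using p by auto
  qed
  define y where "y = of_int l * x"
  have "0 = (\<Sum>i\<le>N. of_int (coeff p i) * x ^ i)"
    using p by (simp add: poly_altdef N_def)
  also have "\<dots> = (\<Sum>i<N. of_int (coeff p i) * x ^ i) + of_int l * x ^ N"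
    by (simp add: lessThan_Suc_atMost[symmetric] N_def l_def)
  finally have rel: "of_int l * x ^ N = (\<Sum>i<N. of_int (- coeff p i) * x ^ i)"
    by (simp add: sum_negf add_eq_0_iff)
  have "y ^ N = of_int l ^ (N - 1) * (of_int l * x ^ N)"
    using N by (cases N) (auto simp: y_def power_mult_distrib)
  also have "\<dots> = (\<Sum>i<N. of_int (- coeff p i * l ^ (N - 1 - i)) * y ^ i)"
    unfolding rel sum_distrib_left
  proof (intro sum.cong refl)
    fix i assume "i \<in> {..<N}"
    then have "N - 1 = (N - 1 - i) + i" by auto
    then have "(of_int l :: complex) ^ (N - 1) = of_int l ^ (N - 1 - i) * of_int l ^ i"
      by (metis power_add)
    then show "of_int l ^ (N - 1) * (of_int (- coeff p i) * x ^ i)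
        = of_int (- coeff p i * l ^ (N - 1 - i)) * y ^ i"
      by (simp add: y_def power_mult_distrib)
  qed
  finally have "algebraic_int y"
    by (rule algebraic_int_power_relation(1)[OF _ N])
  then show "\<exists>d::int. d \<noteq> 0 \<and> algebraic_int (of_int d * x)"
    using l y_def by blast
next
  assume "\<exists>d::int. d \<noteq> 0 \<and> algebraic_int (of_int d * x)"
  then obtain d :: int where d: "d \<noteq> 0" "algebraic_int (of_int d * x)" by blast
  then obtain p :: "int poly" where p: "poly (of_int_poly p) (of_int d * x) = 0" "p \<noteq> 0"
    by (meson algebraicE' algebraic_int_imp_algebraic)
  have "poly (of_int_poly (p \<circ>\<^sub>p [:0, d:])) x = 0"
    using p by (simp add: of_int_hom.map_poly_pcompose poly_pcompose of_int_hom.map_poly_pCons_hom mult.commute)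
  moreover have "p \<circ>\<^sub>p [:0, d:] \<noteq> 0"
    using p d by (simp add: pcompose_eq_0_iff)
  ultimately show "algebraic x" by (intro algebraicI[of "of_int_poly (p \<circ>\<^sub>p [:0, d:])"]) auto
qed

lemma algebraic_add:
  fixes a b :: complex
  assumes "algebraic a" "algebraic b"
  shows "algebraic (a + b)"
proof -
  obtain d e :: int where d: "d \<noteq> 0" "algebraic_int (of_int d * a)"
    and e: "e \<noteq> 0" "algebraic_int (of_int e * b)"
    using assms unfolding algebraic_iff_int_multiple by blast
  have "of_int (d * e) * (a + b) = of_int e * (of_int d * a) + of_int d * (of_int e * b)"
    by (simp add: algebra_simps)
  then have "algebraic_int (of_int (d * e) * (a + b))"
    using d e by (auto intro!: algebraic_int_add algebraic_int_mult algebraic_int_of_int)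
  then show ?thesis unfolding algebraic_iff_int_multiple using d e by (intro exI[of _ "d * e"]) auto
qed

lemma algebraic_mult:
  fixes a b :: complex
  assumes "algebraic a" "algebraic b"
  shows "algebraic (a * b)"
proof -
  obtain d e :: int where d: "d \<noteq> 0" "algebraic_int (of_int d * a)"
    and e: "e \<noteq> 0" "algebraic_int (of_int e * b)"
    using assms unfolding algebraic_iff_int_multiple by blast
  have "of_int (d * e) * (a * b) = (of_int d * a) * (of_int e * b)"
    by (simp add: algebra_simps)
  then have "algebraic_int (of_int (d * e) * (a * b))"
    using algebraic_int_mult[OF d(2) e(2)] by metis
  then show ?thesis unfolding algebraic_iff_int_multiple using d e by (intro exI[of _ "d * e"]) auto
qed

lemma algebraic_sum:
  "(\<And>i. i \<in> I \<Longrightarrow> algebraic (g i :: complex)) \<Longrightarrow> algebraic (sum g I)"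
  by (induction I rule: infinite_finite_induct) (auto intro: algebraic_add)

lemma algebraic_diff: "algebraic (a :: complex) \<Longrightarrow> algebraic b \<Longrightarrow> algebraic (a - b)"
  using algebraic_add[of a "- b"] algebraic_minus[of b] by simp

lemma common_denominator:
  fixes g :: "'i \<Rightarrow> complex"
  assumes "finite I" "\<And>i. i \<in> I \<Longrightarrow> algebraic (g i)"
  shows "\<exists>D::int. D \<noteq> 0 \<and> (\<forall>i\<in>I. algebraic_int (of_int D * g i))"
  using assms
proof (induction I rule: finite_induct)
  case empty
  then show ?case by (intro exI[of _ 1]) auto
next
  case (insert x F)
  then obtain D :: int where D: "D \<noteq> 0" "\<And>i. i \<in> F \<Longrightarrow> algebraic_int (of_int D * g i)" by auto
  obtain d :: int where d: "d \<noteq> 0" "algebraic_int (of_int d * g x)"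
    using insert.prems algebraic_iff_int_multiple by blast
  have "algebraic_int (of_int (D * d) * g i)" if "i \<in> insert x F" for i
  proof (cases "i = x")
    case True
    then show ?thesis
      using algebraic_int_mult[OF algebraic_int_of_int[of D] d(2)] by (simp add: mult_ac)
  next
    case False
    then show ?thesis
      using that algebraic_int_mult[OF algebraic_int_of_int[of d] D(2)[of i]] by (simp add: mult_ac)
  qed
  then show ?case using D d by (intro exI[of _ "D * d"]) auto
qed

section \<open>Primes above p and integrality at them\<close>

lemma algebraic_integer_ring_cring: "cring algebraic_integer_ring"
proof (rule cringI)
  show "abelian_group algebraic_integer_ring"
  proof (rule abelian_groupI)
    fix x assume "x \<in> carrier algebraic_integer_ring"
    then show "\<exists>y\<in>carrier algebraic_integer_ring. y \<oplus>\<^bsub>algebraic_integer_ring\<^esub> x = \<zero>\<^bsub>algebraic_integer_ring\<^esub>"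
      by (intro bexI[of _ "- x"]) (auto simp: algebraic_integer_ring_def)
  qed (auto simp: algebraic_integer_ring_def algebraic_int_add)
  show "Group.comm_monoid algebraic_integer_ring"
    by (rule comm_monoidI)
      (auto simp: algebraic_integer_ring_def algebraic_int_mult algebraic_int_1)
qed (auto simp: algebraic_integer_ring_def algebra_simps)

lemma rational_not_algebraic_int:
  assumes "p > (1 :: nat)"
  shows "\<not> algebraic_int (1 / of_nat p :: complex)"
proof
  assume a: "algebraic_int (1 / of_nat p :: complex)"
  have "(1 / of_nat p :: complex) \<in> \<rat>" by auto
  then have "(1 / of_nat p :: complex) \<in> \<int>"
    using a rational_algebraic_int_is_int by blast
  then obtain k where k: "(1 / of_nat p :: complex) = of_int k" by (auto elim: Ints_cases)
  then have "(of_int (k * int p) :: complex) = of_int 1"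
    using assms by (simp add: field_simps)
  then have "k * int p = 1" by (simp only: of_int_eq_iff)
  then have "int p dvd 1" by (metis dvd_triv_right)
  then show False using assms by simp
qed

text \<open>A set maximal among the proper ideals containing \<open>p\<close>; properness holds for the
  principal ideal of \<open>p\<close> since \<open>1 / p\<close> is not an algebraic integer.\<close>

lemma prime_above_exists:
  assumes p: "p > (1 :: nat)"
  shows "\<exists>P. prime_above p P"
proof -
  let ?O = "{x :: complex. algebraic_int x}"
  define good where "good I \<longleftrightarrow> I \<subseteq> ?O \<and> of_nat p \<in> I \<and> 1 \<notin> I
    \<and> (\<forall>x\<in>I. \<forall>y\<in>I. x + y \<in> I) \<and> (\<forall>x\<in>I. \<forall>r\<in>?O. r * x \<in> I)" for I :: "complex set"
  have "good {of_nat p * x | x. x \<in> ?O}" (is "good ?I0")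
    unfolding good_def
  proof (intro conjI ballI)
    show "?I0 \<subseteq> ?O" by (auto intro: algebraic_int_mult algebraic_int_of_nat)
    show "of_nat p \<in> ?I0" by (auto intro!: exI[of _ 1] algebraic_int_1)
    show "1 \<notin> ?I0"
    proof
      assume "1 \<in> ?I0"
      then obtain x :: complex where x: "algebraic_int x" "of_nat p * x = 1" unfolding mem_Collect_eq by metis
      then have "x = 1 / of_nat p" using p by (simp add: eq_divide_eq mult.commute)
      then show False using rational_not_algebraic_int[OF p] x(1) by simp
    qed
  next
    fix x y assume "x \<in> ?I0" "y \<in> ?I0"
    then obtain a b where "algebraic_int a" "x = of_nat p * a" "algebraic_int b" "y = of_nat p * b"
      by auto
    then show "x + y \<in> ?I0"
      by (auto intro!: exI[of _ "a + b"] algebraic_int_add simp: distrib_left)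
  next
    fix x r assume "x \<in> ?I0" "r \<in> ?O"
    then obtain a where "algebraic_int a" "x = of_nat p * a" "algebraic_int r" by auto
    then show "r * x \<in> ?I0"
      by (auto intro!: exI[of _ "r * a"] algebraic_int_mult)
  qed
  then have ne0: "Collect good \<noteq> {}" by blast
  have "\<Union>C \<in> Collect good" if ne: "C \<noteq> {}" and ch: "subset.chain (Collect good) C" for C
  proof -
    have C: "C \<subseteq> Collect good" and chain: "\<And>X Y. X \<in> C \<Longrightarrow> Y \<in> C \<Longrightarrow> X \<subseteq> Y \<or> Y \<subseteq> X"
      using ch unfolding subset_chain_def by blast+
    show ?thesis
      unfolding mem_Collect_eq good_def
    proof (intro conjI ballI)
      have good: "good X" if "X \<in> C" for X using C that by auto
      show "\<Union>C \<subseteq> ?O" "of_nat p \<in> \<Union>C" "1 \<notin> \<Union>C"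
        using good ne unfolding good_def by blast+
      fix x assume x: "x \<in> \<Union>C"
      then obtain X where X: "X \<in> C" "x \<in> X" by auto
      show "r * x \<in> \<Union>C" if "r \<in> ?O" for r
        using X good[OF X(1)] that unfolding good_def by blast
      show "x + y \<in> \<Union>C" if y: "y \<in> \<Union>C" for y
      proof -
        obtain Y where Y: "Y \<in> C" "y \<in> Y" using y by auto
        obtain Z where "Z \<in> C" "x \<in> Z" "y \<in> Z" using chain X Y by blast
        then show ?thesis using good[of Z] unfolding good_def by blast
      qed
    qed
  qed
  from subset_Zorn_nonempty[OF ne0 this] obtain P where P: "good P" and max: "\<And>X. good X \<Longrightarrow> P \<subseteq> X \<Longrightarrow> X = P"
    by auto
  have PO: "P \<subseteq> ?O" and pP: "of_nat p \<in> P" and oneP: "1 \<notin> P"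
    and addP: "\<And>x y. x \<in> P \<Longrightarrow> y \<in> P \<Longrightarrow> x + y \<in> P"
    and multP: "\<And>x r. x \<in> P \<Longrightarrow> algebraic_int r \<Longrightarrow> r * x \<in> P"
    using P unfolding good_def by auto
  have zeroP: "0 \<in> P" using multP[OF pP, of 0] by simp
  have prime: "a \<in> P \<or> b \<in> P" if ab: "algebraic_int a" "algebraic_int b" "a * b \<in> P" for a b
  \<comment> \<open>For \<open>a\<close> outside \<open>P\<close> the ideal \<open>P + (a)\<close>
    is strictly larger, so by maximality it contains 1. Multiplying \<open>1 = m + r * a\<close> by
    \<open>b\<close> then puts \<open>b\<close> into \<open>P\<close>.\<close>
  proof (rule ccontr)
    assume neg: "\<not> (a \<in> P \<or> b \<in> P)"
    let ?J = "{m + r * a | m r. m \<in> P \<and> algebraic_int r}"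
    have sub: "P \<subseteq> ?J"
    proof
      fix m assume "m \<in> P"
      then have "m = m + 0 * a \<and> m \<in> P \<and> algebraic_int (0 :: complex)" by simp
      then show "m \<in> ?J" by blast
    qed
    have "a = 0 + 1 * a \<and> 0 \<in> P \<and> algebraic_int (1 :: complex)" using zeroP algebraic_int_1 by simp
    then have "a \<in> ?J" by blast
    then have notgood: "\<not> good ?J" using max[of ?J] sub neg by blast
    have JO: "?J \<subseteq> ?O" using PO ab by (auto intro!: algebraic_int_add algebraic_int_mult)
    have addJ: "x + y \<in> ?J" if xy: "x \<in> ?J" "y \<in> ?J" for x y
    proof -
      obtain m r m' r' where "m \<in> P" "algebraic_int r" "x = m + r * a"
        "m' \<in> P" "algebraic_int r'" "y = m' + r' * a" using xy by blast
      then have "x + y = (m + m') + (r + r') * a" "m + m' \<in> P" "algebraic_int (r + r')"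
        by (auto intro: addP algebraic_int_add simp: algebra_simps)
      then show ?thesis by blast
    qed
    have multJ: "s * x \<in> ?J" if xs: "x \<in> ?J" "algebraic_int s" for x s
    proof -
      obtain m r where "m \<in> P" "algebraic_int r" "x = m + r * a" using xs by blast
      then have "s * x = s * m + (s * r) * a" "s * m \<in> P" "algebraic_int (s * r)"
        using \<open>m \<in> P\<close> \<open>algebraic_int r\<close> xs(2) multP algebraic_int_mult
          \<open>x = m + r * a\<close> by (simp_all add: distrib_left mult.assoc)
      then show ?thesis by blast
    qed
    have "1 \<in> ?J"
    proof (rule ccontr)
      assume "1 \<notin> ?J"
      then have "good ?J"
        unfolding good_def
      proof (intro conjI ballI)
        show "?J \<subseteq> ?O" by (rule JO)
        show "of_nat p \<in> ?J" using sub pP by (rule subsetD)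
        show "1 \<notin> ?J" by fact
        show "x + y \<in> ?J" if "x \<in> ?J" "y \<in> ?J" for x y using that by (rule addJ)
        show "r * x \<in> ?J" if "x \<in> ?J" "r \<in> ?O" for x r
          using that(1) that(2)[unfolded mem_Collect_eq] by (rule multJ)
      qed
      then show False using notgood by contradiction
    qed
    then obtain m r where "m \<in> P" "algebraic_int r" "1 = m + r * a" by blast
    then have "b * (m + r * a) = b" by simp
    then have "b * m + r * (a * b) = b" by (simp add: algebra_simps)
    moreover have "b * m + r * (a * b) \<in> P"
      by (intro addP multP \<open>m \<in> P\<close> \<open>algebraic_int r\<close> ab)
    ultimately have "b \<in> P" by simp
    then show False using neg by simp
  qed
  have car: "carrier algebraic_integer_ring = ?O" by (simp add: algebraic_integer_ring_def)
  have "ideal P algebraic_integer_ring"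
  proof (rule idealI)
    show "Ring.ring algebraic_integer_ring"
      using algebraic_integer_ring_cring by (rule cring.axioms)
    have inv: "inv\<^bsub>add_monoid algebraic_integer_ring\<^esub> x = - x" if "x \<in> P" for x
    proof -
      interpret cring algebraic_integer_ring by (rule algebraic_integer_ring_cring)
      have x: "x \<in> ?O" using that PO by auto
      then have "\<ominus>\<^bsub>algebraic_integer_ring\<^esub> x = - x"
        by (intro minus_equality) (auto simp: algebraic_integer_ring_def)
      then show ?thesis by (simp add: a_inv_def)
    qed
    show "subgroup P (add_monoid algebraic_integer_ring)"
    proof
      show "P \<subseteq> carrier (add_monoid algebraic_integer_ring)" using PO by (simp add: car)
      show "x \<otimes>\<^bsub>add_monoid algebraic_integer_ring\<^esub> y \<in> P" if "x \<in> P" "y \<in> P" for x y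
        using addP that by (simp add: algebraic_integer_ring_def)
      show "\<one>\<^bsub>add_monoid algebraic_integer_ring\<^esub> \<in> P"
        using zeroP by (simp add: algebraic_integer_ring_def)
      show "inv\<^bsub>add_monoid algebraic_integer_ring\<^esub> x \<in> P" if "x \<in> P" for x
        using inv[OF that] multP[OF that, of "-1"] by (simp add: algebraic_int_minus algebraic_int_1)
    qed
    fix a x assume "a \<in> P" "x \<in> carrier algebraic_integer_ring"
    then show "x \<otimes>\<^bsub>algebraic_integer_ring\<^esub> a \<in> P" "a \<otimes>\<^bsub>algebraic_integer_ring\<^esub> x \<in> P"
      using multP[of a x] by (auto simp: algebraic_integer_ring_def mult.commute)
  qed
  then have "primeideal P algebraic_integer_ring"
  proof (rule primeidealI)
    show "carrier algebraic_integer_ring \<noteq> P"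
      using oneP algebraic_int_1 by (auto simp: car)
  qed (use algebraic_integer_ring_cring prime in \<open>auto simp: algebraic_integer_ring_def\<close>)
  then show ?thesis using pP unfolding prime_above_def by blast
qed

lemma prime_aboveD:
  assumes "prime_above p P"
  shows "of_nat p \<in> P" "1 \<notin> P" "0 \<in> P"
    and "\<And>x. x \<in> P \<Longrightarrow> algebraic_int x"
    and "\<And>x y. x \<in> P \<Longrightarrow> y \<in> P \<Longrightarrow> x + y \<in> P"
    and "\<And>x r. x \<in> P \<Longrightarrow> algebraic_int r \<Longrightarrow> r * x \<in> P"
    and "\<And>a b. algebraic_int a \<Longrightarrow> algebraic_int b \<Longrightarrow> a * b \<in> P \<Longrightarrow> a \<in> P \<or> b \<in> P"
proof -
  interpret primeideal P algebraic_integer_ring using assms by (simp add: prime_above_def)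
  show "of_nat p \<in> P" using assms by (simp add: prime_above_def)
  show "1 \<notin> P" using I_notcarr one_imp_carrier by (auto simp: algebraic_integer_ring_def)
  show "0 \<in> P" using additive_subgroup.zero_closed[OF is_additive_subgroup] by (simp add: algebraic_integer_ring_def)
  show "\<And>x. x \<in> P \<Longrightarrow> algebraic_int x" using a_subset by (auto simp: algebraic_integer_ring_def)
  show "\<And>x y. x \<in> P \<Longrightarrow> y \<in> P \<Longrightarrow> x + y \<in> P"
    using additive_subgroup.a_closed[OF is_additive_subgroup] by (simp add: algebraic_integer_ring_def)
  show "\<And>x r. x \<in> P \<Longrightarrow> algebraic_int r \<Longrightarrow> r * x \<in> P"
    using I_l_closed by (simp add: algebraic_integer_ring_def)
  show "\<And>a b. algebraic_int a \<Longrightarrow> algebraic_int b \<Longrightarrow> a * b \<in> P \<Longrightarrow> a \<in> P \<or> b \<in> P"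
    using I_prime by (simp add: algebraic_integer_ring_def)
qed

text \<open>By Bezout, 1 would otherwise be a combination of two elements of
  \<open>P\<close>.\<close>

lemma int_notin_prime_above:
  assumes P: "prime_above p P" and "coprime t (int p)"
  shows "of_int t \<notin> P"
proof
  assume t: "of_int t \<in> P"
  obtain x y where "x * t + y * int p = 1"
    using bezout_int[of t "int p"] assms(2) by (auto simp: coprime_iff_gcd_eq_1)
  then have "of_int x * of_int t + of_int y * of_nat p = (1 :: complex)"
    by (metis of_int_1 of_int_add of_int_mult of_int_of_nat_eq)
  then show False
    using prime_aboveD[OF P] t algebraic_int_of_int by metis
qed

lemma integral_at_algebraic_int: "prime_above p P \<Longrightarrow> algebraic_int x \<Longrightarrow> integral_at P x"
  unfolding integral_at_def
  using prime_aboveD(2) algebraic_int_1 by (intro exI[of _ x] exI[of _ 1]) auto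

lemma
  assumes P: "prime_above p P" and xy: "integral_at P x" "integral_at P y"
  shows integral_at_add: "integral_at P (x + y)" and integral_at_mult: "integral_at P (x * y)"
proof -
  obtain a b where a: "algebraic_int a" "algebraic_int b" "b \<notin> P" "x = a / b"
    using xy by (auto simp: integral_at_def)
  obtain c d where c: "algebraic_int c" "algebraic_int d" "d \<notin> P" "y = c / d"
    using xy by (auto simp: integral_at_def)
  have bd: "b * d \<notin> P" "algebraic_int (b * d)" using a c prime_aboveD(7)[OF P] algebraic_int_mult by auto
  have "b \<noteq> 0" "d \<noteq> 0" using a c prime_aboveD(3)[OF P] by auto
  then have "x + y = (a * d + c * b) / (b * d)" using a c by (simp add: field_simps)
  then show "integral_at P (x + y)"
    unfolding integral_at_def using a c bd by (metis algebraic_int_add algebraic_int_mult)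
  have "x * y = (a * c) / (b * d)" using a c by simp
  then show "integral_at P (x * y)"
    unfolding integral_at_def using a c bd by (metis algebraic_int_mult)
qed

lemma integral_at_power:
  assumes "prime_above p P" "integral_at P x"
  shows "integral_at P (x ^ k)"
  by (induction k)
    (auto intro: integral_at_mult[OF assms(1)] integral_at_algebraic_int[OF assms(1)] algebraic_int_1 assms(2))

text \<open>Replaces finiteness of a P-adic valuation. Some algebraic integer times \<open>g\<close>
  is a nonzero rational integer \<open>d\<close>. If \<open>g\<close> were divisible by all powers
  of \<open>p\<close> at \<open>P\<close>, so would be \<open>d\<close>; removing the exact power of
  \<open>p\<close> from \<open>d\<close> would leave an integer prime to \<open>p\<close> inside
  \<open>P\<close>.\<close>

lemma not_infinitely_divisible:
  assumes P: "prime_above p P" and p: "prime p" and g: "algebraic g" "g \<noteq> 0"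
  shows "\<exists>i. \<not> integral_at P (g / of_nat p ^ i)"
proof (rule ccontr)
  assume "\<not> ?thesis"
  then have all: "integral_at P (g / of_nat p ^ i)" for i by simp
  obtain d :: int where d: "d \<noteq> 0" "algebraic_int (of_int d * inverse g)"
    using g algebraic_inverse algebraic_iff_int_multiple by blast
  have int: "integral_at P (of_int d / of_nat p ^ i)" for i
    using integral_at_mult[OF P integral_at_algebraic_int[OF P d(2)] all[of i]] g(2)
    by (simp add: field_simps)
  obtain e t where t: "d = int p ^ e * t" "\<not> int p dvd t"
    using multiplicity_decompose'[of d "int p"] d(1) p
    by (metis prime_nat_int_transfer not_prime_unit)
  \<comment> \<open>One power of \<open>p\<close> more than \<open>d\<close> contains.\<close>
  have "integral_at P (of_int t / of_nat p)"
    using int[of "Suc e"] p by (simp add: t field_simps prime_gt_0_nat)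
  then obtain a b where ab: "algebraic_int a" "algebraic_int b" "b \<notin> P" "of_int t / of_nat p = a / b"
    by (auto simp: integral_at_def)
  have "b \<noteq> 0" using ab prime_aboveD(3)[OF P] by auto
  then have "of_int t * b = a * of_nat p" using ab(4) p by (simp add: field_simps prime_gt_0_nat)
  then have "of_int t * b \<in> P" using prime_aboveD(1,6)[OF P] ab by metis
  then have "of_int t \<in> P" using prime_aboveD(7)[OF P] ab algebraic_int_of_int by metis
  moreover have "coprime t (int p)"
    using t(2) p by (metis coprime_commute prime_imp_coprime prime_nat_int_transfer)
  ultimately show False using int_notin_prime_above[OF P] by blast
qed

section \<open>Power series over subrings of the complex numbers\<close>

text \<open>A subring of the complex numbers; negation comes from multiplication by -1. The
  instances are Z, the algebraic integers, the algebraic numbers and the numbers integral at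
  \<open>P\<close>.\<close>

definition closed_coeffs :: "complex set \<Rightarrow> bool" where
  "closed_coeffs S \<longleftrightarrow> \<int> \<subseteq> S \<and> (\<forall>x\<in>S. \<forall>y\<in>S. x + y \<in> S \<and> x * y \<in> S)"

definition coeffs_in :: "complex set \<Rightarrow> complex fps \<Rightarrow> bool" where
  "coeffs_in S F \<longleftrightarrow> (\<forall>j. fps_nth F j \<in> S)"

lemma closed_coeffs_Ints: "closed_coeffs \<int>"
  by (auto simp: closed_coeffs_def)

lemma closed_coeffs_algebraic_int: "closed_coeffs {x. algebraic_int x}"
  by (auto simp: closed_coeffs_def algebraic_int_add algebraic_int_mult int_imp_algebraic_int)

lemma closed_coeffs_algebraic: "closed_coeffs {x. algebraic x}"
  by (auto simp: closed_coeffs_def algebraic_add algebraic_mult int_imp_algebraic_int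
      algebraic_int_imp_algebraic)

lemma closed_coeffs_integral_at: "prime_above p P \<Longrightarrow> closed_coeffs {x. integral_at P x}"
  by (auto simp: closed_coeffs_def integral_at_add integral_at_mult integral_at_algebraic_int
      int_imp_algebraic_int)

lemma coeffs_in_mono: "coeffs_in S F \<Longrightarrow> S \<subseteq> T \<Longrightarrow> coeffs_in T F"
  by (auto simp: coeffs_in_def)

lemma closed_coeffs_sum:
  "closed_coeffs S \<Longrightarrow> (\<And>i. i \<in> I \<Longrightarrow> g i \<in> S) \<Longrightarrow> sum g I \<in> S"
  by (induction I rule: infinite_finite_induct) (auto simp: closed_coeffs_def)

lemma closed_coeffs_uminus: "closed_coeffs S \<Longrightarrow> x \<in> S \<Longrightarrow> - x \<in> S"
  unfolding closed_coeffs_def by (metis Ints_1 Ints_minus mult_minus1 subsetD)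

context
  fixes S :: "complex set"
  assumes S: "closed_coeffs S"
begin

lemma coeffs_in_add: "coeffs_in S F \<Longrightarrow> coeffs_in S G \<Longrightarrow> coeffs_in S (F + G)"
  using S by (auto simp: coeffs_in_def closed_coeffs_def)

lemma coeffs_in_uminus: "coeffs_in S F \<Longrightarrow> coeffs_in S (- F)"
  using closed_coeffs_uminus[OF S] by (auto simp: coeffs_in_def)

lemma coeffs_in_diff: "coeffs_in S F \<Longrightarrow> coeffs_in S G \<Longrightarrow> coeffs_in S (F - G)"
  using coeffs_in_add[of F "- G"] coeffs_in_uminus[of G] by simp

lemma coeffs_in_const: "x \<in> S \<Longrightarrow> coeffs_in S (fps_const x)"
  using S by (auto simp: coeffs_in_def closed_coeffs_def)

lemma coeffs_in_1: "coeffs_in S 1"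
  using S by (auto simp: coeffs_in_def closed_coeffs_def)

lemma coeffs_in_X: "coeffs_in S fps_X"
  using S by (auto simp: coeffs_in_def closed_coeffs_def fps_X_def)

lemma coeffs_in_mult: "coeffs_in S F \<Longrightarrow> coeffs_in S G \<Longrightarrow> coeffs_in S (F * G)"
  using S by (auto simp: coeffs_in_def fps_mult_nth closed_coeffs_def intro!: closed_coeffs_sum[OF S])

lemma coeffs_in_power: "coeffs_in S F \<Longrightarrow> coeffs_in S (F ^ k)"
  by (induction k) (auto intro: coeffs_in_1 coeffs_in_mult)

lemma coeffs_in_sum: "(\<And>i. i \<in> I \<Longrightarrow> coeffs_in S (g i)) \<Longrightarrow> coeffs_in S (sum g I)"
  by (auto simp: coeffs_in_def fps_sum_nth intro!: closed_coeffs_sum[OF S])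

text \<open>With constant coefficient 1 the recursion for the inverse series involves no
  division.\<close>

lemma coeffs_in_inverse:
  assumes F: "coeffs_in S F" "fps_nth F 0 = 1"
  shows "coeffs_in S (inverse F)"
proof -
  have eq: "F * inverse F = 1" using F(2) by (simp add: inverse_mult_eq_1' )
  have "fps_nth (inverse F) m \<in> S" for m
  proof (induction m rule: less_induct)
    case (less m)
    show ?case
    proof (cases m)
      case 0
      then show ?thesis using F(2) S by (auto simp: closed_coeffs_def)
    next
      case (Suc k)
      have "0 = fps_nth (F * inverse F) m" using eq Suc by simp
      also have "\<dots> = fps_nth (inverse F) m + (\<Sum>i=1..m. fps_nth F i * fps_nth (inverse F) (m - i))"
        unfolding fps_mult_nth by (subst sum.atLeast_Suc_atMost) (auto simp: F(2))
      finally have "fps_nth (inverse F) m = - (\<Sum>i=1..m. fps_nth F i * fps_nth (inverse F) (m - i))"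
        by (simp add: eq_neg_iff_add_eq_0)
      moreover have "(\<Sum>i=1..m. fps_nth F i * fps_nth (inverse F) (m - i)) \<in> S"
      proof (rule closed_coeffs_sum[OF S])
        fix i assume "i \<in> {1..m}"
        then have "fps_nth (inverse F) (m - i) \<in> S" by (intro less.IH) auto
        then show "fps_nth F i * fps_nth (inverse F) (m - i) \<in> S"
          using F(1) S by (auto simp: coeffs_in_def closed_coeffs_def)
      qed
      ultimately show ?thesis using closed_coeffs_uminus[OF S] by simp
    qed
  qed
  then show ?thesis by (simp add: coeffs_in_def)
qed

end

text \<open>The logarithmic derivative of \<open>Z ^ n = V\<close> gives the recursion \<open>n V Z' = V' Z\<close>.\<close>

lemma coeffs_algebraic_root:
  assumes ZV: "Z ^ n = V" "n > 0" and V: "coeffs_in {x. algebraic x} V"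
    and Z0: "fps_nth Z 0 = (1 :: complex)"
  shows "coeffs_in {x. algebraic x} Z"
proof -
  have V0: "fps_nth V 0 = 1" using ZV(1) Z0 by (auto simp: fps_power_zeroth)
  have deq: "fps_deriv V * Z = fps_const (of_nat n) * (V * fps_deriv Z)"
  proof -
    have "fps_deriv V * Z = of_nat n * fps_deriv Z * (Z ^ (n - 1) * Z)"
      by (simp add: ZV(1)[symmetric] fps_deriv_power' mult_ac)
    also have "Z ^ (n - 1) * Z = V" using ZV by (metis Suc_diff_1 power_Suc2)
    finally show ?thesis by (simp add: mult_ac fps_of_nat)
  qed
  have rec: "(\<Sum>i=0..m. fps_nth (fps_deriv V) i * fps_nth Z (m - i))
      = of_nat n * (\<Sum>i=0..m. fps_nth V i * (of_nat (m - i + 1) * fps_nth Z (m - i + 1)))" for m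
  proof -
    have "fps_nth (fps_deriv V * Z) m = of_nat n * fps_nth (V * fps_deriv Z) m"
      unfolding deq by simp
    then show ?thesis unfolding fps_mult_nth fps_deriv_nth by simp
  qed
  note cl = closed_coeffs_algebraic
  have alg_nat: "algebraic (of_nat k :: complex)" for k
    using algebraic_int_of_nat algebraic_int_imp_algebraic by blast
  have "algebraic (fps_nth Z m)" for m
  proof (induction m rule: less_induct)
    case (less m)
    show ?case
    proof (cases m)
      case 0
      then show ?thesis using Z0 algebraic_int_1 algebraic_int_imp_algebraic by auto
    next
      case (Suc k)
      define A where "A = (\<Sum>i=0..k. fps_nth (fps_deriv V) i * fps_nth Z (k - i))"
      define B where "B = (\<Sum>i=1..k. fps_nth V i * (of_nat (k - i + 1) * fps_nth Z (k - i + 1)))"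
      \<comment> \<open>Since \<open>V\<close> has constant coefficient 1, the term
        \<open>i = 0\<close> of the recursion isolates the new coefficient of \<open>Z\<close>; all
        other terms contain earlier ones only.\<close>
      have "A = of_nat n * (of_nat m * fps_nth Z m + B)"
        unfolding A_def B_def rec by (subst sum.atLeast_Suc_atMost) (auto simp: V0 Suc)
      then have "A - of_nat n * B = of_nat (n * m) * fps_nth Z m"
        by (simp add: distrib_left)
      moreover have "(of_nat (n * m) :: complex) \<noteq> 0"
        unfolding of_nat_eq_0_iff using ZV(2) Suc by simp
      ultimately have eq: "fps_nth Z m = (A - of_nat n * B) * inverse (of_nat (n * m))"
        by (metis nonzero_mult_div_cancel_left divide_inverse)
      have "algebraic A"
        unfolding A_def
      proof (rule algebraic_sum)
        fix i assume "i \<in> {0..k}"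
        then have "algebraic (fps_nth Z (k - i))" using Suc by (intro less.IH) auto
        moreover have "algebraic (fps_nth (fps_deriv V) i)"
          using V by (auto simp: coeffs_in_def fps_deriv_nth simp del: of_nat_Suc intro!: algebraic_mult alg_nat)
        ultimately show "algebraic (fps_nth (fps_deriv V) i * fps_nth Z (k - i))"
          by (rule algebraic_mult[rotated])
      qed
      moreover have "algebraic B"
        unfolding B_def
      proof (rule algebraic_sum)
        fix i assume "i \<in> {1..k}"
        then have "algebraic (fps_nth Z (k - i + 1))" using Suc by (intro less.IH) auto
        then show "algebraic (fps_nth V i * (of_nat (k - i + 1) * fps_nth Z (k - i + 1)))"
          using V by (auto simp: coeffs_in_def simp del: of_nat_Suc intro!: algebraic_mult alg_nat)
      qed
      ultimately show ?thesis
        unfolding eq by (intro algebraic_mult algebraic_diff alg_nat algebraic_inverse)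
    qed
  qed
  then show ?thesis by (simp add: coeffs_in_def)
qed

text \<open>As \<open>H k\<close> starts with 1 and is shifted by \<open>d - k\<close>, the
  coefficient in degree \<open>d - i\<close> is \<open>b i\<close> plus an integer combination of
  the \<open>b k\<close> with \<open>k > i\<close>. Descending induction from \<open>i = d\<close>
  recovers every \<open>b i\<close>.\<close>

lemma coeffs_algebraic_triangular:
  assumes Y: "coeffs_in {x. algebraic x} (\<Sum>i\<le>d. fps_const (b i) * fps_X ^ (d - i) * H i)"
    and H: "\<And>i. coeffs_in \<int> (H i)" "\<And>i. fps_nth (H i) 0 = 1"
  shows "i \<le> d \<Longrightarrow> algebraic (b i)"
proof (induction "d - i" arbitrary: i rule: less_induct)
  case less
  define m where "m = d - i"
  let ?t = "\<lambda>k. fps_nth (fps_const (b k) * fps_X ^ (d - k) * H k) m"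
  have t: "?t k = (if k < i then 0 else b k * fps_nth (H k) (k - i))" if "k \<le> d" for k
  proof -
    have "fps_const (b k) * fps_X ^ (d - k) * H k = fps_X ^ (d - k) * (fps_const (b k) * H k)"
      by (simp add: mult_ac)
    moreover have "m < d - k \<longleftrightarrow> k < i" using that less.prems by (auto simp: m_def)
    moreover have "m - (d - k) = k - i" if "\<not> k < i" using \<open>k \<le> d\<close> less.prems that by (auto simp: m_def)
    ultimately show ?thesis by (simp only: fps_X_power_mult_nth) simp
  qed
  have "algebraic (\<Sum>k\<le>d. ?t k)" using Y by (auto simp: coeffs_in_def fps_sum_nth)
  also have "(\<Sum>k\<le>d. ?t k) = b i + (\<Sum>k\<in>{Suc i..d}. b k * fps_nth (H k) (k - i))"
  proof -
    have "(\<Sum>k\<le>d. ?t k) = (\<Sum>k\<in>{i..d}. ?t k)"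
      by (rule sum.mono_neutral_right) (auto simp: t simp del: fps_mult_nth)
    also have "\<dots> = ?t i + (\<Sum>k\<in>{Suc i..d}. ?t k)"
      using less.prems by (rule sum.atLeast_Suc_atMost)
    also have "?t i = b i" using t[of i] less.prems H(2) by simp
    also have "(\<Sum>k\<in>{Suc i..d}. ?t k) = (\<Sum>k\<in>{Suc i..d}. b k * fps_nth (H k) (k - i))"
      by (intro sum.cong) (auto simp: t)
    finally show ?thesis .
  qed
  finally have "algebraic (b i + (\<Sum>k\<in>{Suc i..d}. b k * fps_nth (H k) (k - i)))" .
  moreover have "algebraic (\<Sum>k\<in>{Suc i..d}. b k * fps_nth (H k) (k - i))"
    using H(1) by (intro algebraic_sum algebraic_mult less.hyps)
      (auto simp: coeffs_in_def intro!: algebraic_int_imp_algebraic int_imp_algebraic_int)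
  ultimately show ?case using algebraic_diff by fastforce
qed

text \<open>\<open>Z * C\<close> is invertible over the algebraic numbers, so \<open>Y\<close>
  inherits algebraic coefficients from \<open>R\<close>, and with it the \<open>b i\<close>. There
  are finitely many of these and the \<open>H i\<close> are integral, so one integer clears all
  denominators of \<open>Y\<close>.\<close>

lemma bounded_triangular:
  assumes R: "R = Z * C * Y" and Y_def: "Y = (\<Sum>i\<le>d. fps_const (b i) * fps_X ^ (d - i) * H i)"
    and H: "\<And>i. coeffs_in \<int> (H i)" "\<And>i. fps_nth (H i) 0 = 1"
    and C: "coeffs_in \<int> C" "fps_nth C 0 = 1"
    and Z: "coeffs_in {x. algebraic x} Z" "fps_nth Z 0 = 1"
    and alg: "coeffs_in {x. algebraic x} R"
  shows "\<exists>D::int. D \<noteq> 0 \<and> coeffs_in {x. algebraic_int x} (fps_const (of_int D) * Y)"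
proof -
  have Za: "coeffs_in {x. algebraic x} (inverse (Z * C))"
    using Z C closed_coeffs_algebraic
    by (intro coeffs_in_inverse coeffs_in_mult) (auto intro: coeffs_in_mono simp: closed_coeffs_def)
  have "inverse (Z * C) * (Z * C) = 1"
    by (rule inverse_mult_eq_1) (auto simp: Z C)
  then have "Y = inverse (Z * C) * R" by (simp add: R mult.assoc[symmetric])
  then have "coeffs_in {x. algebraic x} Y"
    using coeffs_in_mult[OF closed_coeffs_algebraic Za alg] by simp
  then have "\<And>i. i \<le> d \<Longrightarrow> algebraic (b i)"
    unfolding Y_def using coeffs_algebraic_triangular H by blast
  then obtain D :: int where D: "D \<noteq> 0" "\<And>i. i \<le> d \<Longrightarrow> algebraic_int (of_int D * b i)"
    using common_denominator[of "{..d}" b] by auto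
  have "fps_const (of_int D) * Y = (\<Sum>i\<le>d. fps_const (of_int D * b i) * fps_X ^ (d - i) * H i)"
    by (simp add: Y_def sum_distrib_left mult.assoc[symmetric])
  also have "coeffs_in {x. algebraic_int x} \<dots>"
    using closed_coeffs_algebraic_int D(2)
    by (intro coeffs_in_sum coeffs_in_mult coeffs_in_power coeffs_in_X coeffs_in_const)
      (auto intro: coeffs_in_mono[OF H(1)] int_imp_algebraic_int)
  finally show ?thesis using D(1) by blast
qed

text \<open>\<open>Z\<close> is almost integral over the power series with coefficients integral at \<open>P\<close>: with
  \<open>G = (p ^ N D Y) ^ (n - 1)\<close> all \<open>G Z ^ i\<close> have integral coefficients, hence so do all
  \<open>G (Z - 1) ^ i\<close>, whose lowest coefficient is the \<open>i\<close>-th power of the linear coefficient of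
  \<open>Z\<close> times the lowest coefficient of \<open>G\<close>.\<close>

lemma unbounded_root:
  assumes p: "prime p" and P: "prime_above p P"
    and ZV: "Z ^ n = V" "n > 0" and V: "coeffs_in \<int> V" and Z0: "fps_nth Z 0 = 1"
    and Z1: "of_int (int p * u) * fps_nth Z 1 = of_int t" "coprime t (int p)"
    and C: "coeffs_in \<int> C" "fps_nth C 0 = 1"
    and Y: "D \<noteq> 0" "coeffs_in {x. algebraic_int x} (fps_const (of_int D) * Y)" "Y \<noteq> 0"
    and R: "R = Z * C * Y"
  shows "\<exists>j. \<not> integral_at P (of_nat p ^ N * fps_nth R j)"
proof (rule ccontr)
  assume "\<not> ?thesis"
  then have int: "integral_at P (of_nat p ^ N * fps_nth R j)" for j by simp
  let ?O = "{x. integral_at P x}"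
  note cl = closed_coeffs_integral_at[OF P]
  have O_int: "x \<in> ?O" if "algebraic_int x" for x using integral_at_algebraic_int[OF P that] by simp
  have Z_O: "\<int> \<subseteq> ?O" using O_int int_imp_algebraic_int by blast
  \<comment> \<open>\<open>B\<close> has integral coefficients, and so does \<open>Z * B\<close>: it
    equals \<open>D\<close> times \<open>p ^ N * R\<close> divided by the unit
    \<open>C\<close>.\<close>
  define B where "B = fps_const (of_nat p ^ N) * (fps_const (of_int D) * Y)"
  have B_int: "coeffs_in {x. algebraic_int x} B"
    unfolding B_def using closed_coeffs_algebraic_int Y(2)
    by (intro coeffs_in_mult[OF closed_coeffs_algebraic_int _ Y(2)] coeffs_in_const)
      (auto intro: algebraic_int_power algebraic_int_of_nat)
  then have B_O: "coeffs_in ?O B" by (rule coeffs_in_mono) (use O_int in auto)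
  have PR: "coeffs_in ?O (fps_const (of_nat p ^ N) * R)"
    using int by (simp add: coeffs_in_def)
  have "coeffs_in ?O (fps_const (of_int D) * (fps_const (of_nat p ^ N) * R) * inverse C)"
    using C
    by (intro coeffs_in_mult[OF cl coeffs_in_mult[OF cl coeffs_in_const[OF cl] PR] coeffs_in_inverse[OF cl]]
          O_int algebraic_int_of_int coeffs_in_mono[OF C(1) Z_O])
  also have "fps_const (of_int D) * (fps_const (of_nat p ^ N) * R) * inverse C
      = Z * B * (C * inverse C)"
    by (simp add: R B_def mult_ac)
  also have "C * inverse C = 1" using C by (simp add: inverse_mult_eq_1')
  finally have ZB: "coeffs_in ?O (Z * B)" by simp
  \<comment> \<open>Exponents of \<open>Z\<close> can be reduced modulo \<open>n\<close> by
    \<open>Z ^ n = V\<close>, so at most \<open>n - 1\<close> factors \<open>B\<close> are ever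
    needed.\<close>
  define G where "G = B ^ (n - 1)"
  have GZ: "coeffs_in ?O (Z ^ i * G)" for i
  proof -
    define j where "j = i mod n"
    have j: "j \<le> n - 1" using ZV(2) unfolding j_def by (metis Suc_pred' less_Suc_eq_le mod_less_divisor)
    have "Z ^ i = V ^ (i div n) * Z ^ j"
      unfolding j_def ZV(1)[symmetric] power_mult[symmetric] power_add[symmetric] by simp
    moreover have "Z ^ j * G = (Z * B) ^ j * B ^ (n - 1 - j)"
      using power_add[of B j "n - 1 - j"] le_add_diff_inverse[OF j]
      by (simp only: G_def power_mult_distrib mult.assoc)
    ultimately have "Z ^ i * G = V ^ (i div n) * ((Z * B) ^ j * B ^ (n - 1 - j))"
      by (simp add: mult.assoc)
    then show ?thesis
      using cl ZB B_O coeffs_in_mono[OF V Z_O] by (auto intro!: coeffs_in_mult coeffs_in_power)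
  qed
  have GZ1: "coeffs_in ?O ((Z - 1) ^ i * G)" for i
  proof -
    have "(Z - 1) ^ i * G = (\<Sum>k\<le>i. of_nat (i choose k) * (-1) ^ (i - k) * (Z ^ k * G))"
      unfolding diff_conv_add_uminus binomial_ring sum_distrib_right
      by (intro sum.cong) (auto simp: mult_ac)
    also have "coeffs_in ?O \<dots>"
    proof (rule coeffs_in_sum[OF cl])
      fix k
      have 1: "coeffs_in ?O (of_nat (i choose k))"
        using coeffs_in_const[OF cl O_int[OF algebraic_int_of_nat[of "i choose k"]]]
        by (simp add: fps_of_nat)
      have 2: "coeffs_in ?O ((-1) ^ (i - k))"
        by (intro coeffs_in_power coeffs_in_uminus coeffs_in_1 cl)
      show "coeffs_in ?O (of_nat (i choose k) * (-1) ^ (i - k) * (Z ^ k * G))"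
        by (intro coeffs_in_mult cl 1 2 GZ)
    qed
    finally show ?thesis .
  qed
  have "B \<noteq> 0" using Y p by (auto simp: B_def fps_eq_iff)
  then have "G \<noteq> 0" by (simp add: G_def)
  define s g where "s = subdegree G" and "g = fps_nth G s"
  have g: "g \<noteq> 0" using \<open>G \<noteq> 0\<close> by (simp add: g_def s_def)
  have "coeffs_in {x. algebraic_int x} G"
    unfolding G_def by (intro coeffs_in_power closed_coeffs_algebraic_int B_int)
  then have g_alg: "algebraic g" by (auto simp: g_def coeffs_in_def)
  define \<alpha> where "\<alpha> = fps_nth Z 1"
  have pow: "\<alpha> ^ i * g \<in> ?O" for i
  proof -
    \<comment> \<open>\<open>Z - 1\<close> is divisible by X. In degree \<open>i + s\<close> of
      \<open>(Z - 1) ^ i * G\<close> only the product of the constant coefficient of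
      \<open>W ^ i\<close> and the lowest coefficient \<open>g\<close> of \<open>G\<close>
      survives.\<close>
    define W where "W = fps_shift 1 (Z - 1)"
    have W: "Z - 1 = fps_X * W"
      unfolding W_def using Z0
      by (intro fps_ext) (auto simp: fps_X_mult_nth)
    have W0: "fps_nth W 0 = \<alpha>" by (simp add: W_def \<alpha>_def)
    have "fps_nth ((Z - 1) ^ i * G) (i + s) = fps_nth (W ^ i * G) s"
      unfolding W power_mult_distrib mult.assoc fps_X_power_mult_nth by simp
    also have "\<dots> = (\<Sum>k=0..s. fps_nth (W ^ i) k * fps_nth G (s - k))"
      by (rule fps_mult_nth)
    also have "\<dots> = (\<Sum>k\<in>{0}. fps_nth (W ^ i) k * fps_nth G (s - k))"
    proof (rule sum.mono_neutral_right)
      show "\<forall>k\<in>{0..s} - {0}. fps_nth (W ^ i) k * fps_nth G (s - k) = 0"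
      proof
        fix k assume "k \<in> {0..s} - {0}"
        then have "s - k < subdegree G" unfolding s_def by auto
        then show "fps_nth (W ^ i) k * fps_nth G (s - k) = 0"
          by (simp only: nth_less_subdegree_zero mult_zero_right)
      qed
    qed auto
    also have "\<dots> = \<alpha> ^ i * g" by (simp add: fps_power_zeroth W0 g_def)
    finally show ?thesis using GZ1[of i] unfolding coeffs_in_def by metis
  qed
  have t0: "t \<noteq> 0" using Z1(2) p by (auto simp: not_prime_unit)
  have inv_t: "integral_at P (1 / of_int t)"
    unfolding integral_at_def using int_notin_prime_above[OF P Z1(2)] algebraic_int_1 algebraic_int_of_int
    by blast
  \<comment> \<open>The linear coefficient is t / (p u), so u \<alpha> / t = 1 / p with
    \<open>t\<close> a unit at \<open>P\<close>. Integrality of all \<open>\<alpha> ^ i * g\<close>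
    thus makes \<open>g\<close> divisible by every power of \<open>p\<close>.\<close>
  have "integral_at P (g / of_nat p ^ i)" for i
  proof -
    have "of_int u * \<alpha> * (1 / of_int t) = 1 / of_nat p"
      using Z1(1) t0 p by (simp add: \<alpha>_def field_simps prime_gt_0_nat)
    then have "g / of_nat p ^ i = (of_int u * \<alpha> * (1 / of_int t)) ^ i * g"
      by (simp add: power_one_over)
    also have "\<dots> = of_int u ^ i * ((1 / of_int t) ^ i * (\<alpha> ^ i * g))"
      by (simp only: power_mult_distrib mult_ac)
    finally have eq: "g / of_nat p ^ i = of_int u ^ i * ((1 / of_int t) ^ i * (\<alpha> ^ i * g))" .
    have "integral_at P (\<alpha> ^ i * g)" using pow by simp
    then show ?thesis
      unfolding eq
      using integral_at_mult[OF P integral_at_power[OF P integral_at_algebraic_int[OF P algebraic_int_of_int]]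
          integral_at_mult[OF P integral_at_power[OF P inv_t]]]
      by blast
  qed
  then show False using not_infinitely_divisible[OF P p g_alg g] by blast
qed

section \<open>Characters of \<open>\<Gamma>\<^sub>0(2)\<close>\<close>

hide_const (open) Matrix.mat Matrix.vec Determinant.det Matrix.row Matrix.col
hide_type (open) Matrix.mat Matrix.vec
no_notation Matrix.vec_index (infixl "$" 100)
no_notation fps_nth (infixl "$" 75)

section \<open>Integer two-by-two matrices and the groups built from them\<close>

definition mat2 :: "int \<Rightarrow> int \<Rightarrow> int \<Rightarrow> int \<Rightarrow> int^2^2" where
  "mat2 a b c d = vector [vector [a, b], vector [c, d]]"

lemma mat2_nth [simp]:
  "mat2 a b c d $ 1 $ 1 = a" "mat2 a b c d $ 1 $ 2 = b"
  "mat2 a b c d $ 2 $ 1 = c" "mat2 a b c d $ 2 $ 2 = d"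
  by (simp_all add: mat2_def)

lemma mat2_eta: "A = mat2 (A $ 1 $ 1) (A $ 1 $ 2) (A $ 2 $ 1) (A $ 2 $ 2)"
  by (simp add: Finite_Cartesian_Product.vec_eq_iff forall_2)

lemma mat2_eq_iff: "mat2 a b c d = mat2 a' b' c' d' \<longleftrightarrow> a = a' \<and> b = b' \<and> c = c' \<and> d = d'"
  by (metis mat2_nth)

lemma mat2_mult:
  "mat2 a b c d ** mat2 a' b' c' d' = mat2 (a*a' + b*c') (a*b' + b*d') (c*a' + d*c') (c*b' + d*d')"
  by (simp add: Finite_Cartesian_Product.vec_eq_iff forall_2 matrix_matrix_mult_def sum_2)

lemma mat_1_eq_mat2: "mat 1 = mat2 1 0 0 1"
  by (simp add: Finite_Cartesian_Product.vec_eq_iff forall_2 Finite_Cartesian_Product.mat_def)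

lemma uminus_mat2: "- mat2 a b c d = mat2 (- a) (- b) (- c) (- d)"
  by (simp add: Finite_Cartesian_Product.vec_eq_iff forall_2)

lemma det_mat2: "det (mat2 a b c d) = a * d - b * c"
  by (simp add: det_2)

lemma mat_U_eq: "mat_U = mat2 1 0 2 1" and mat_V_eq: "mat_V = mat2 (-1) 1 (-2) 1"
  by (simp_all add: mat_U_def mat_V_def mat2_def)

lemma SL2Z_carrier: "A \<in> carrier SL2Z \<longleftrightarrow> det A = 1"
  by (simp add: SL2Z_def)

lemma mat2_in_SL2Z: "mat2 a b c d \<in> carrier SL2Z \<longleftrightarrow> a * d - b * c = 1"
  by (simp add: SL2Z_carrier det_mat2)

lemma mat2_in_Gamma0: "mat2 a b c d \<in> Gamma0 2 \<longleftrightarrow> a * d - b * c = 1 \<and> even c"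
  by (simp add: Gamma0_def mat2_in_SL2Z)

lemma bar_eq: "bar A = {A, - A}"
proof -
  obtain a b c d where "A = mat2 a b c d" using mat2_eta by metis
  then show ?thesis
    by (auto simp: bar_def r_coset_def SL2Z_def mat_1_eq_mat2 uminus_mat2 mat2_mult)
qed

lemma bar_uminus: "bar (- A) = bar A"
  by (auto simp: bar_eq)

lemma bar_mult: "bar A \<otimes>\<^bsub>barGamma0_2\<^esub> bar B = bar (A ** B)"
proof -
  obtain a b c d a' b' c' d' where "A = mat2 a b c d" "B = mat2 a' b' c' d'"
    using mat2_eta by metis
  then show ?thesis
    by (auto simp: bar_eq barGamma0_2_def PSL2Z_def FactGroup_def set_mult_def SL2Z_def
        uminus_mat2 mat2_mult)
qed

lemma group_SL2Z: "Group.group SL2Z"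
proof (rule groupI)
  show "x \<otimes>\<^bsub>SL2Z\<^esub> y \<in> carrier SL2Z" if "x \<in> carrier SL2Z" "y \<in> carrier SL2Z" for x y
    using that by (simp add: SL2Z_def det_mul)
  show "\<exists>y\<in>carrier SL2Z. y \<otimes>\<^bsub>SL2Z\<^esub> x = \<one>\<^bsub>SL2Z\<^esub>" if "x \<in> carrier SL2Z" for x
  proof -
    obtain a b c d where x: "x = mat2 a b c d" using mat2_eta by metis
    with that have "mat2 d (- b) (- c) a \<in> carrier SL2Z" "mat2 d (- b) (- c) a ** x = mat 1"
      by (auto simp: mat2_in_SL2Z mat2_mult mat_1_eq_mat2 mat2_eq_iff algebra_simps)
    then show ?thesis by (intro bexI[of _ "mat2 d (- b) (- c) a"]) (auto simp: SL2Z_def)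
  qed
qed (auto simp: SL2Z_def matrix_mul_assoc)

lemma inv_SL2Z:
  assumes "mat2 a b c d \<in> carrier SL2Z"
  shows "inv\<^bsub>SL2Z\<^esub> mat2 a b c d = mat2 d (- b) (- c) a"
  using assms
  by (intro group.inv_equality[OF group_SL2Z])
    (auto simp: mat2_in_SL2Z, auto simp: SL2Z_def mat2_mult mat_1_eq_mat2 mat2_eq_iff algebra_simps)

lemma mat2_in_principal_Gamma:
  "mat2 a b c d \<in> principal_Gamma N \<longleftrightarrow> a * d - b * c = 1 \<and>
     int N dvd a - 1 \<and> int N dvd b \<and> int N dvd c \<and> int N dvd d - 1"
  by (auto simp: principal_Gamma_def mat2_in_SL2Z forall_2 mat_1_eq_mat2 cong_iff_dvd_diff)

lemma congruence_subgroup_principal_Gamma: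
  assumes "N \<ge> 1"
  shows "congruence_subgroup (principal_Gamma N)"
  unfolding congruence_subgroup_def
proof (intro conjI)
  show "subgroup (principal_Gamma N) SL2Z"
  proof
    show "principal_Gamma N \<subseteq> carrier SL2Z" by (auto simp: principal_Gamma_def)
    show "\<one>\<^bsub>SL2Z\<^esub> \<in> principal_Gamma N"
      using mat2_in_principal_Gamma[of 1 0 0 1 N] by (simp add: SL2Z_def mat_1_eq_mat2)
  next
    fix x y assume xy: "x \<in> principal_Gamma N" "y \<in> principal_Gamma N"
    obtain a b c d where x: "x = mat2 a b c d" using mat2_eta by metis
    obtain a' b' c' d' where y: "y = mat2 a' b' c' d'" using mat2_eta by metis
    have "det (x ** y) = 1"
      using xy by (auto simp: det_mul principal_Gamma_def SL2Z_carrier)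
    then have det: "(a*a' + b*c') * (c*b' + d*d') - (a*b' + b*d') * (c*a' + d*c') = 1"
      by (simp add: x y mat2_mult det_mat2)
    have "int N dvd a * (a' - 1) + (a - 1) + b * c'" "int N dvd c * b' + d * (d' - 1) + (d - 1)"
      "int N dvd a*b' + b*d'" "int N dvd c*a' + d*c'"
      using xy by (auto simp: x y mat2_in_principal_Gamma)
    moreover have "a*a' + b*c' - 1 = a * (a' - 1) + (a - 1) + b * c'"
      and "c*b' + d*d' - 1 = c * b' + d * (d' - 1) + (d - 1)"
      by (simp_all add: algebra_simps)
    ultimately show "x \<otimes>\<^bsub>SL2Z\<^esub> y \<in> principal_Gamma N"
      using det by (simp only: SL2Z_def x y mat2_mult mat2_in_principal_Gamma monoid.simps)
  next
    fix x assume x: "x \<in> principal_Gamma N"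
    obtain a b c d where xe: "x = mat2 a b c d" using mat2_eta by metis
    from x have "x \<in> carrier SL2Z" by (simp add: principal_Gamma_def)
    then show "inv\<^bsub>SL2Z\<^esub> x \<in> principal_Gamma N"
      using x by (auto simp: xe inv_SL2Z mat2_in_principal_Gamma algebra_simps)
  qed
  show "\<exists>M\<ge>1. principal_Gamma M \<subseteq> principal_Gamma N" using assms by blast
qed

section \<open>Descent on Gamma_0(2) and the multiplier formula of the eta quotient\<close>

text \<open>Euclidean algorithm on the bottom row \<open>(c, d)\<close>: as \<open>c\<close> is even and \<open>d\<close> odd, one
  of right multiplication by \<open>T\<^sup>\<plusminus>\<^sup>1\<close> and by \<open>U\<^sup>\<plusminus>\<^sup>1\<close> decreases
  \<open>\<bar>c\<bar> + \<bar>d\<bar>\<close> unless \<open>c = 0\<close>.\<close>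

lemma Gamma0_2_induct [consumes 2, case_names one T U neg]:
  fixes a b c d :: int
  assumes "a * d - b * c = 1" "even c"
    and one: "Q 1 0 0 1"
    and T: "\<And>a b c d. a * d - b * c = 1 \<Longrightarrow> even c \<Longrightarrow> Q a b c d \<longleftrightarrow> Q a (a + b) c (c + d)"
    and U: "\<And>a b c d. a * d - b * c = 1 \<Longrightarrow> even c \<Longrightarrow> Q a b c d \<longleftrightarrow> Q (a + 2 * b) b (c + 2 * d) d"
    and neg: "\<And>a b c d. a * d - b * c = 1 \<Longrightarrow> even c \<Longrightarrow> Q a b c d \<longleftrightarrow> Q (- a) (- b) (- c) (- d)"
  shows "Q a b c d"
  using assms(1,2)
proof (induction "nat (\<bar>c\<bar> + \<bar>d\<bar>)" arbitrary: a b c d rule: less_induct)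
  case less
  note det = less.prems(1) and c = less.prems(2)
  have d: "odd d"
  proof
    assume "even d"
    with c have "even (a * d - b * c)" by simp
    with det show False by simp
  qed
  show ?case
  proof (cases "c = 0")
    case True
    \<comment> \<open>For \<open>c = 0\<close> the matrix is a power of T up to sign. The
      assumptions are equivalences so that the induction can step in both directions.\<close>
    have T0: "Q 1 b 0 1" for b
    proof (induction b rule: int_induct[of _ 0])
      case base
      show ?case by (rule one)
    next
      case (step1 i)
      then show ?case using T[of 1 1 i 0] by (simp add: add.commute)
    next
      case (step2 i)
      then show ?case using T[of 1 1 "i - 1" 0] by simp
    qed
    have "a * d = 1" using det True by simp
    then consider "a = 1" "d = 1" | "a = -1" "d = -1" using zmult_eq_1_iff by blast
    then show ?thesis
      using T0[of b] T0[of "- b"] neg[of 1 1 "- b" 0] True by cases auto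
  next
    case False
    show ?thesis
    proof (cases "\<bar>c\<bar> < \<bar>d\<bar>")
      case True
      show ?thesis
      proof (cases "c * d > 0")
        case pos: True
        have "\<bar>d - c\<bar> < \<bar>d\<bar>" using pos True False by (auto simp: zero_less_mult_iff abs_if)
        then have "Q a (b - a) c (d - c)"
          using less.hyps[of c "d - c" a "b - a"] det c by (simp add: algebra_simps)
        then show ?thesis using T[of a "d - c" "b - a" c] det c by (simp add: algebra_simps)
      next
        case neg: False
        have "\<bar>d + c\<bar> < \<bar>d\<bar>" using neg True False by (auto simp: zero_less_mult_iff abs_if split: if_splits)
        then have "Q a (a + b) c (c + d)"
          using less.hyps[of c "c + d" a "a + b"] det c by (simp add: algebra_simps)
        then show ?thesis using T[of a d b c] det c by simp
      qed
    next
      case le: False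
      \<comment> \<open>Different parities exclude equality, so one of the two descents always
        applies.\<close>
      moreover have "\<bar>c\<bar> \<noteq> \<bar>d\<bar>" using c d by (metis even_abs_add_iff even_add abs_eq_iff even_minus)
      ultimately have cd: "\<bar>d\<bar> < \<bar>c\<bar>" by simp
      have d0: "d \<noteq> 0" using d by auto
      show ?thesis
      proof (cases "c * d > 0")
        case pos: True
        have "\<bar>c - 2 * d\<bar> < \<bar>c\<bar>" using pos cd d0 by (auto simp: zero_less_mult_iff abs_if split: if_splits)
        then have "Q (a - 2 * b) b (c - 2 * d) d"
          using less.hyps[of "c - 2 * d" d "a - 2 * b" b] det c by (simp add: algebra_simps)
        then show ?thesis using U[of "a - 2 * b" d b "c - 2 * d"] det c by (simp add: algebra_simps)
      next
        case neg: False
        have "\<bar>c + 2 * d\<bar> < \<bar>c\<bar>" using neg cd d0 by (auto simp: zero_less_mult_iff abs_if split: if_splits)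
        then have "Q (a + 2 * b) b (c + 2 * d) d"
          using less.hyps[of "c + 2 * d" d "a + 2 * b" b] det c by (simp add: algebra_simps)
        then show ?thesis using U[of a d b c] det c by simp
      qed
    qed
  qed
qed

text \<open>The character of \<open>\<eta>(\<tau>) / \<eta>(2\<tau>)\<close> on \<open>\<Gamma>\<^sub>0(2)\<close> is \<open>exp (\<pi> \<i> Psi / 12)\<close>; the formula
  comes from the multiplier of the Dedekind eta function.\<close>

definition Psi :: "int \<Rightarrow> int \<Rightarrow> int \<Rightarrow> int \<Rightarrow> int" where
  "Psi a b c d = (a + d) * (c div 2) - b * d * (2 * (c div 2)^2 + 1) - 3 * (c div 2) * d
     + 3 * ((d^2 - 1) div 2)"

text \<open>If 3 does not divide \<open>x\<close>, then x^2 is 1 and 2 x^2 + 1 is 0 modulo 3. The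
  factor 2 x^2 + 1 occurs in \<open>Psi\<close> with x = c / 2.\<close>

lemma three_dvd_cubic: "(3::int) dvd x * (2 * x^2 + 1)"
proof -
  have "x = 3 * (x div 3) \<or> x = 3 * (x div 3) + 1 \<or> x = 3 * (x div 3) + 2" by presburger
  then obtain y where "x = 3 * y \<or> x = 3 * y + 1 \<or> x = 3 * y + 2" by blast
  then show ?thesis
  proof (elim disjE)
    assume "x = 3 * y"
    then have "x * (2 * x^2 + 1) = 3 * (y * (2 * x^2 + 1))" by simp
    then show ?thesis by (metis dvd_triv_left)
  next
    assume "x = 3 * y + 1"
    then have "x * (2 * x^2 + 1) = 3 * (x * (6*y^2 + 4*y + 1))" by (simp add: power2_eq_square algebra_simps)
    then show ?thesis by (metis dvd_triv_left)
  next
    assume "x = 3 * y + 2"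
    then have "x * (2 * x^2 + 1) = 3 * (x * (6*y^2 + 8*y + 3))" by (simp add: power2_eq_square algebra_simps)
    then show ?thesis by (metis dvd_triv_left)
  qed
qed

lemma dvd_24_iff: "(24::int) dvd x \<longleftrightarrow> 3 dvd x \<and> 8 dvd x"
  by presburger

lemma Psi_parametrised:
  "Psi a b (2 * c) (2 * y + 1) =
     (a + 2*y + 1) * c - b * (2*y + 1) * (2 * c^2 + 1) - 3 * c * (2*y + 1) + 6 * y * (y + 1)"
proof -
  have "((2 * y + 1)^2 - 1) div 2 = 2 * y * (y + 1)"
    by (simp add: power2_eq_square algebra_simps)
  then show ?thesis by (simp add: Psi_def)
qed

lemma odd_of_det:
  assumes "a * d - b * c = (1::int)" "even c"
  shows "odd a" "odd d"
proof -
  have "odd (a * d - b * c)" using assms(1) by simp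
  then show "odd a" "odd d" using assms(2) by auto
qed

text \<open>The eta quotient gains the factor exp(- pi i / 12) under T, so \<open>Psi\<close> must
  drop by 1 modulo 24. With a = 2x + 1, d = 2y + 1, c = 2e the determinant condition reads b e = 2xy
  + x + y, and the moduli 3 and 8 are treated separately.\<close>

lemma Psi_T:
  assumes "a * d - b * c = 1" "even c"
  shows "24 dvd Psi a (a + b) c (c + d) - Psi a b c d + 1"
proof -
  obtain x y e where xy: "a = 2 * x + 1" "d = 2 * y + 1" "c = 2 * e"
    using odd_of_det[OF assms] assms(2) by (meson evenE oddE)
  have det: "b * e = 2 * x * y + x + y" using assms(1) by (simp add: xy algebra_simps)
  have ad: "(2*x + 1) * (2*y + 1) = 1 + 2 * (b * e)" by (simp add: det algebra_simps)
  have cd: "c + d = 2 * (y + e) + 1" by (simp add: xy)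
  have "Psi a (a + b) c (c + d) - Psi a b c d + 1
      = 2 * e^2 - ((2*x+1) * (2*y+1) + 2 * (2*x+1) * e + 2 * (b * e)) * (2 * e^2 + 1) + 12 * y * e + 6 * e + 1"
    unfolding cd unfolding xy Psi_parametrised by (simp add: power2_eq_square algebra_simps)
  also have "\<dots> = 6 * (2*y+1) * e - 2 * (2*x + 1 + 2*b) * (e * (2 * e^2 + 1))"
    unfolding ad by (simp add: power2_eq_square algebra_simps)
  finally have eq: "Psi a (a + b) c (c + d) - Psi a b c d + 1
      = 6 * (2*y+1) * e - 2 * (2*x + 1 + 2*b) * (e * (2 * e^2 + 1))" .
  have "3 dvd Psi a (a + b) c (c + d) - Psi a b c d + 1"
    unfolding eq using three_dvd_cubic[of e] by (intro dvd_diff dvd_mult[of 3 "e * (2 * e\<^sup>2 + 1)"]) auto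
  moreover have "8 dvd Psi a (a + b) c (c + d) - Psi a b c d + 1"
  \<comment> \<open>For even \<open>e\<close> the factor 8 comes out directly. For odd
    \<open>e\<close> it needs \<open>y - x - b\<close> to be even, which is again the determinant
    condition.\<close>
  proof (cases "even e")
    case True
    then obtain s where s: "e = 2 * s" by blast
    have "Psi a (a + b) c (c + d) - Psi a b c d + 1
      = 8 * (s * (3 * y + 1 - x - b) - 4 * (2*x + 1 + 2*b) * s^3)"
      unfolding eq s by (simp add: power2_eq_square power3_eq_cube algebra_simps)
    then show ?thesis by simp
  next
    case False
    then obtain s where s: "e = 2 * s + 1" by (meson oddE)
    define w where "w = 2 * s^2 + 2 * s"
    have e2: "2 * e^2 + 1 = 4 * w + 3" by (simp add: s w_def power2_eq_square algebra_simps)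
    have yx: "y = 2 * s * b + b - 2 * x * y - x" using det by (simp add: s algebra_simps)
    have "3 * (2*y+1) - (2*x + 1 + 2*b) * (4 * w + 3) = 6 * (y - x - b) - 4 * w * (2*x + 1 + 2*b)"
      by (simp add: algebra_simps)
    also have "y - x - b = 2 * (s * b - x * y - x)" using yx by (simp add: algebra_simps)
    finally have "3 * (2*y+1) - (2*x + 1 + 2*b) * (4 * w + 3)
        = 4 * (3 * (s * b - x * y - x) - w * (2*x + 1 + 2*b))" by (simp add: algebra_simps)
    moreover have "Psi a (a + b) c (c + d) - Psi a b c d + 1
        = 2 * e * (3 * (2*y+1) - (2*x + 1 + 2*b) * (4 * w + 3))"
      unfolding eq e2 by (simp add: algebra_simps)
    ultimately have "Psi a (a + b) c (c + d) - Psi a b c d + 1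
        = 8 * (e * (3 * (s * b - x * y - x) - w * (2*x + 1 + 2*b)))" by simp
    then show ?thesis by (metis dvd_triv_left)
  qed
  ultimately show ?thesis by (simp add: dvd_24_iff)
qed

text \<open>The eta quotient gains exp(- pi i / 12) under U as well. Here the difference factors as
  2 (1 - d^2) d (a + b), and d (d^2 - 1) is a multiple of 24 for odd \<open>d\<close>.\<close>

lemma Psi_U:
  assumes "a * d - b * c = 1" "even c"
  shows "24 dvd Psi (a + 2 * b) b (c + 2 * d) d - Psi a b c d + 1"
proof -
  obtain x y e where xy: "a = 2 * x + 1" "d = 2 * y + 1" "c = 2 * e"
    using odd_of_det[OF assms] assms(2) by (meson evenE oddE)
  have det: "b * e = 2 * x * y + x + y" using assms(1) by (simp add: xy algebra_simps)
  have cd: "c + 2 * d = 2 * (e + 2 * y + 1)" by (simp add: xy)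
  have "Psi (a + 2 * b) b (c + 2 * d) d - Psi a b c d + 1
      = 2 * (1 - d^2) * (1 + 2 * (b * e) + b * d) + (a * d - b * c - 1)"
    unfolding cd unfolding xy Psi_parametrised
    by (simp add: power2_eq_square algebra_simps)
  also have "\<dots> = 2 * (1 - d^2) * (1 + 2 * (b * e) + b * d)" using assms(1) by simp
  also have "1 + 2 * (b * e) + b * d = d * (a + b)" by (simp add: det xy algebra_simps)
  finally have eq: "Psi (a + 2 * b) b (c + 2 * d) d - Psi a b c d + 1
      = 2 * ((1 - d^2) * d) * (a + b)" by (simp add: mult_ac)
  have "2 * ((1 - d^2) * d) = - (8 * (y * (y + 1) * (2 * y + 1)))"
    by (simp add: xy power2_eq_square algebra_simps)
  moreover have "3 dvd y * (y + 1) * (2 * y + 1)"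
  proof -
    have "y * (y + 1) * (2 * y + 1) = y * (2 * y^2 + 1) + 3 * y^2"
      by (simp add: power2_eq_square algebra_simps)
    then show ?thesis using three_dvd_cubic[of y] by (simp add: dvd_add)
  qed
  ultimately have "24 dvd 2 * ((1 - d^2) * d)"
    by (metis dvd_24_iff dvd_minus_iff dvd_mult dvd_triv_left)
  then show ?thesis unfolding eq by (rule dvd_mult2)
qed

lemma Psi_uminus: "even c \<Longrightarrow> Psi (- a) (- b) (- c) (- d) = Psi a b c d"
proof (elim evenE)
  fix e assume c: "c = 2 * e"
  then have "- c = 2 * (- e)" by simp
  then have "(- c) div 2 = - e" by presburger
  then show "Psi (- a) (- b) (- c) (- d) = Psi a b c d"
    unfolding Psi_def by (simp add: c algebra_simps)
qed

text \<open>The level is 48 and not 24 because \<open>c\<close> and \<open>d^2 - 1\<close> enter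
  \<open>Psi\<close> halved.\<close>

lemma Psi_principal_Gamma:
  assumes "mat2 a b c d \<in> principal_Gamma 48"
  shows "24 dvd Psi a b c d" "even b"
proof -
  from assms have *: "48 dvd b" "48 dvd c" "48 dvd d - 1" by (auto simp: mat2_in_principal_Gamma)
  obtain b' where b: "b = 48 * b'" using *(1) by (rule dvdE)
  obtain c' where c: "c = 48 * c'" using *(2) by (rule dvdE)
  obtain d' where "d - 1 = 48 * d'" using *(3) by (rule dvdE)
  then have d: "d = 48 * d' + 1" by simp
  have e: "c div 2 = 24 * c'" unfolding c by presburger
  have "d^2 - 1 = 2 * (24 * (48 * d'^2 + 2 * d'))"
    by (simp add: d power2_eq_square algebra_simps)
  then have f: "(d^2 - 1) div 2 = 24 * (48 * d'^2 + 2 * d')" by (metis nonzero_mult_div_cancel_left zero_neq_numeral)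
  have "Psi a b c d = 24 * ((a + d) * c') - 24 * (2 * b' * d * (2 * (24 * c')^2 + 1)) - 24 * (3 * c' * d)
     + 24 * (3 * (48 * d'^2 + 2 * d'))"
    unfolding Psi_def e f by (simp add: b)
  then show "24 dvd Psi a b c d" by (simp only: dvd_add dvd_diff dvd_triv_left)
  show "even b" by (simp add: b)
qed

text \<open>The first factor on the right is g T g^-1 T^(-A^2), where g has rows (A, m) and (c, d).
  It is congruent to the identity modulo every divisor of \<open>c\<close>.\<close>

lemma conjugate_T:
  assumes "A * d - m * c = 1"
  shows "mat2 A m c d ** mat2 1 1 0 1
    = mat2 (1 - A * c) (A^3 * c) (- (c^2)) (1 + A * c + A^2 * c^2) ** (mat2 1 (A^2) 0 1 ** mat2 A m c d)"
proof -
  have "(1 - A*c) * (m + A^2 * d) + A^3 * c * d = A + m + A * (A * d - m * c - 1)"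
    by (simp add: algebra_simps power2_eq_square power3_eq_cube)
  moreover have "- (c^2) * (m + A^2 * d) + (1 + A*c + A^2 * c^2) * d = c + d + c * (A * d - m * c - 1)"
    by (simp add: algebra_simps power2_eq_square)
  moreover have "(1 - A*c) * (A + A^2 * c) + A^3 * c * c = A"
    by (simp add: algebra_simps power2_eq_square power3_eq_cube)
  moreover have "- (c^2) * (A + A^2 * c) + (1 + A*c + A^2 * c^2) * c = c"
    by (simp add: algebra_simps power2_eq_square)
  ultimately show ?thesis
    using assms by (simp add: mat2_mult mat2_eq_iff)
qed

lemma conjugate_T_det:
  "(1 - A * c) * (1 + A * c + A ^ 2 * c^2) - (A ^ 3 * c) * (- (c^2)) = (1 :: int)"
  by (simp add: algebra_simps power2_eq_square power3_eq_cube)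

section \<open>Finite-order characters and congruence subgroups\<close>

context
  fixes chi :: "(int^2^2) set \<Rightarrow> complex"
  assumes chi: "finite_order_character barGamma0_2 chi"
begin

lemma chi_mult:
  assumes "A \<in> Gamma0 2" "B \<in> Gamma0 2"
  shows "chi (bar (A ** B)) = chi (bar A) * chi (bar B)"
proof -
  have "chi \<in> hom barGamma0_2 complex_units" using chi by (simp add: finite_order_character_def)
  moreover have "bar A \<in> carrier barGamma0_2" "bar B \<in> carrier barGamma0_2"
    using assms by (auto simp: barGamma0_2_def)
  ultimately show ?thesis
    unfolding bar_mult[symmetric] by (simp add: hom_def complex_units_def)
qed

lemma chi_nonzero: "A \<in> Gamma0 2 \<Longrightarrow> chi (bar A) \<noteq> 0"
  using chi by (auto simp: finite_order_character_def hom_def complex_units_def barGamma0_2_def Pi_iff)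

lemma chi_one: "chi (bar (mat2 1 0 0 1)) = 1"
  using chi_mult[of "mat2 1 0 0 1" "mat2 1 0 0 1"] chi_nonzero[of "mat2 1 0 0 1"]
  by (simp add: mat2_in_Gamma0 mat2_mult)

lemma chi_T: "chi (bar (mat2 1 1 0 1)) = chi (bar mat_V) * chi (bar mat_U)"
  using chi_mult[of mat_V mat_U] by (simp add: mat_U_eq mat_V_eq mat2_in_Gamma0 mat2_mult)

lemma chi_T_power: "chi (bar (mat2 1 (int m) 0 1)) = chi (bar (mat2 1 1 0 1)) ^ m"
proof (induction m)
  case 0
  then show ?case by (simp add: chi_one)
next
  case (Suc m)
  then show ?case
    using chi_mult[of "mat2 1 1 0 1" "mat2 1 (int m) 0 1"] by (simp add: mat2_in_Gamma0 mat2_mult add.commute)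
qed

text \<open>Both sides change alike along the generators. U contributes \<open>l\<close> and T = V U
  contributes \<open>e * l\<close>; \<open>Psi\<close> drops by 1 modulo 24 in both cases, while the
  parity of \<open>b\<close> changes under T only, because \<open>a\<close> is odd.\<close>

lemma chi_eq_Psi:
  assumes lam: "chi (bar mat_U) ^ 24 = 1" and eps: "chi (bar mat_V) \<in> {1, -1}"
    and A: "a * d - b * c = 1" "even c"
  shows "chi (bar (mat2 a b c d)) = chi (bar mat_U) powi (- Psi a b c d) * chi (bar mat_V) powi b"
proof -
  define l e where "l = chi (bar mat_U)" and "e = chi (bar mat_V)"
  have l0: "l \<noteq> 0" "e \<noteq> 0"
    unfolding l_def e_def by (auto intro!: chi_nonzero simp: mat_U_eq mat_V_eq mat2_in_Gamma0)
  have step: "l powi (- x) = l powi (- y) * l" if "24 dvd x - y + 1" for x y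
  proof -
    obtain k where "x - y + 1 = 24 * k" using \<open>24 dvd x - y + 1\<close> by (rule dvdE)
    then have "- x = (- y) + 1 + 24 * (- k)" by simp
    then have "l powi (- x) = l powi (- y) * l * (l powi 24) powi (- k)"
      using l0(1) by (simp only: power_int_add power_int_mult power_int_1_right simp_thms)
    also have "l powi 24 = 1" using lam by (simp add: l_def)
    finally show ?thesis by simp
  qed
  have T: "chi (bar (mat2 a (a + b) c (c + d))) = chi (bar (mat2 a b c d)) * (e * l)"
    if "a * d - b * c = 1" "even c" for a b c d
    using chi_mult[of "mat2 a b c d" "mat2 1 1 0 1"] chi_T that
    by (simp add: mat2_in_Gamma0 mat2_mult l_def e_def)
  have U: "chi (bar (mat2 (a + 2 * b) b (c + 2 * d) d)) = chi (bar (mat2 a b c d)) * l"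
    if "a * d - b * c = 1" "even c" for a b c d
    using chi_mult[of "mat2 a b c d" "mat2 1 0 2 1"] that
    by (simp add: mat2_in_Gamma0 mat2_mult l_def mat_U_eq mult.commute)
  have e_odd: "e powi (a + b) = e powi b * e" if "odd a" for a b
  proof -
    have "e powi 2 = 1" using eps by (auto simp: e_def)
    moreover obtain x where "a = 2 * x + 1" using \<open>odd a\<close> by (rule oddE)
    ultimately have "e powi a = e" using l0(2) by (simp add: power_int_add power_int_mult)
    then show ?thesis using l0(2) by (simp add: power_int_add)
  qed
  have e_neg: "e powi (- b) = e powi b" for b
    using eps by (auto simp: e_def power_int_minus power_int_minus_left)
  have "chi (bar (mat2 a b c d)) = l powi (- Psi a b c d) * e powi b"
  proof (rule Gamma0_2_induct[OF A, where Q = "\<lambda>a b c d. chi (bar (mat2 a b c d)) = l powi (- Psi a b c d) * e powi b"])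
    show "chi (bar (mat2 1 0 0 1)) = l powi (- Psi 1 0 0 1) * e powi 0"
      by (simp add: chi_one Psi_def)
  next
    fix a b c d :: int assume *: "a * d - b * c = 1" "even c"
    show "(chi (bar (mat2 a b c d)) = l powi (- Psi a b c d) * e powi b) \<longleftrightarrow>
      (chi (bar (mat2 a (a + b) c (c + d))) = l powi (- Psi a (a + b) c (c + d)) * e powi (a + b))"
      unfolding T[OF *] step[OF Psi_T[OF *]] e_odd[OF odd_of_det(1)[OF *]] using l0 by simp
    show "(chi (bar (mat2 a b c d)) = l powi (- Psi a b c d) * e powi b) \<longleftrightarrow>
      (chi (bar (mat2 (a + 2 * b) b (c + 2 * d) d)) = l powi (- Psi (a + 2 * b) b (c + 2 * d) d) * e powi b)"
      unfolding U[OF *] step[OF Psi_U[OF *]] using l0 by simp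
    show "(chi (bar (mat2 a b c d)) = l powi (- Psi a b c d) * e powi b) \<longleftrightarrow>
      (chi (bar (mat2 (- a) (- b) (- c) (- d))) = l powi (- Psi (- a) (- b) (- c) (- d)) * e powi (- b))"
      unfolding Psi_uminus[OF *(2)] e_neg uminus_mat2[symmetric] bar_uminus by (rule refl)
  qed
  then show ?thesis by (simp add: l_def e_def)
qed

lemma chi_trivial_on_principal_Gamma_48:
  assumes "chi (bar mat_U) ^ 24 = 1" "chi (bar mat_V) \<in> {1, -1}" and A: "A \<in> principal_Gamma 48"
  shows "chi (bar A) = 1" "A \<in> Gamma0 2"
proof -
  obtain a b c d where A_eq: "A = mat2 a b c d" using mat2_eta by metis
  then have P: "mat2 a b c d \<in> principal_Gamma 48" using A by simp
  then have *: "a * d - b * c = 1" "48 dvd c" by (auto simp: mat2_in_principal_Gamma)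
  from *(2) have "even c" by presburger
  then show "A \<in> Gamma0 2" by (simp add: A_eq mat2_in_Gamma0 *)
  obtain k where k: "Psi a b c d = 24 * k" using Psi_principal_Gamma(1)[OF P] by (rule dvdE)
  obtain m where m: "b = 2 * m" using Psi_principal_Gamma(2)[OF P] by (rule evenE)
  have "chi (bar mat_U) powi (- Psi a b c d) = (chi (bar mat_U) powi 24) powi (- k)"
    unfolding k by (simp only: power_int_mult mult_minus_right[symmetric])
  moreover have "chi (bar mat_V) powi b = (chi (bar mat_V) powi 2) powi m"
    unfolding m by (simp only: power_int_mult)
  ultimately show "chi (bar A) = 1"
    using chi_eq_Psi[OF assms(1,2) *(1) \<open>even c\<close>] assms(1,2) by (auto simp: A_eq)
qed

text \<open>The residues are chosen for the sake of a^2 - 1: it is 24 modulo the part of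
  \<open>M\<close> prime to 5, and 3 modulo 5 if 5 divides \<open>M\<close>. Hence gcd(M, a^2 - 1)
  divides 24, although 5 itself is not a unit modulo every \<open>M\<close>.\<close>

lemma coprime_crt:
  fixes M :: nat
  assumes "M > 0"
  obtains a e M' where "M = 5 ^ e * M'" "\<not> 5 dvd M'" "[a = 5] (mod M')" "[a = 2] (mod 5 ^ e)"
    "coprime a M" "a > 1"
proof -
  define e M' where "e = multiplicity 5 M" and "M' = M div 5 ^ e"
  have "5 ^ e dvd M" unfolding e_def by (rule multiplicity_dvd)
  then have "M = 5 ^ e * M'" by (simp add: M'_def)
  moreover have "\<not> 5 dvd M'"
    unfolding M'_def e_def using assms by (intro multiplicity_decompose) auto
  ultimately have M': "M = 5 ^ e * M'" "\<not> 5 dvd M'" by blast+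
  have p5: "prime (5::nat)" by simp
  then have cop: "coprime (5::nat) M'" using M'(2) prime_imp_coprime by blast
  then have "coprime M' (5 ^ e)" by (simp add: coprime_commute)
  then obtain a0 where a0: "[a0 = 5] (mod M')" "[a0 = 2] (mod 5 ^ e)"
    using binary_chinese_remainder_nat by blast
  \<comment> \<open>Keeps the residues and makes \<open>a > 1\<close>.\<close>
  define a where "a = a0 + 2 * M"
  have a: "[a = 5] (mod M')" "[a = 2] (mod 5 ^ e)"
    using a0 by (auto simp: a_def M'(1) cong_def mod_add_eq[symmetric] mult.assoc mult.left_commute)
  have "coprime a M'" using a(1) cop by (meson cong_imp_coprime cong_sym)
  moreover have "coprime a (5 ^ e)"
  proof (cases "e = 0")
    case False
    then have "[a = 2] (mod 5)" using a(2) cong_dvd_modulus_nat[of a 2 "5 ^ e" 5] by simp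
    then have "\<not> 5 dvd a" by (auto simp: cong_def)
    then have "coprime 5 a" by (rule prime_imp_coprime[OF p5])
    then show ?thesis by (simp add: coprime_commute)
  qed simp
  ultimately have "coprime a M" by (simp add: M'(1))
  moreover have "a > 1" using assms by (simp add: a_def)
  ultimately show ?thesis using that M' a by blast
qed

text \<open>Modulo \<open>M\<close>, conjugation by a diagonal matrix \<open>(a, 1 / a)\<close> maps \<open>T\<close> to
  \<open>T\<close> to the power \<open>a\<^sup>2\<close>.\<close>

lemma chi_T_square:
  assumes triv: "\<And>A. A \<in> principal_Gamma M \<Longrightarrow> A \<in> Gamma0 2 \<Longrightarrow> chi (bar A) = 1"
    and M: "M > 0" "even M" and a: "coprime a M" "a > 1"
  shows "chi (bar (mat2 1 1 0 1)) ^ (a^2) = chi (bar (mat2 1 1 0 1))"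
proof -
  \<comment> \<open>Inverting \<open>a\<close> modulo M^2 rather than M allows both off-diagonal
    entries, \<open>M\<close> and \<open>c\<close>, to be multiples of \<open>M\<close>.\<close>
  have "coprime (int a) (int M ^ 2)" using a(1) by simp
  then obtain d where "[int a * d = 1] (mod (int M)^2)" using cong_solve_coprime_int by blast
  then obtain k where k: "int a * d - 1 = int M ^ 2 * k"
    by (meson cong_iff_dvd_diff dvdE)
  define c where "c = int M * k"
  have det: "int a * d - int M * c = 1" using k by (simp add: c_def power2_eq_square algebra_simps)
  have even: "even c" "int M dvd c" "even (c^2)" using M by (auto simp: c_def)
  let ?g = "mat2 (int a) (int M) c d" and ?T = "mat2 1 1 0 1"
  let ?D = "mat2 (1 - int a * c) (int a ^ 3 * c) (- (c^2)) (1 + int a * c + int a ^ 2 * c^2)"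
  let ?S = "mat2 1 (int (a^2)) 0 1"
  have g: "?g \<in> Gamma0 2" using det even by (simp add: mat2_in_Gamma0)
  have T: "?T \<in> Gamma0 2" "?S \<in> Gamma0 2" by (auto simp: mat2_in_Gamma0)
  note Ddet = conjugate_T_det[of "int a" c]
  have D: "?D \<in> Gamma0 2" using Ddet even by (simp only: mat2_in_Gamma0 even_minus)
  have "?D \<in> principal_Gamma M"
    unfolding mat2_in_principal_Gamma
    using Ddet even(2) by (simp add: power2_eq_square add.assoc)
  then have chiD: "chi (bar ?D) = 1" using triv D by blast
  have "?g ** ?T = ?D ** (?S ** ?g)"
    using conjugate_T[OF det] by simp
  moreover have "?S ** ?g \<in> Gamma0 2" using det even by (simp add: mat2_mult mat2_in_Gamma0 algebra_simps)
  ultimately have "chi (bar ?g) * chi (bar ?T) = chi (bar ?D) * (chi (bar ?S) * chi (bar ?g))"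
    using chi_mult g T D by metis
  then have "chi (bar ?T) = chi (bar ?S)" using chi_nonzero[OF g] chiD by simp
  then show ?thesis unfolding chi_T_power[symmetric] by (rule sym)
qed

lemma power_gcd_eq_1:
  fixes x :: complex
  assumes "x ^ i = 1" "x ^ j = 1" "i > 0"
  shows "x ^ gcd i j = 1"
proof -
  obtain u v where "i * u = j * v + gcd i j" using bezout_nat[of i j] assms(3) by auto
  then have "(x ^ i) ^ u = (x ^ j) ^ v * x ^ gcd i j" by (metis power_add power_mult)
  then show ?thesis using assms by simp
qed

text \<open>The order of chi(T) divides \<open>M\<close>, since T^M lies in the principal subgroup,
  and a^2 - 1, by conjugation; hence it divides 24. Passing from T = V U to U costs a sign, which
  the 24th power removes.\<close>

lemma chi_U_power_24:
  assumes triv: "\<And>A. A \<in> principal_Gamma N \<Longrightarrow> A \<in> Gamma0 2 \<Longrightarrow> chi (bar A) = 1"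
    and N: "N \<ge> 1" and eps: "chi (bar mat_V) \<in> {1, -1}"
  shows "chi (bar mat_U) ^ 24 = 1"
proof -
  \<comment> \<open>An even level puts the conjugating matrix and its correction factor into
    \<open>Gamma0 2\<close>.\<close>
  define M where "M = 2 * N"
  have M: "M > 0" "even M" using N by (auto simp: M_def)
  have sub: "principal_Gamma M \<subseteq> principal_Gamma N"
  proof
    fix A assume A: "A \<in> principal_Gamma M"
    obtain a b c d where A_eq: "A = mat2 a b c d" using mat2_eta by metis
    have "int N dvd int M" by (simp add: M_def)
    then show "A \<in> principal_Gamma N"
      using A unfolding A_eq mat2_in_principal_Gamma by (meson dvd_trans)
  qed
  define x where "x = chi (bar (mat2 1 1 0 1))"
  obtain a e M' where M': "M = 5 ^ e * M'" "\<not> 5 dvd M'" and a: "[a = 5] (mod M')" "[a = 2] (mod 5 ^ e)"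
    "coprime a M" "a > 1" using coprime_crt[OF M(1)] by metis
  have "x ^ (a^2) = x"
    unfolding x_def using triv sub M a(3,4) by (intro chi_T_square[of M]) auto
  moreover have "x \<noteq> 0" unfolding x_def by (intro chi_nonzero) (simp add: mat2_in_Gamma0)
  moreover have "x ^ (a^2) = x ^ (a^2 - 1) * x"
    using a(4) by (cases "a^2") (auto simp: mult.commute)
  ultimately have xa: "x ^ (a^2 - 1) = 1" by simp
  have "mat2 1 (int M) 0 1 \<in> principal_Gamma M" "mat2 1 (int M) 0 1 \<in> Gamma0 2"
    by (auto simp: mat2_in_principal_Gamma mat2_in_Gamma0)
  then have xM: "x ^ M = 1" using triv sub chi_T_power[of M] by (auto simp: x_def)
  define g where "g = gcd M (a^2 - 1)"
  have xg: "x ^ g = 1" unfolding g_def using xM xa M by (intro power_gcd_eq_1)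
  have a21: "a^2 \<ge> 1" using a(4) by simp
  have p5: "prime (5::nat)" by simp
  have "g dvd 24"
  proof -
    have "coprime g 5"
    proof (cases "e = 0")
      case True
      then have "g dvd M'" by (simp add: g_def M'(1))
      then show ?thesis using M'(2) by (metis coprime_commute dvd_trans prime_imp_coprime p5)
    next
      case False
      then have "[a = 2] (mod 5)" using a(2) cong_dvd_modulus_nat[of a 2 "5 ^ e" 5] by simp
      then have "[a^2 = 2^2] (mod 5)" by (rule cong_pow)
      then have "a^2 mod 5 = 4" by (simp add: cong_def)
      then have "\<not> 5 dvd a^2 - 1" using a21 by presburger
      then have "\<not> 5 dvd g" unfolding g_def by (meson dvd_trans gcd_dvd2)
      then show ?thesis by (metis coprime_commute prime_imp_coprime p5)
    qed
    then have "coprime g (5 ^ e)" by simp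
    moreover have "g dvd 5 ^ e * M'" unfolding g_def M'(1)[symmetric] by simp
    ultimately have "g dvd M'" using coprime_dvd_mult_right_iff by blast
    then have "[a = 5] (mod g)" by (rule cong_dvd_modulus_nat[OF a(1)])
    then have "[a^2 = 5^2] (mod g)" by (rule cong_pow)
    moreover have "[a^2 = 1] (mod g)"
    proof -
      have "g dvd a^2 - 1" by (simp add: g_def)
      then show ?thesis using a21 by (simp add: cong_altdef_nat)
    qed
    ultimately have "[5^2 = 1] (mod g)" by (meson cong_sym cong_trans)
    then show ?thesis by (simp add: cong_altdef_nat)
  qed
  then have "x ^ 24 = 1" using xg by (metis dvdE power_mult power_one)
  moreover have "x = chi (bar mat_V) * chi (bar mat_U)" by (simp add: x_def chi_T)
  ultimately show ?thesis using eps by (auto simp: power_mult_distrib)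
qed

end

lemma primitive_root_dvd:
  assumes "primitive_root_of_unity n z"
  shows "z ^ m = 1 \<longleftrightarrow> n dvd m"
proof
  have n: "n > 0" "z ^ n = 1" "\<And>k. 0 < k \<Longrightarrow> k < n \<Longrightarrow> z ^ k \<noteq> 1"
    using assms by (auto simp: primitive_root_of_unity_def)
  show "n dvd m" if "z ^ m = 1"
  proof -
    have "z ^ m = (z ^ n) ^ (m div n) * z ^ (m mod n)"
      by (metis mult_div_mod_eq power_add power_mult)
    then have "z ^ (m mod n) = 1" using that n by simp
    then have "m mod n = 0" using n(1) n(3)[of "m mod n"] by (metis mod_less_divisor neq0_conv)
    then show ?thesis by blast
  qed
  show "z ^ m = 1" if "n dvd m" using that n by (auto simp: power_mult)
qed

section \<open>The Eisenstein series of weight two\<close>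

lemma has_sum_int_limit:
  fixes f :: "int \<Rightarrow> complex"
  assumes "(f has_sum L) A"
  shows "(\<lambda>M. sum f ({- int M..<int M} \<inter> A)) \<longlonglongrightarrow> L"
proof -
  have "filterlim (\<lambda>M. {- int M..<int M} \<inter> A) (finite_subsets_at_top A) sequentially"
    unfolding filterlim_finite_subsets_at_top
  proof (intro allI impI)
    fix X assume X: "finite X \<and> X \<subseteq> A"
    define B where "B = nat (Max (insert 0 (abs ` X))) + 1"
    have "\<bar>x\<bar> < int B" if "x \<in> X" for x
    proof -
      have "\<bar>x\<bar> \<le> Max (insert 0 (abs ` X))" using X that by (intro Max_ge) auto
      then show ?thesis unfolding B_def by linarith
    qed
    then have "X \<subseteq> {- int M..<int M} \<inter> A" if "M \<ge> B" for M using X that by fastforce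
    then show "\<forall>\<^sub>F M in sequentially. finite ({- int M..<int M} \<inter> A) \<and> X \<subseteq> {- int M..<int M} \<inter> A
        \<and> {- int M..<int M} \<inter> A \<subseteq> A"
      unfolding eventually_sequentially by (intro exI[of _ B]) auto
  qed
  with assms show ?thesis unfolding has_sum_def by (rule filterlim_compose)
qed

lemma has_sum_intI:
  fixes f :: "int \<Rightarrow> complex"
  assumes "f summable_on A" "(\<lambda>M. sum f ({- int M..<int M} \<inter> A)) \<longlonglongrightarrow> L"
  shows "(f has_sum L) A"
proof -
  have "(f has_sum infsum f A) A" using assms(1) by simp
  moreover from this have "infsum f A = L"
    using has_sum_int_limit assms(2) LIMSEQ_unique by blast
  ultimately show ?thesis by simp
qed

text \<open>Half-open intervals pair k with -1 - k, which matches the arguments z and 1 - z of the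
  digamma reflection.\<close>

lemma sum_int_interval:
  "sum f {- int M..<int M} = (\<Sum>k<M. f (int k)) + (\<Sum>k<M. f (- 1 - int k))"
  for f :: "int \<Rightarrow> 'a::comm_monoid_add"
proof (induction M)
  case (Suc M)
  have "{- int (Suc M)..<int (Suc M)} = insert (int M) (insert (- 1 - int M) {- int M..<int M})" by auto
  with Suc show ?case by (simp add: add_ac)
qed simp

lemma sum_int_interval_nonzero:
  fixes f :: "int \<Rightarrow> 'a::ab_group_add"
  assumes "M > 0"
  shows "sum f ({- int M..<int M} \<inter> (UNIV - {0})) = sum f {- int M..<int M} - f 0"
proof -
  have "{- int M..<int M} \<inter> (UNIV - {0}) = {- int M..<int M} - {0}" by auto
  then show ?thesis using assms by (simp add: sum_diff1)
qed

lemma sum_telescope_int: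
  fixes g :: "int \<Rightarrow> 'a::ab_group_add"
  shows "(\<Sum>m\<in>{- int M..<int M}. g (m - 1) - g m) = g (- int M - 1) - g (int M - 1)"
proof (induction M)
  case (Suc M)
  have "{- int (Suc M)..<int (Suc M)} = insert (int M) (insert (- int M - 1) {- int M..<int M})" by auto
  then have "(\<Sum>m\<in>{- int (Suc M)..<int (Suc M)}. g (m - 1) - g m)
      = (g (int M - 1) - g (int M)) + ((g (- int M - 1 - 1) - g (- int M - 1)) + (g (- int M - 1) - g (int M - 1)))"
    by (simp add: Suc.IH)
  moreover have "- int (Suc M) - 1 = - int M - 1 - 1" "int (Suc M) - 1 = int M" by simp_all
  ultimately show ?case by simp
qed simp

lemma summable_on_int_powr:
  assumes "p > 1"
  shows "(\<lambda>m::int. (1 + real_of_int \<bar>m\<bar>) powr - p) summable_on UNIV"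
proof -
  have "summable (\<lambda>n. real (Suc n) powr - p)"
    using assms summable_real_powr_iff[of "- p"] by (subst summable_Suc_iff) simp
  then have nat: "(\<lambda>n. real (Suc n) powr - p) summable_on UNIV"
    by (intro summable_nonneg_imp_summable_on) auto
  have 1: "(\<lambda>m::int. (1 + real_of_int \<bar>m\<bar>) powr - p) summable_on (range int)"
    using nat by (subst summable_on_reindex) (auto simp: o_def)
  have 2: "(\<lambda>m::int. (1 + real_of_int \<bar>m\<bar>) powr - p) summable_on (range (\<lambda>n. - int (Suc n)))"
  proof (subst summable_on_reindex)
    have "summable (\<lambda>n. real (Suc (Suc n)) powr - p)"
      using \<open>summable (\<lambda>n. real (Suc n) powr - p)\<close> by (subst summable_Suc_iff)
    then have "(\<lambda>n. real (Suc (Suc n)) powr - p) summable_on UNIV"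
      by (intro summable_nonneg_imp_summable_on) auto
    then show "((\<lambda>m::int. (1 + real_of_int \<bar>m\<bar>) powr - p) \<circ> (\<lambda>n. - int (Suc n))) summable_on UNIV"
      by (simp add: o_def add_ac)
  qed (auto simp: inj_on_def)
  have "range int \<inter> range (\<lambda>n. - int (Suc n)) = {}" by auto
  moreover have "range int \<union> range (\<lambda>n. - int (Suc n)) = UNIV"
  proof -
    have "m \<in> range int \<union> range (\<lambda>n. - int (Suc n))" for m :: int
      by (cases m rule: int_cases) auto
    then show ?thesis by blast
  qed
  ultimately show ?thesis using summable_on_Un_disjoint[OF 1 2] by simp
qed

section \<open>Partial fractions of cot and of the inverse square of sin\<close>

lemma sin_pi_nonreal: "Im z \<noteq> 0 \<Longrightarrow> sin (of_real pi * z) \<noteq> (0 :: complex)"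
proof
  assume z: "Im z \<noteq> 0" "sin (of_real pi * z) = 0"
  then obtain n :: int where "of_real pi * z = of_real (real_of_int n * pi)"
    by (auto simp: sin_eq_0)
  then have "Im (of_real pi * z) = 0" by simp
  then show False using z by simp
qed

lemma nonreal_not_Ints: "Im z \<noteq> 0 \<Longrightarrow> z \<notin> \<int>" "Im z \<noteq> 0 \<Longrightarrow> 1 - z \<notin> \<int>"
  by (auto elim!: Ints_cases simp: complex_eq_iff)

lemma nonreal_not_nonpos_Ints: "Im z \<noteq> 0 \<Longrightarrow> z \<notin> \<int>\<^sub>\<le>\<^sub>0" "Im z \<noteq> 0 \<Longrightarrow> 1 - z \<notin> \<int>\<^sub>\<le>\<^sub>0"
  using nonreal_not_Ints nonpos_Ints_Int by blast+

text \<open>Logarithmic derivative of the reflection formula for Gamma.\<close>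

lemma Digamma_reflection_nonreal:
  fixes z :: complex
  assumes z: "Im z \<noteq> 0"
  shows "Digamma (1 - z) - Digamma z = of_real pi * cot (of_real pi * z)"
proof -
  note [simp] = nonreal_not_nonpos_Ints[OF z] sin_pi_nonreal[OF z]
  have G: "Gamma z \<noteq> 0" "Gamma (1 - z) \<noteq> 0" by (simp_all add: Gamma_eq_zero_iff)
  have 1: "((\<lambda>z. Gamma z * Gamma (1 - z)) has_field_derivative
      Gamma z * Gamma (1 - z) * (Digamma z - Digamma (1 - z))) (at z)"
    by (auto intro!: derivative_eq_intros simp: algebra_simps)
  have 2: "((\<lambda>z. of_real pi / sin (of_real pi * z)) has_field_derivative
      - (of_real pi / sin (of_real pi * z)) * (of_real pi * cot (of_real pi * z))) (at z)"
    by (auto intro!: derivative_eq_intros simp: cot_def divide_simps)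
  have "(\<lambda>z. Gamma z * Gamma (1 - z)) = (\<lambda>z :: complex. of_real pi / sin (of_real pi * z))"
    using Gamma_reflection_complex by auto
  then have "Gamma z * Gamma (1 - z) * (Digamma z - Digamma (1 - z))
      = - (of_real pi / sin (of_real pi * z)) * (of_real pi * cot (of_real pi * z))"
    using DERIV_unique[OF 1] 2 by simp
  then have "Gamma z * Gamma (1 - z) * (Digamma (1 - z) - Digamma z)
      = Gamma z * Gamma (1 - z) * (of_real pi * cot (of_real pi * z))"
    using Gamma_reflection_complex[of z] by (simp add: algebra_simps)
  then show ?thesis using G by simp
qed

text \<open>In the limit formulas for the digamma function at 1 - z and at z the same logarithm
  occurs. It cancels in the difference and leaves the two halves of the sum.\<close>

lemma cot_partial_fractions:
  fixes z :: complex
  assumes z: "Im z \<noteq> 0"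
  shows "(\<lambda>M. \<Sum>n\<in>{- int M..<int M}. 1 / (z + of_int n)) \<longlonglongrightarrow> of_real pi * cot (of_real pi * z)"
proof -
  have nz: "z \<noteq> 0" "1 - z \<noteq> 0" using nonreal_not_Ints[OF z] by auto
  have "(\<lambda>M. (of_real (ln (real M)) - (\<Sum>n<M. inverse (1 - z + of_nat n)))
       - (of_real (ln (real M)) - (\<Sum>n<M. inverse (z + of_nat n))))
     \<longlonglongrightarrow> Digamma (1 - z) - Digamma z"
    by (intro tendsto_diff Digamma_LIMSEQ nz)
  also have "(\<lambda>M. (of_real (ln (real M)) - (\<Sum>n<M. inverse (1 - z + of_nat n)))
       - (of_real (ln (real M)) - (\<Sum>n<M. inverse (z + of_nat n))))
     = (\<lambda>M. \<Sum>n\<in>{- int M..<int M}. 1 / (z + of_int n))"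
  proof
    fix M
    have "1 / (z + of_int (- 1 - int k)) = - inverse (1 - z + of_nat k)" for k
    proof -
      have "z + of_int (- 1 - int k) = - (1 - z + of_nat k)" by simp
      then show ?thesis by (simp only: inverse_minus_eq[symmetric] inverse_eq_divide[symmetric])
    qed
    then show "(of_real (ln (real M)) - (\<Sum>n<M. inverse (1 - z + of_nat n)))
       - (of_real (ln (real M)) - (\<Sum>n<M. inverse (z + of_nat n)))
     = (\<Sum>n\<in>{- int M..<int M}. 1 / (z + of_int n))"
      unfolding sum_int_interval by (simp add: sum_negf inverse_eq_divide)
  qed
  finally show ?thesis using Digamma_reflection_nonreal[OF z] by simp
qed

text \<open>Derivative of the digamma reflection; the two halves of the sum are the trigamma series
  at z and at 1 - z.\<close>

lemma inverse_sin_squared_partial_fractions: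
  fixes z :: complex
  assumes z: "Im z \<noteq> 0"
  shows "(\<lambda>M. \<Sum>n\<in>{- int M..<int M}. 1 / (z + of_int n)^2) \<longlonglongrightarrow> (of_real pi / sin (of_real pi * z))^2"
proof -
  note ni = nonreal_not_nonpos_Ints[OF z]
  have nz: "z \<noteq> 0" "1 - z \<noteq> 0" using nonreal_not_Ints[OF z] by auto
  have 1: "((\<lambda>z. Digamma (1 - z) - Digamma z) has_field_derivative
      - Polygamma 1 (1 - z) - Polygamma 1 z) (at z)"
    using ni by (auto intro!: derivative_eq_intros)
  have 2: "((\<lambda>z. of_real pi * cot (of_real pi * z)) has_field_derivative
      (- ((of_real pi / sin (of_real pi * z))^2))) (at z)"
    using sin_pi_nonreal[OF z]
    by (auto intro!: derivative_eq_intros DERIV_chain2[OF DERIV_cot] simp: power2_eq_square divide_simps)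
  have "\<forall>\<^sub>F w in nhds z. w \<in> {w. Im w > 0} \<union> {w. Im w < 0}"
    using z by (intro eventually_nhds_in_open open_Un open_halfspace_Im_gt open_halfspace_Im_lt) auto
  then have "\<forall>\<^sub>F w in nhds z. Digamma (1 - w) - Digamma w = of_real pi * cot (of_real pi * w)"
    by eventually_elim (auto intro!: Digamma_reflection_nonreal)
  from DERIV_cong_ev[OF refl this refl] 1
  have "((\<lambda>z. of_real pi * cot (of_real pi * z)) has_field_derivative
      - Polygamma 1 (1 - z) - Polygamma 1 z) (at z)" by blast
  note eq = DERIV_unique[OF this 2]
  have "b + a = c" if "- a - b = - c" for a b c :: complex
    using that by (simp add: diff_eq_eq add.commute minus_equation_iff[of a])
  from this[OF eq]
  have sum: "Polygamma 1 z + Polygamma 1 (1 - z) = (of_real pi / sin (of_real pi * z))^2"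
    .
  have P: "(\<lambda>M. \<Sum>k<M. inverse ((w + of_nat k)^2)) \<longlonglongrightarrow> Polygamma 1 w" if "w \<noteq> 0" for w :: complex
    using Polygamma_LIMSEQ[OF that, of 1] by (simp add: sums_def numeral_2_eq_2)
  have "(\<lambda>M. \<Sum>n\<in>{- int M..<int M}. 1 / (z + of_int n)^2)
    = (\<lambda>M. (\<Sum>k<M. inverse ((z + of_nat k)^2)) + (\<Sum>k<M. inverse ((1 - z + of_nat k)^2)))"
  proof
    fix M
    have "(z + of_int (- 1 - int k))^2 = (1 - z + of_nat k)^2" for k
    proof -
      have "z + of_int (- 1 - int k) = - (1 - z + of_nat k)" by simp
      then show ?thesis by (simp only: power2_minus)
    qed
    then show "(\<Sum>n\<in>{- int M..<int M}. 1 / (z + of_int n)^2)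
      = (\<Sum>k<M. inverse ((z + of_nat k)^2)) + (\<Sum>k<M. inverse ((1 - z + of_nat k)^2))"
      unfolding sum_int_interval by (simp add: inverse_eq_divide)
  qed
  then show ?thesis using tendsto_add[OF P[OF nz(1)] P[OF nz(2)]] sum by simp
qed

section \<open>The absolutely convergent double series behind E_2\<close>

lemma lattice_lower_bound:
  fixes \<tau> :: complex
  assumes "Im \<tau> > 0"
  shows "real_of_int \<bar>m\<bar> + real_of_int \<bar>n\<bar> \<le> (1 + (norm \<tau> + 1) / Im \<tau>) * norm (of_int m + of_int n * \<tau>)"
proof -
  let ?z = "of_int m + of_int n * \<tau>"
  \<comment> \<open>The imaginary part controls \<open>n\<close>; the triangle inequality then
    controls \<open>m\<close>.\<close>
  have "\<bar>Im ?z\<bar> \<le> norm ?z" by (rule abs_Im_le_cmod)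
  then have n: "real_of_int \<bar>n\<bar> * Im \<tau> \<le> norm ?z" using assms by (simp add: abs_mult)
  then have n': "real_of_int \<bar>n\<bar> \<le> norm ?z / Im \<tau>" using assms by (simp add: field_simps)
  have "real_of_int \<bar>m\<bar> = norm (?z - of_int n * \<tau>)" by simp
  also have "\<dots> \<le> norm ?z + real_of_int \<bar>n\<bar> * norm \<tau>"
    using norm_triangle_ineq4[of ?z "of_int n * \<tau>"] by (simp add: norm_mult)
  also have "\<dots> \<le> norm ?z + norm ?z / Im \<tau> * norm \<tau>"
    using n' by (intro add_left_mono mult_right_mono) auto
  finally have "real_of_int \<bar>m\<bar> + real_of_int \<bar>n\<bar> \<le> norm ?z + norm ?z / Im \<tau> * norm \<tau> + norm ?z / Im \<tau>"
    using n' by simp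
  then show ?thesis using assms by (simp add: field_simps)
qed

text \<open>With z = m + n tau this is 1/(z - 1) - 1/z - 1/z^2: minus the term of the weight two
  lattice sum, plus a difference that telescopes in \<open>m\<close>. The correction improves
  quadratic to cubic decay.\<close>

definition lattice_term :: "complex \<Rightarrow> int \<Rightarrow> int \<Rightarrow> complex" where
  "lattice_term \<tau> m n = 1 / ((of_int m + of_int n * \<tau>)^2 * (of_int (m - 1) + of_int n * \<tau>))"

lemma lattice_nonzero:
  "Im \<tau> > 0 \<Longrightarrow> n \<noteq> 0 \<Longrightarrow> of_int m + of_int n * \<tau> \<noteq> 0"
  by (auto simp: complex_eq_iff)

lemma lattice_term_summable:
  assumes \<tau>: "Im \<tau> > 0"
  shows "(\<lambda>(m, n). lattice_term \<tau> m n) summable_on (UNIV \<times> (UNIV - {0}))"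
proof -
  define K where "K = 1 + (norm \<tau> + 1) / Im \<tau>"
  have K: "K > 0" using \<tau> by (simp add: K_def add_pos_nonneg)
  let ?A = "UNIV \<times> (UNIV - {0}) :: (int \<times> int) set"
  \<comment> \<open>Cubic decay is divided evenly between the variables: the majorant is a product
    of two one-variable terms of exponent 3/2, each of them summable.\<close>
  define g where "g m = (1 + real_of_int \<bar>m\<bar>) powr (- (3/2))" for m :: int
  have g: "g summable_on UNIV" unfolding g_def by (rule summable_on_int_powr) simp
  have "(\<lambda>x. norm (case x of (m, n) \<Rightarrow> g m * g n)) summable_on (UNIV \<times> UNIV)"
  proof (subst Infinite_Sum.abs_summable_on_Sigma_iff, intro conjI ballI)
    have nn: "norm (g m * g n) = g m * g n" for m n by (simp add: g_def)
    show "(\<lambda>n. norm (case (m, n) of (m, n) \<Rightarrow> g m * g n)) summable_on UNIV" for m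
      using summable_on_cmult_right[OF g, of "g m"] by (simp only: prod.case nn)
    have "(\<Sum>\<^sub>\<infinity>n. norm (case (m, n) of (m, n) \<Rightarrow> g m * g n)) = g m * (\<Sum>\<^sub>\<infinity>n. g n)" for m
      using infsum_cmult_right[of "g m" g UNIV] g by (simp only: prod.case nn)
    moreover have "norm (g m * (\<Sum>\<^sub>\<infinity>n. g n)) = g m * (\<Sum>\<^sub>\<infinity>n. g n)" for m
    proof -
      have "0 \<le> (\<Sum>\<^sub>\<infinity>n. g n)" by (intro infsum_nonneg) (simp add: g_def)
      moreover have "0 \<le> g m" by (simp add: g_def)
      ultimately show ?thesis by simp
    qed
    ultimately show "(\<lambda>m. norm (\<Sum>\<^sub>\<infinity>n. norm (case (m, n) of (m, n) \<Rightarrow> g m * g n))) summable_on UNIV"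
      using summable_on_cmult_left[OF g, of "\<Sum>\<^sub>\<infinity>n. g n"] by (simp only:)
  qed
  then have "(\<lambda>x. norm (case x of (m, n) \<Rightarrow> g m * g n)) summable_on ?A"
    by (rule summable_on_subset_banach) auto
  then have "(\<lambda>x. 8 * K^3 * norm (case x of (m, n) \<Rightarrow> g m * g n)) summable_on ?A"
    by (rule summable_on_cmult_right)
  then have abs: "(\<lambda>x. norm (case x of (m, n) \<Rightarrow> 8 * K^3 * (g m * g n))) summable_on ?A"
    using K by (simp add: case_prod_unfold g_def)
  have "(\<lambda>x. norm (case x of (m, n) \<Rightarrow> lattice_term \<tau> m n)) summable_on ?A"
  proof (rule Infinite_Sum.abs_summable_on_comparison_test[OF abs])
    fix x assume "x \<in> ?A"
    then obtain m n where x: "x = (m, n)" "n \<noteq> 0" by auto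
    define a where "a = real_of_int \<bar>m\<bar> + real_of_int \<bar>n\<bar>"
    have n1: "real_of_int \<bar>n\<bar> \<ge> 1" using x(2) by linarith
    have a: "a > 0" "a \<ge> 1 + real_of_int \<bar>m\<bar>" "2 * a \<ge> 1 + real_of_int \<bar>n\<bar>"
      using n1 unfolding a_def by auto
    have lb: "real_of_int \<bar>m\<bar> + real_of_int \<bar>n\<bar> \<le> K * norm (of_int m + of_int n * \<tau>)" for m n
      using lattice_lower_bound[OF \<tau>, of m n] by (simp add: K_def)
    have aux: "x + y \<le> 2 * K * z" if "x \<le> x' + 1" "0 \<le> x'" "1 \<le> y" "x' + y \<le> K * z" for x x' y z :: real
      using that by linarith
    have b: "a \<le> 2 * K * norm (of_int (m - 1) + of_int n * \<tau>)"
      unfolding a_def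
    proof (rule aux)
      show "real_of_int \<bar>m\<bar> \<le> real_of_int \<bar>m - 1\<bar> + 1" by linarith
    qed (use n1 lb[of "m - 1" n] in auto)
    have c: "a \<le> K * norm (of_int m + of_int n * \<tau>)"
      using lb[of m n] unfolding a_def by linarith
    have "a^3 = a * a * a" by (simp add: power3_eq_cube)
    also have "\<dots> \<le> (K * norm (of_int m + of_int n * \<tau>)) * (K * norm (of_int m + of_int n * \<tau>))
        * (2 * K * norm (of_int (m - 1) + of_int n * \<tau>))"
      using a b c by (intro mult_mono) auto
    also have "\<dots> = 2 * K^3 * (norm (of_int m + of_int n * \<tau>) ^ 2 * norm (of_int (m - 1) + of_int n * \<tau>))"
      by (simp add: power3_eq_cube power2_eq_square)
    finally have 1: "a^3 \<le> 2 * K^3 * (norm (of_int m + of_int n * \<tau>) ^ 2 * norm (of_int (m - 1) + of_int n * \<tau>))" .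
    have "norm (lattice_term \<tau> m n) = 1 / (norm (of_int m + of_int n * \<tau>) ^ 2 * norm (of_int (m - 1) + of_int n * \<tau>))"
      by (simp add: lattice_term_def norm_divide norm_mult norm_power)
    also have "\<dots> \<le> 2 * K^3 / a^3"
    proof -
      have "norm (of_int m + of_int n * \<tau>) ^ 2 * norm (of_int (m - 1) + of_int n * \<tau>) > 0"
        using lattice_nonzero[OF \<tau> x(2), of m] lattice_nonzero[OF \<tau> x(2), of "m - 1"] by simp
      then show ?thesis using 1 a(1) by (simp add: divide_simps mult_ac)
    qed
    also have "\<dots> \<le> 8 * K^3 * (g m * g n)"
    proof -
      \<comment> \<open>The factor 1/4 is a lower bound for 2^(-3/2), the loss from using
        \<open>2 * a\<close> instead of \<open>a\<close> in the variable \<open>n\<close>.\<close>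
      have "1 / (4 * a^3) \<le> g m * g n"
      proof -
        have "a powr (-(3/2)) \<le> g m"
          unfolding g_def using a by (intro powr_mono2') auto
        moreover have "(2*a) powr (-(3/2)) \<le> g n"
          unfolding g_def using a by (intro powr_mono2') auto
        ultimately have "a powr (-(3/2)) * (2*a) powr (-(3/2)) \<le> g m * g n"
          by (intro mult_mono) (auto simp: g_def)
        moreover have "a powr (-(3/2)) * (2*a) powr (-(3/2)) = 2 powr (-(3/2)) * a powr (-3)"
          using a(1) by (simp add: powr_mult powr_add[symmetric])
        moreover have "a powr (-3) = 1 / a^3"
          using a(1) by (simp add: powr_minus powr_numeral inverse_eq_divide)
        moreover have "(1/4 :: real) \<le> 2 powr (-(3/2))"
        proof -
          have "(2::real) powr (-2) \<le> 2 powr (-(3/2))" by (intro powr_mono) auto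
          then show ?thesis by (simp add: powr_minus)
        qed
        moreover have "1 / a^3 \<ge> 0" using a(1) by simp
        ultimately show ?thesis
          using mult_right_mono[of "1/4" "2 powr (-(3/2))" "1 / a^3"] by simp
      qed
      then have "8 * K^3 * (1 / (4 * a^3)) \<le> 8 * K^3 * (g m * g n)"
        using K by (intro mult_left_mono) auto
      then show ?thesis by simp
    qed
    finally show "norm (case x of (m, n) \<Rightarrow> lattice_term \<tau> m n) \<le> norm (case x of (m, n) \<Rightarrow> 8 * K^3 * (g m * g n))"
      using K by (simp add: x g_def)
  qed
  then show ?thesis by (rule Infinite_Sum.abs_summable_summable)
qed

lemma lattice_term_eq:
  assumes "Im \<tau> > 0" "n \<noteq> 0"
  shows "lattice_term \<tau> m n = (1 / (of_int (m - 1) + of_int n * \<tau>) - 1 / (of_int m + of_int n * \<tau>))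
           - 1 / (of_int m + of_int n * \<tau>)^2"
proof -
  define z where "z = of_int m + of_int n * \<tau>"
  have z: "z \<noteq> 0" "z - 1 \<noteq> 0"
    using lattice_nonzero[OF assms, of m] lattice_nonzero[OF assms, of "m - 1"] by (auto simp: z_def algebra_simps)
  have "of_int (m - 1) + of_int n * \<tau> = z - 1" by (simp add: z_def)
  then show ?thesis
    unfolding lattice_term_def z_def[symmetric] using z by (simp add: divide_simps) (simp add: power2_eq_square algebra_simps)
qed

lemma tendsto_inverse_of_int_linear:
  fixes w :: complex
  shows "(\<lambda>M. 1 / (of_int (- int M - 1) + w)) \<longlonglongrightarrow> 0" "(\<lambda>M. 1 / (of_int (int M - 1) + w)) \<longlonglongrightarrow> 0"
proof -
  have "filterlim (\<lambda>M. of_nat M :: complex) at_infinity sequentially" by (rule tendsto_of_nat)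
  then have "filterlim (\<lambda>M. of_nat M + (w - 1)) at_infinity sequentially"
    by (rule tendsto_add_filterlim_at_infinity'[OF _ tendsto_const])
  moreover have "filterlim (\<lambda>M. of_nat M + (1 - w)) at_infinity sequentially"
    using \<open>filterlim (\<lambda>M. of_nat M :: complex) at_infinity sequentially\<close>
    by (rule tendsto_add_filterlim_at_infinity'[OF _ tendsto_const])
  ultimately have "(\<lambda>M. inverse (of_nat M + (w - 1))) \<longlonglongrightarrow> 0" "(\<lambda>M. inverse (of_nat M + (1 - w))) \<longlonglongrightarrow> 0"
    by (auto intro: filterlim_compose[OF tendsto_inverse_0])
  moreover have "inverse (of_nat M + (w - 1)) = 1 / (of_int (int M - 1) + w)" for M
    by (simp add: inverse_eq_divide algebra_simps)
  moreover have "- inverse (of_nat M + (1 - w)) = 1 / (of_int (- int M - 1) + w)" for M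
  proof -
    have "of_int (- int M - 1) + w = - (of_nat M + (1 - w))" by simp
    then show ?thesis by (simp only: inverse_minus_eq[symmetric] inverse_eq_divide[symmetric])
  qed
  ultimately show "(\<lambda>M. 1 / (of_int (- int M - 1) + w)) \<longlonglongrightarrow> 0" "(\<lambda>M. 1 / (of_int (int M - 1) + w)) \<longlonglongrightarrow> 0"
    using tendsto_minus[of "\<lambda>M. inverse (of_nat M + (1 - w))" 0 sequentially] by simp_all
qed

text \<open>Along a row the correction telescopes to 0 and leaves minus the partial fraction series
  of (pi / sin)^2.\<close>

lemma lattice_row:
  assumes \<tau>: "Im \<tau> > 0" and n: "n \<noteq> 0"
  shows "((\<lambda>m. lattice_term \<tau> m n) has_sum (- ((of_real pi / sin (of_real pi * (of_int n * \<tau>)))^2))) UNIV"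
proof (rule has_sum_intI)
  define w where "w = of_int n * \<tau>"
  have w: "Im w \<noteq> 0" using \<tau> n by (simp add: w_def)
  have "(\<lambda>(n, m). lattice_term \<tau> m n) summable_on ((UNIV - {0}) \<times> UNIV)"
    using lattice_term_summable[OF \<tau>] by (subst summable_on_swap) (simp add: case_prod_unfold o_def)
  then show "(\<lambda>m. lattice_term \<tau> m n) summable_on UNIV"
    using n by (intro summable_on_SigmaD1[of "\<lambda>n m. lattice_term \<tau> m n" "UNIV - {0}" "\<lambda>_. UNIV"]) auto
  have "(\<lambda>M. (1 / (of_int (- int M - 1) + w) - 1 / (of_int (int M - 1) + w))
      - (\<Sum>m\<in>{- int M..<int M}. 1 / (w + of_int m)^2)) \<longlonglongrightarrow> (0 - 0) - (of_real pi / sin (of_real pi * w))^2"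
    by (intro tendsto_diff tendsto_inverse_of_int_linear inverse_sin_squared_partial_fractions w)
  also have "(\<lambda>M. (1 / (of_int (- int M - 1) + w) - 1 / (of_int (int M - 1) + w))
      - (\<Sum>m\<in>{- int M..<int M}. 1 / (w + of_int m)^2))
     = (\<lambda>M. sum (\<lambda>m. lattice_term \<tau> m n) ({- int M..<int M} \<inter> UNIV))"
  proof
    fix M
    show "(1 / (of_int (- int M - 1) + w) - 1 / (of_int (int M - 1) + w))
      - (\<Sum>m\<in>{- int M..<int M}. 1 / (w + of_int m)^2)
     = sum (\<lambda>m. lattice_term \<tau> m n) ({- int M..<int M} \<inter> UNIV)"
      using sum_telescope_int[of "\<lambda>m. 1 / (of_int m + w)" M]
      by (simp only: lattice_term_eq[OF \<tau> n] sum_subtractf w_def Int_UNIV_right) (simp add: add.commute)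
  qed
  finally show "(\<lambda>M. sum (\<lambda>m. lattice_term \<tau> m n) ({- int M..<int M} \<inter> UNIV))
     \<longlonglongrightarrow> - ((of_real pi / sin (of_real pi * (of_int n * \<tau>)))^2)" by (simp add: w_def)
qed

text \<open>The weight two lattice sum over all m + n tau with n nonzero, with the sum over m
  carried out first.\<close>

definition sin_sum :: "complex \<Rightarrow> complex" where
  "sin_sum \<tau> = (\<Sum>\<^sub>\<infinity>n\<in>UNIV - {0 :: int}. (of_real pi / sin (of_real pi * (of_int n * \<tau>)))^2)"

lemma sin_sum:
  assumes \<tau>: "Im \<tau> > 0"
  shows "((\<lambda>n. (of_real pi / sin (of_real pi * (of_int n * \<tau>)))^2) has_sum sin_sum \<tau>) (UNIV - {0 :: int})"
proof -
  have swap: "(\<lambda>(n, m). lattice_term \<tau> m n) summable_on ((UNIV - {0}) \<times> UNIV)"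
    using lattice_term_summable[OF \<tau>] by (subst summable_on_swap) (simp add: case_prod_unfold o_def)
  have "(\<lambda>n. \<Sum>\<^sub>\<infinity>m. lattice_term \<tau> m n) summable_on (UNIV - {0})"
    using summable_on_Sigma_banach[OF swap] by simp
  also have "?this \<longleftrightarrow> (\<lambda>n. - ((of_real pi / sin (of_real pi * (of_int n * \<tau>)))^2)) summable_on (UNIV - {0 :: int})"
    using lattice_row[OF \<tau>] by (intro summable_on_cong infsumI) auto
  finally show ?thesis unfolding sin_sum_def by (simp add: summable_on_uminus)
qed

lemma sin_sum_rows:
  assumes \<tau>: "Im \<tau> > 0"
  shows "(\<Sum>\<^sub>\<infinity>m. \<Sum>\<^sub>\<infinity>n\<in>UNIV - {0}. lattice_term \<tau> m n) = - sin_sum \<tau>"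
proof -
  have "(\<Sum>\<^sub>\<infinity>m. \<Sum>\<^sub>\<infinity>n\<in>UNIV - {0}. lattice_term \<tau> m n) = (\<Sum>\<^sub>\<infinity>n\<in>UNIV - {0}. \<Sum>\<^sub>\<infinity>m. lattice_term \<tau> m n)"
    using lattice_term_summable[OF \<tau>] by (rule infsum_swap_banach)
  also have "\<dots> = (\<Sum>\<^sub>\<infinity>n\<in>UNIV - {0 :: int}. - ((of_real pi / sin (of_real pi * (of_int n * \<tau>)))^2))"
    using lattice_row[OF \<tau>] by (intro infsum_cong infsumI) auto
  finally show ?thesis by (simp add: infsum_uminus sin_sum_def)
qed

text \<open>Twice the Basel sum. The half-open interval contains one more negative than positive
  number, hence the \<open>Suc M\<close> in one of the two halves.\<close>

lemma inverse_squares_limit: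
  "(\<lambda>M. \<Sum>n\<in>{- int M..<int M} \<inter> (UNIV - {0}). 1 / (of_int n)^2 :: complex) \<longlonglongrightarrow> of_real (pi^2 / 3)"
proof -
  have "(\<lambda>k. 1 / (real k + 1)^2) sums (pi^2 / 6)"
    using inverse_squares_sums by (simp add: add_ac)
  then have lim: "(\<lambda>M. \<Sum>k<M. 1 / (real k + 1)^2) \<longlonglongrightarrow> pi^2 / 6" by (simp add: sums_def)
  have "(\<lambda>M. (\<Sum>k<M. 1 / (real k + 1)^2) + (\<Sum>k<Suc M. 1 / (real k + 1)^2)) \<longlonglongrightarrow> pi^2 / 6 + pi^2 / 6"
    by (intro tendsto_add lim LIMSEQ_Suc[OF lim])
  then have "(\<lambda>M. of_real ((\<Sum>k<M. 1 / (real k + 1)^2) + (\<Sum>k<Suc M. 1 / (real k + 1)^2)) :: complex)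
      \<longlonglongrightarrow> of_real (pi^2 / 6 + pi^2 / 6)"
    by (rule tendsto_of_real)
  also have "(\<lambda>M. of_real ((\<Sum>k<M. 1 / (real k + 1)^2) + (\<Sum>k<Suc M. 1 / (real k + 1)^2)) :: complex)
      = (\<lambda>M. \<Sum>n\<in>{- int (Suc M)..<int (Suc M)} \<inter> (UNIV - {0}). 1 / (of_int n)^2)"
  proof
    fix M
    have "(\<Sum>k<Suc M. 1 / (of_int (int k))^2) = (\<Sum>k<M. 1 / (of_nat (Suc k))^2 :: complex)"
      by (subst sum.lessThan_Suc_shift) simp
    moreover have "of_int (- 1 - int k) ^ 2 = (of_nat (Suc k) ^ 2 :: complex)" for k
      by (simp add: power2_eq_square algebra_simps)
    ultimately show "of_real ((\<Sum>k<M. 1 / (real k + 1)^2) + (\<Sum>k<Suc M. 1 / (real k + 1)^2))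
      = (\<Sum>n\<in>{- int (Suc M)..<int (Suc M)} \<inter> (UNIV - {0}). 1 / (of_int n)^2 :: complex)"
      by (subst sum_int_interval_nonzero, simp, subst sum_int_interval)
        (simp add: add.commute del: of_nat_Suc sum.lessThan_Suc, simp add: add.commute)
  qed
  also have "pi^2 / 6 + pi^2 / 6 = pi^2 / 3" by simp
  finally show ?thesis by (rule LIMSEQ_imp_Suc)
qed

text \<open>Sum of 1/(m + n tau) over n nonzero, taken along the intervals; it converges only
  conditionally. For m = 0 opposite terms cancel.\<close>

definition cot_column :: "complex \<Rightarrow> int \<Rightarrow> complex" where
  "cot_column \<tau> m = (if m = 0 then 0 else of_real pi / \<tau> * cot (of_real pi * (of_int m / \<tau>)) - 1 / of_int m)"

text \<open>The same for 1/(m + n tau)^2. For m = 0 it is 2 zeta(2) / tau^2; otherwise the term n =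
  0 is removed from the full partial fraction series.\<close>

definition square_column :: "complex \<Rightarrow> int \<Rightarrow> complex" where
  "square_column \<tau> m = (if m = 0 then of_real (pi^2 / 3) / \<tau>^2
     else (of_real pi / sin (of_real pi * (of_int m / \<tau>)))^2 / \<tau>^2 - 1 / (of_int m)^2)"

lemma cot_column_limit:
  assumes \<tau>: "Im \<tau> > 0"
  shows "(\<lambda>M. \<Sum>n\<in>{- int M..<int M} \<inter> (UNIV - {0}). 1 / (of_int m + of_int n * \<tau>)) \<longlonglongrightarrow> cot_column \<tau> m"
proof (cases "m = 0")
  case True
  have \<tau>0: "\<tau> \<noteq> 0" using \<tau> by auto
  \<comment> \<open>Only n = -M is left without a partner.\<close>
  have "(\<Sum>n\<in>{- int M..<int M} \<inter> (UNIV - {0}). 1 / (of_int m + of_int n * \<tau>)) = - inverse (of_nat M) / \<tau>"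
    if "M > 0" for M
  proof -
    obtain k where M: "M = Suc k" using \<open>M > 0\<close> gr0_implies_Suc by blast
    have *: "1 / (of_int (- 1 - int j) * \<tau>) = - (1 / (of_nat (Suc j) * \<tau>))" for j
    proof -
      have "of_int (- 1 - int j) * \<tau> = - (of_nat (Suc j) * \<tau>)" by (simp add: algebra_simps)
      then show ?thesis by (metis divide_minus_right)
    qed
    have "(\<Sum>n\<in>{- int M..<int M}. 1 / (of_int n * \<tau>))
       = (\<Sum>j<k. 1 / (of_nat (Suc j) * \<tau>)) - (\<Sum>j<Suc k. 1 / (of_nat (Suc j) * \<tau>))"
      unfolding sum_int_interval M * by (subst sum.lessThan_Suc_shift) (simp add: sum_negf del: of_nat_Suc sum.lessThan_Suc)
    also have "\<dots> = - inverse (of_nat M) / \<tau>" by (simp add: M inverse_eq_divide del: of_nat_Suc)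
    finally show ?thesis using that True by (simp add: sum_int_interval_nonzero)
  qed
  then have "\<forall>\<^sub>F M in sequentially. - inverse (of_nat M) / \<tau> = (\<Sum>n\<in>{- int M..<int M} \<inter> (UNIV - {0}). 1 / (of_int m + of_int n * \<tau>))"
    using eventually_mono[OF eventually_gt_at_top[of "0 :: nat"]] by simp
  moreover have "(\<lambda>M. - inverse (of_nat M) / \<tau>) \<longlonglongrightarrow> - 0 / \<tau>"
    using \<tau>0 by (intro tendsto_intros lim_inverse_n)
  ultimately show ?thesis using True by (auto simp: cot_column_def dest: Lim_transform_eventually)
next
  case False
  have \<tau>0: "\<tau> \<noteq> 0" using \<tau> by auto
  have w: "Im (of_int m / \<tau>) \<noteq> 0"
    using \<tau> False by (auto simp: Im_divide complex_eq_iff)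
  have eq: "1 / (of_int m + of_int n * \<tau>) = 1 / \<tau> * (1 / (of_int m / \<tau> + of_int n))" for n
    using \<tau>0 by (simp add: field_simps)
  have "(\<lambda>M. 1 / \<tau> * (\<Sum>n\<in>{- int M..<int M}. 1 / (of_int m / \<tau> + of_int n)) - 1 / of_int m)
     \<longlonglongrightarrow> 1 / \<tau> * (of_real pi * cot (of_real pi * (of_int m / \<tau>))) - 1 / of_int m"
    by (intro tendsto_intros cot_partial_fractions w)
  moreover have "1 / \<tau> * (\<Sum>n\<in>{- int M..<int M}. 1 / (of_int m / \<tau> + of_int n)) - 1 / of_int m
     = (\<Sum>n\<in>{- int M..<int M} \<inter> (UNIV - {0}). 1 / (of_int m + of_int n * \<tau>))" if "M > 0" for M
    using that by (simp only: sum_int_interval_nonzero eq[symmetric] sum_distrib_left) simp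
  then have "\<forall>\<^sub>F M in sequentially. 1 / \<tau> * (\<Sum>n\<in>{- int M..<int M}. 1 / (of_int m / \<tau> + of_int n)) - 1 / of_int m
     = (\<Sum>n\<in>{- int M..<int M} \<inter> (UNIV - {0}). 1 / (of_int m + of_int n * \<tau>))"
    using eventually_mono[OF eventually_gt_at_top[of "0 :: nat"]] by simp
  ultimately show ?thesis using False by (auto simp: cot_column_def dest: Lim_transform_eventually)
qed

lemma square_column_limit:
  assumes \<tau>: "Im \<tau> > 0"
  shows "(\<lambda>M. \<Sum>n\<in>{- int M..<int M} \<inter> (UNIV - {0}). 1 / (of_int m + of_int n * \<tau>)^2) \<longlonglongrightarrow> square_column \<tau> m"
proof (cases "m = 0")
  case True
  have "(\<lambda>M. (\<Sum>n\<in>{- int M..<int M} \<inter> (UNIV - {0}). 1 / (of_int n)^2) / \<tau>^2) \<longlonglongrightarrow> of_real (pi^2 / 3) / \<tau>^2"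
    using \<tau> by (intro tendsto_divide inverse_squares_limit) auto
  then show ?thesis using True by (simp add: square_column_def sum_divide_distrib power_mult_distrib)
next
  case False
  have \<tau>0: "\<tau> \<noteq> 0" using \<tau> by auto
  have w: "Im (of_int m / \<tau>) \<noteq> 0"
    using \<tau> False by (auto simp: Im_divide complex_eq_iff)
  have eq: "1 / (of_int m + of_int n * \<tau>)^2 = 1 / (of_int m / \<tau> + of_int n)^2 / \<tau>^2" for n
  proof -
    have "of_int m + of_int n * \<tau> = (of_int m / \<tau> + of_int n) * \<tau>" using \<tau>0 by (simp add: field_simps)
    then show ?thesis by (simp only: power_mult_distrib) simp
  qed
  have "(\<lambda>M. (\<Sum>n\<in>{- int M..<int M}. 1 / (of_int m / \<tau> + of_int n)^2) / \<tau>^2 - 1 / (of_int m)^2)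
     \<longlonglongrightarrow> (of_real pi / sin (of_real pi * (of_int m / \<tau>)))^2 / \<tau>^2 - 1 / (of_int m)^2"
    using \<tau>0 by (intro tendsto_diff tendsto_divide tendsto_const inverse_sin_squared_partial_fractions w) auto
  moreover have "(\<Sum>n\<in>{- int M..<int M}. 1 / (of_int m / \<tau> + of_int n)^2) / \<tau>^2 - 1 / (of_int m)^2
     = (\<Sum>n\<in>{- int M..<int M} \<inter> (UNIV - {0}). 1 / (of_int m + of_int n * \<tau>)^2)" if "M > 0" for M
    using that by (simp only: sum_int_interval_nonzero eq[symmetric] sum_divide_distrib) simp
  then have "\<forall>\<^sub>F M in sequentially. (\<Sum>n\<in>{- int M..<int M}. 1 / (of_int m / \<tau> + of_int n)^2) / \<tau>^2 - 1 / (of_int m)^2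
     = (\<Sum>n\<in>{- int M..<int M} \<inter> (UNIV - {0}). 1 / (of_int m + of_int n * \<tau>)^2)"
    using eventually_mono[OF eventually_gt_at_top[of "0 :: nat"]] by simp
  ultimately show ?thesis using False by (auto simp: square_column_def dest: Lim_transform_eventually)
qed

lemma lattice_column:
  assumes \<tau>: "Im \<tau> > 0"
  shows "((\<lambda>n. lattice_term \<tau> m n) has_sum (cot_column \<tau> (m - 1) - cot_column \<tau> m - square_column \<tau> m)) (UNIV - {0})"
proof (rule has_sum_intI)
  show "(\<lambda>n. lattice_term \<tau> m n) summable_on (UNIV - {0})"
    using lattice_term_summable[OF \<tau>]
    by (intro summable_on_SigmaD1[of "lattice_term \<tau>" UNIV "\<lambda>_. UNIV - {0}"]) auto
  have "sum (\<lambda>n. lattice_term \<tau> m n) ({- int M..<int M} \<inter> (UNIV - {0}))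
     = (\<Sum>n\<in>{- int M..<int M} \<inter> (UNIV - {0}). 1 / (of_int (m - 1) + of_int n * \<tau>))
       - (\<Sum>n\<in>{- int M..<int M} \<inter> (UNIV - {0}). 1 / (of_int m + of_int n * \<tau>))
       - (\<Sum>n\<in>{- int M..<int M} \<inter> (UNIV - {0}). 1 / (of_int m + of_int n * \<tau>)^2)" for M
    unfolding sum_subtractf[symmetric] by (intro sum.cong refl lattice_term_eq \<tau>) auto
  then show "(\<lambda>M. sum (\<lambda>n. lattice_term \<tau> m n) ({- int M..<int M} \<inter> (UNIV - {0})))
     \<longlonglongrightarrow> cot_column \<tau> (m - 1) - cot_column \<tau> m - square_column \<tau> m"
    using tendsto_diff[OF tendsto_diff[OF cot_column_limit[OF \<tau>, of "m - 1"] cot_column_limit[OF \<tau>, of m]]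
        square_column_limit[OF \<tau>, of m]] by simp
qed

text \<open>Written in exp(-2 i z) because it is applied to z = pi m / tau with m > 0, which lies in
  the lower half-plane, where this exponential is small.\<close>

lemma cot_eq_exp:
  fixes z :: complex
  assumes "sin z \<noteq> 0"
  shows "cot z = \<i> * (1 + exp (- 2 * \<i> * z)) / (1 - exp (- 2 * \<i> * z))"
proof -
  have e: "exp (- 2 * \<i> * z) = exp (- (\<i> * z)) * exp (- (\<i> * z))" by (simp add: exp_add[symmetric] mult.assoc)
  have e1: "exp (\<i> * z) * exp (- (\<i> * z)) = 1" by (simp add: exp_add[symmetric])
  have s: "2 * \<i> * sin z = exp (\<i> * z) - exp (- (\<i> * z))" and c: "2 * cos z = exp (\<i> * z) + exp (- (\<i> * z))"
    by (simp_all add: sin_exp_eq cos_exp_eq)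
  have 1: "2 * \<i> * sin z * exp (- (\<i> * z)) = 1 - exp (- 2 * \<i> * z)"
    unfolding s e by (simp add: left_diff_distrib e1)
  have 2: "2 * cos z * exp (- (\<i> * z)) = 1 + exp (- 2 * \<i> * z)"
    unfolding c e by (simp add: distrib_right e1)
  show ?thesis unfolding 1[symmetric] 2[symmetric] using assms by (simp add: cot_def divide_simps)
qed

lemma sin_squared_eq_exp:
  fixes z :: complex
  shows "sin z ^ 2 * (- 4 * exp (2 * \<i> * z)) = (1 - exp (2 * \<i> * z))^2"
proof -
  have e: "exp (2 * \<i> * z) = exp (\<i> * z) * exp (\<i> * z)" by (simp add: exp_add[symmetric] mult.assoc)
  have e1: "exp (\<i> * z) * exp (- (\<i> * z)) = 1" by (simp add: exp_add[symmetric])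
  have s: "2 * \<i> * sin z = exp (\<i> * z) - exp (- (\<i> * z))" by (simp add: sin_exp_eq)
  have "2 * \<i> * sin z * exp (\<i> * z) = exp (2 * \<i> * z) - 1"
    unfolding s e by (simp add: left_diff_distrib mult.commute[of "exp (- (\<i> * z))"] e1)
  then have "(2 * \<i> * sin z * exp (\<i> * z))^2 = (1 - exp (2 * \<i> * z))^2"
    by (simp add: power2_commute)
  moreover have "(2 * \<i> * sin z * exp (\<i> * z))^2 = sin z ^ 2 * (- 4 * exp (2 * \<i> * z))"
    unfolding e by (simp add: power_mult_distrib power2_eq_square mult_ac)
  ultimately show ?thesis by simp
qed

lemma Im_minus_inverse_pos: "Im \<tau> > 0 \<Longrightarrow> Im (- 1 / \<tau>) > 0"
  by (auto simp: Im_divide complex_eq_iff sum_power2_gt_zero_iff intro!: divide_neg_pos)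

lemma norm_exp_upper: "norm (exp (2 * of_real pi * \<i> * \<tau>)) < 1 \<longleftrightarrow> Im \<tau> > 0"
  by (simp add: norm_exp_eq_Re zero_less_mult_iff)

text \<open>The ends of the telescoping sum over the columns do not cancel, as cot tends to i at one
  end and to -i at the other. This is the origin of the term 2 pi i / tau in the inversion
  formula.\<close>

lemma cot_column_at_top:
  assumes \<tau>: "Im \<tau> > 0"
  shows "(\<lambda>M. cot_column \<tau> (int M - 1)) \<longlonglongrightarrow> of_real pi * \<i> / \<tau>"
    and "(\<lambda>M. cot_column \<tau> (- int M - 1)) \<longlonglongrightarrow> - (of_real pi * \<i> / \<tau>)"
proof -
  have \<tau>0: "\<tau> \<noteq> 0" using \<tau> by auto
  define \<rho> where "\<rho> = exp (2 * of_real pi * \<i> * (- 1 / \<tau>))"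
  have \<rho>: "norm \<rho> < 1" unfolding \<rho>_def norm_exp_upper by (rule Im_minus_inverse_pos[OF \<tau>])
  have eq: "cot_column \<tau> (int M) = of_real pi / \<tau> * (\<i> * (1 + \<rho> ^ M) / (1 - \<rho> ^ M)) - inverse (of_nat M)"
    if "M > 0" for M
  proof -
    have "Im (of_int (int M) / \<tau>) \<noteq> 0"
      using \<tau> that by (auto simp: Im_divide complex_eq_iff)
    then have "cot (of_real pi * (of_int (int M) / \<tau>)) = \<i> * (1 + exp (- 2 * \<i> * (of_real pi * (of_int (int M) / \<tau>))))
        / (1 - exp (- 2 * \<i> * (of_real pi * (of_int (int M) / \<tau>))))"
      by (intro cot_eq_exp sin_pi_nonreal)
    moreover have "exp (- 2 * \<i> * (of_real pi * (of_int (int M) / \<tau>))) = \<rho> ^ M"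
      unfolding \<rho>_def exp_of_nat_mult[symmetric] by (simp add: mult_ac)
    ultimately show ?thesis using that by (simp add: cot_column_def inverse_eq_divide)
  qed
  have "(\<lambda>M. \<rho> ^ M) \<longlonglongrightarrow> 0" using \<rho> by (rule LIMSEQ_power_zero)
  then have "(\<lambda>M. of_real pi / \<tau> * (\<i> * (1 + \<rho> ^ M) / (1 - \<rho> ^ M)) - inverse (of_nat M))
     \<longlonglongrightarrow> of_real pi / \<tau> * (\<i> * (1 + 0) / (1 - 0)) - 0"
    by (intro tendsto_diff tendsto_mult tendsto_divide tendsto_add tendsto_const lim_inverse_n) auto
  moreover have "\<forall>\<^sub>F M in sequentially. of_real pi / \<tau> * (\<i> * (1 + \<rho> ^ M) / (1 - \<rho> ^ M)) - inverse (of_nat M)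
      = cot_column \<tau> (int M)"
    using eventually_mono[OF eventually_gt_at_top[of "0 :: nat"]] eq by simp
  ultimately have lim: "(\<lambda>M. cot_column \<tau> (int M)) \<longlonglongrightarrow> of_real pi * \<i> / \<tau>"
    by (auto dest: Lim_transform_eventually)
  have odd: "cot_column \<tau> (- m) = - cot_column \<tau> m" for m
    by (simp add: cot_column_def cot_def algebra_simps)
  have "(\<lambda>M. cot_column \<tau> (int (Suc M) - 1)) \<longlonglongrightarrow> of_real pi * \<i> / \<tau>" using lim by simp
  then show "(\<lambda>M. cot_column \<tau> (int M - 1)) \<longlonglongrightarrow> of_real pi * \<i> / \<tau>"
    by (rule LIMSEQ_imp_Suc)
  have "- int M - 1 = - int (Suc M)" for M by simp
  then show "(\<lambda>M. cot_column \<tau> (- int M - 1)) \<longlonglongrightarrow> - (of_real pi * \<i> / \<tau>)"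
    unfolding odd by (simp only: odd) (intro tendsto_minus LIMSEQ_Suc[OF lim])
qed

text \<open>Summing the same absolutely convergent double series by rows and by columns
  (Hurwitz's method) shows that the two conditionally convergent sums for \<open>G\<^sub>2\<close> differ by
  \<open>2 \<pi> \<i> / \<tau>\<close>.\<close>

theorem sin_sum_inversion:
  assumes \<tau>: "Im \<tau> > 0"
  shows "sin_sum \<tau> = 2 * of_real pi * \<i> / \<tau> + of_real (pi^2 / 3) / \<tau>^2 + sin_sum (- 1 / \<tau>) / \<tau>^2 - of_real (pi^2 / 3)"
proof -
  let ?c = "\<lambda>m. cot_column \<tau> (m - 1) - cot_column \<tau> m - square_column \<tau> m"
  have "(\<lambda>m. \<Sum>\<^sub>\<infinity>n\<in>UNIV - {0}. lattice_term \<tau> m n) summable_on UNIV"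
    using summable_on_Sigma_banach[OF lattice_term_summable[OF \<tau>]] by simp
  moreover have inner: "(\<Sum>\<^sub>\<infinity>n\<in>UNIV - {0}. lattice_term \<tau> m n) = ?c m" for m
    using lattice_column[OF \<tau>] by (rule infsumI)
  ultimately have summ: "?c summable_on UNIV" by simp
  have "infsum ?c UNIV = - sin_sum \<tau>" using sin_sum_rows[OF \<tau>] by (simp only: inner)
  then have "(?c has_sum - sin_sum \<tau>) UNIV" using summ by (metis has_sum_infsum)
  from has_sum_int_limit[OF this]
  have lim: "(\<lambda>M. sum ?c {- int M..<int M}) \<longlonglongrightarrow> - sin_sum \<tau>" by simp
  have sum_sin: "(\<lambda>M. \<Sum>m\<in>{- int M..<int M} \<inter> (UNIV - {0}). (of_real pi / sin (of_real pi * (of_int m / \<tau>)))^2)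
      \<longlonglongrightarrow> sin_sum (- 1 / \<tau>)"
    using has_sum_int_limit[OF sin_sum[OF Im_minus_inverse_pos[OF \<tau>]]] by simp
  \<comment> \<open>Column 0 gives pi^2 / (3 tau^2); the other columns give
    \<open>sin_sum (- 1 / \<tau>) / \<tau>^2\<close> minus the removed terms n = 0, which add up to
    pi^2 / 3.\<close>
  have "(\<lambda>M. of_real (pi^2 / 3) / \<tau>^2 + (\<Sum>m\<in>{- int M..<int M} \<inter> (UNIV - {0}). (of_real pi / sin (of_real pi * (of_int m / \<tau>)))^2) / \<tau>^2
       - (\<Sum>n\<in>{- int M..<int M} \<inter> (UNIV - {0}). 1 / (of_int n)^2))
     \<longlonglongrightarrow> of_real (pi^2 / 3) / \<tau>^2 + sin_sum (- 1 / \<tau>) / \<tau>^2 - of_real (pi^2 / 3)"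
    using \<tau> by (intro tendsto_intros sum_sin inverse_squares_limit) auto
  moreover have "of_real (pi^2 / 3) / \<tau>^2 + (\<Sum>m\<in>{- int M..<int M} \<inter> (UNIV - {0}). (of_real pi / sin (of_real pi * (of_int m / \<tau>)))^2) / \<tau>^2
       - (\<Sum>n\<in>{- int M..<int M} \<inter> (UNIV - {0}). 1 / (of_int n)^2) = (\<Sum>m\<in>{- int M..<int M}. square_column \<tau> m)" if "M > 0" for M
  proof -
    have "(\<Sum>m\<in>{- int M..<int M}. square_column \<tau> m)
        = square_column \<tau> 0 + (\<Sum>m\<in>{- int M..<int M} \<inter> (UNIV - {0}). square_column \<tau> m)"
      using that by (simp add: sum_int_interval_nonzero)
    also have "(\<Sum>m\<in>{- int M..<int M} \<inter> (UNIV - {0}). square_column \<tau> m)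
       = (\<Sum>m\<in>{- int M..<int M} \<inter> (UNIV - {0}). (of_real pi / sin (of_real pi * (of_int m / \<tau>)))^2 / \<tau>^2 - 1 / (of_int m)^2)"
      by (intro sum.cong) (auto simp: square_column_def)
    finally show ?thesis by (simp add: square_column_def sum_subtractf sum_divide_distrib)
  qed
  then have "\<forall>\<^sub>F M in sequentially. of_real (pi^2 / 3) / \<tau>^2 + (\<Sum>m\<in>{- int M..<int M} \<inter> (UNIV - {0}). (of_real pi / sin (of_real pi * (of_int m / \<tau>)))^2) / \<tau>^2
       - (\<Sum>n\<in>{- int M..<int M} \<inter> (UNIV - {0}). 1 / (of_int n)^2) = (\<Sum>m\<in>{- int M..<int M}. square_column \<tau> m)"
    using eventually_mono[OF eventually_gt_at_top[of "0 :: nat"]] by simp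
  ultimately have sq: "(\<lambda>M. \<Sum>m\<in>{- int M..<int M}. square_column \<tau> m)
     \<longlonglongrightarrow> of_real (pi^2 / 3) / \<tau>^2 + sin_sum (- 1 / \<tau>) / \<tau>^2 - of_real (pi^2 / 3)"
    by (rule Lim_transform_eventually)
  have "(\<lambda>M. (cot_column \<tau> (- int M - 1) - cot_column \<tau> (int M - 1)) - (\<Sum>m\<in>{- int M..<int M}. square_column \<tau> m))
     \<longlonglongrightarrow> (- (of_real pi * \<i> / \<tau>) - of_real pi * \<i> / \<tau>)
        - (of_real (pi^2 / 3) / \<tau>^2 + sin_sum (- 1 / \<tau>) / \<tau>^2 - of_real (pi^2 / 3))"
    by (intro tendsto_diff cot_column_at_top[OF \<tau>] sq)
  moreover have "(cot_column \<tau> (- int M - 1) - cot_column \<tau> (int M - 1)) - (\<Sum>m\<in>{- int M..<int M}. square_column \<tau> m)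
      = sum ?c {- int M..<int M}" for M
    unfolding sum_subtractf[of "\<lambda>m. cot_column \<tau> (m - 1) - cot_column \<tau> m"] sum_telescope_int by (rule refl)
  ultimately have "(- (of_real pi * \<i> / \<tau>) - of_real pi * \<i> / \<tau>)
        - (of_real (pi^2 / 3) / \<tau>^2 + sin_sum (- 1 / \<tau>) / \<tau>^2 - of_real (pi^2 / 3)) = - sin_sum \<tau>"
    using LIMSEQ_unique[OF _ lim] by simp
  then have "sin_sum \<tau> = - ((- (of_real pi * \<i> / \<tau>) - of_real pi * \<i> / \<tau>)
        - (of_real (pi^2 / 3) / \<tau>^2 + sin_sum (- 1 / \<tau>) / \<tau>^2 - of_real (pi^2 / 3)))"
    by (metis minus_minus)
  then show ?thesis by (simp add: algebra_simps)
qed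

text \<open>(pi / sin(pi z))^2 equals -4 pi^2 w / (1 - w)^2 with w = exp(2 pi i z), and the terms
  for n and -n agree, whence the factor 8.\<close>

lemma sin_sum_q_series:
  assumes \<tau>: "Im \<tau> > 0"
  defines "q \<equiv> exp (2 * of_real pi * \<i> * \<tau>)"
  shows "(\<lambda>k. q ^ Suc k / (1 - q ^ Suc k)^2) sums (- sin_sum \<tau> / (8 * of_real pi^2))"
proof -
  let ?f = "\<lambda>n. (of_real pi / sin (of_real pi * (of_int n * \<tau>)))^2 :: complex"
  have even: "?f (- n) = ?f n" for n by simp
  have f: "?f (int (Suc k)) = - 4 * of_real pi^2 * (q ^ Suc k / (1 - q ^ Suc k)^2)" for k
  proof -
    have "Im (of_int (int (Suc k)) * \<tau>) \<noteq> 0" using \<tau> by simp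
    then have s: "sin (of_real pi * (of_int (int (Suc k)) * \<tau>)) \<noteq> 0" by (rule sin_pi_nonreal)
    have e: "exp (2 * \<i> * (of_real pi * (of_int (int (Suc k)) * \<tau>))) = q ^ Suc k"
      unfolding q_def exp_of_nat_mult[symmetric] by (simp add: mult_ac)
    have sq: "(1 - q ^ Suc k)^2 = sin (of_real pi * (of_int (int (Suc k)) * \<tau>)) ^ 2 * (- 4 * q ^ Suc k)"
      using sin_squared_eq_exp[of "of_real pi * (of_int (int (Suc k)) * \<tau>)"] unfolding e by (rule sym)
    have "q ^ Suc k \<noteq> 0" by (simp add: q_def)
    then show ?thesis unfolding sq using s by (simp only: power_divide) (simp add: field_simps)
  qed
  have "(\<lambda>M. sum ?f ({- int (Suc M)..<int (Suc M)} \<inter> (UNIV - {0}))) \<longlonglongrightarrow> sin_sum \<tau>"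
    using has_sum_int_limit[OF sin_sum[OF \<tau>]] by (rule LIMSEQ_Suc)
  also have "(\<lambda>M. sum ?f ({- int (Suc M)..<int (Suc M)} \<inter> (UNIV - {0})))
     = (\<lambda>M. (\<Sum>k<M. ?f (int (Suc k))) + (\<Sum>k<Suc M. ?f (int (Suc k))))"
  proof
    fix M
    have "- 1 - int k = - int (Suc k)" for k by simp
    then have "?f (- 1 - int k) = ?f (int (Suc k))" for k by (simp only: even)
    then show "sum ?f ({- int (Suc M)..<int (Suc M)} \<inter> (UNIV - {0}))
        = (\<Sum>k<M. ?f (int (Suc k))) + (\<Sum>k<Suc M. ?f (int (Suc k)))"
      by (simp only: sum_int_interval_nonzero zero_less_Suc sum_int_interval sum.lessThan_Suc_shift) simp
  qed
  finally have lim: "(\<lambda>M. (\<Sum>k<M. ?f (int (Suc k))) + (\<Sum>k<Suc M. ?f (int (Suc k)))) \<longlonglongrightarrow> sin_sum \<tau>" .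
  have "(\<lambda>k. ?f (int (Suc k))) summable_on UNIV"
  proof -
    have "?f summable_on (range (\<lambda>k. int (Suc k)))"
      by (rule summable_on_subset_banach[OF has_sum_imp_summable[OF sin_sum[OF \<tau>]]]) auto
    then show ?thesis by (subst (asm) summable_on_reindex) (auto simp: inj_on_def o_def)
  qed
  then have "summable (\<lambda>k. ?f (int (Suc k)))" by (rule summable_on_imp_summable)
  then have s: "(\<lambda>k. ?f (int (Suc k))) sums (\<Sum>k. ?f (int (Suc k)))" by (rule summable_sums)
  then have "(\<lambda>M. (\<Sum>k<M. ?f (int (Suc k))) + (\<Sum>k<Suc M. ?f (int (Suc k))))
     \<longlonglongrightarrow> (\<Sum>k. ?f (int (Suc k))) + (\<Sum>k. ?f (int (Suc k)))"
    unfolding sums_def by (intro tendsto_add LIMSEQ_Suc)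
  have half: "x = y / 2" if "x + x = y" for x y :: complex using that by auto
  note half[OF LIMSEQ_unique[OF \<open>(\<lambda>M. (\<Sum>k<M. ?f (int (Suc k))) + (\<Sum>k<Suc M. ?f (int (Suc k))))
     \<longlonglongrightarrow> (\<Sum>k. ?f (int (Suc k))) + (\<Sum>k. ?f (int (Suc k)))\<close> lim]]
  then have "(\<lambda>k. ?f (int (Suc k))) sums (sin_sum \<tau> / 2)" using s by (simp only:)
  then have "(\<lambda>k. ?f (int (Suc k)) / (- 4 * of_real pi^2)) sums (sin_sum \<tau> / 2 / (- 4 * of_real pi^2))"
    by (rule sums_divide)
  then show ?thesis unfolding f by simp
qed

section \<open>The Dedekind eta function\<close>

text \<open>Logarithm of Euler's product of the 1 - q^m as a Lambert series: the terms -q^(mk) / k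
  are summed over m first. In this form it is single-valued and holomorphic on the unit
  disc.\<close>

definition euler_log :: "complex \<Rightarrow> complex" where
  "euler_log q = (\<Sum>k. - (q ^ Suc k / (of_nat (Suc k) * (1 - q ^ Suc k))))"

text \<open>The termwise derivative of \<open>euler_log\<close>; q times it is minus the generating
  series of the divisor sums sigma(m).\<close>

definition euler_dlog :: "complex \<Rightarrow> complex" where
  "euler_dlog q = (\<Sum>k. - (q ^ k / (1 - q ^ Suc k)^2))"

lemma norm_one_minus_power_ge:
  fixes q :: complex
  assumes "norm q \<le> r" "r < 1"
  shows "norm (1 - q ^ Suc k) \<ge> 1 - r"
proof -
  have r: "0 \<le> r" using norm_ge_zero[of q] assms(1) by linarith
  have "norm (q ^ Suc k) \<le> r ^ Suc k" unfolding norm_power by (intro power_mono assms) auto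
  also have "\<dots> \<le> r ^ 1" using assms r by (intro power_decreasing) auto
  finally have "norm (q ^ Suc k) \<le> r" by simp
  then show ?thesis using norm_triangle_ineq2[of 1 "q ^ Suc k"] by simp
qed

lemma one_minus_power_nonzero:
  fixes q :: complex
  assumes "norm q < 1"
  shows "1 - q ^ Suc k \<noteq> 0"
  using norm_one_minus_power_ge[of q "norm q" k] assms by auto

lemma norm_power_Suc_less_one:
  fixes q :: complex
  assumes "norm q < 1"
  shows "norm (q ^ Suc k) < 1"
proof -
  have "norm q ^ Suc k < 1 ^ Suc k" using assms by (intro power_strict_mono) auto
  then show ?thesis by (simp only: norm_power power_one)
qed

text \<open>On a disc of radius r < 1 the derivatives of the terms are dominated by r^k / (1 - r)^2,
  so the series may be differentiated termwise.\<close>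

lemma has_field_derivative_euler_log:
  assumes "norm q < 1"
  shows "(euler_log has_field_derivative euler_dlog q) (at q)"
proof -
  define r where "r = (1 + norm q) / 2"
  have r: "norm q < r" "r < 1" "r > 0" using assms norm_ge_zero[of q] by (auto simp: r_def simp del: norm_ge_zero)
  let ?f = "\<lambda>k q :: complex. - (q ^ Suc k / (of_nat (Suc k) * (1 - q ^ Suc k)))"
  let ?f' = "\<lambda>k q :: complex. - (q ^ k / (1 - q ^ Suc k)^2)"
  have "((\<lambda>q. \<Sum>k. ?f k q) has_field_derivative (\<Sum>k. ?f' k q)) (at q)"
  proof (rule has_field_derivative_series'(2)[where S = "ball 0 r" and ?x0.0 = 0])
    show "(?f k has_field_derivative ?f' k x) (at x within ball 0 r)" if "x \<in> ball 0 r" for k x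
    proof -
      have n: "1 - x ^ Suc k \<noteq> 0" using that r by (intro one_minus_power_nonzero) auto
      have k: "(of_nat (Suc k) :: complex) \<noteq> 0" by (simp del: of_nat_Suc)
      have p: "((\<lambda>x. x ^ Suc k) has_field_derivative of_nat (Suc k) * x ^ k) (at x within ball 0 r)"
        by (rule derivative_eq_intros refl | simp)+
      have "((\<lambda>x. x ^ Suc k / (of_nat (Suc k) * (1 - x ^ Suc k))) has_field_derivative
          ((of_nat (Suc k) * x ^ k) * (of_nat (Suc k) * (1 - x ^ Suc k))
             - x ^ Suc k * (of_nat (Suc k) * (0 - of_nat (Suc k) * x ^ k)))
          / ((of_nat (Suc k) * (1 - x ^ Suc k)) * (of_nat (Suc k) * (1 - x ^ Suc k)))) (at x within ball 0 r)"
        using n k by (intro DERIV_divide p DERIV_cmult DERIV_diff DERIV_const) simp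
      also have "((of_nat (Suc k) * x ^ k) * (of_nat (Suc k) * (1 - x ^ Suc k))
             - x ^ Suc k * (of_nat (Suc k) * (0 - of_nat (Suc k) * x ^ k)))
          = (of_nat (Suc k) * of_nat (Suc k)) * x ^ k" by (simp add: algebra_simps)
      also have "(of_nat (Suc k) * of_nat (Suc k)) * x ^ k / ((of_nat (Suc k) * (1 - x ^ Suc k)) * (of_nat (Suc k) * (1 - x ^ Suc k)))
          = x ^ k / (1 - x ^ Suc k)^2"
        using n k by (simp add: power2_eq_square divide_simps del: of_nat_Suc power_Suc)
      finally show ?thesis by (rule DERIV_minus)
    qed
    show "uniformly_convergent_on (ball 0 r) (\<lambda>n x. \<Sum>i<n. ?f' i x)"
    proof (rule Weierstrass_m_test')
      show "norm (?f' k x) \<le> r ^ k / (1 - r)^2" if "x \<in> ball 0 r" for k x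
      proof -
        have "norm (?f' k x) = norm x ^ k / norm (1 - x ^ Suc k) ^ 2"
          by (simp add: norm_divide norm_power)
        also have "\<dots> \<le> r ^ k / (1 - r)^2"
          using norm_one_minus_power_ge[of x r k] that r
          by (intro frac_le power_mono) (auto simp del: power_Suc)
        finally show ?thesis .
      qed
      show "summable (\<lambda>k. r ^ k / (1 - r)^2)"
        using r by (intro summable_divide summable_geometric) auto
    qed
  qed (use r in auto)
  then show ?thesis unfolding euler_log_def[abs_def] euler_dlog_def .
qed

lemma euler_log_0 [simp]: "euler_log 0 = 0"
  by (simp add: euler_log_def)

lemma holomorphic_euler_log: "euler_log holomorphic_on ball 0 1"
  unfolding holomorphic_on_def field_differentiable_def
proof (intro ballI exI)
  fix q :: complex assume "q \<in> ball 0 1"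
  then have "norm q < 1" by simp
  from has_field_derivative_euler_log[OF this]
  show "(euler_log has_field_derivative euler_dlog q) (at q within ball 0 1)"
    by (rule has_field_derivative_at_within)
qed

text \<open>Interchange of summation in an absolutely summable double series: its rows are Taylor
  series of Ln, its columns geometric series.\<close>

lemma euler_log_sums:
  assumes q: "norm q < 1"
  shows "(\<lambda>m. Ln (1 - q ^ Suc m)) sums euler_log q"
proof -
  define a where "a m k = - ((q ^ Suc m) ^ Suc k / of_nat (Suc k))" for m k
  have geo: "summable (\<lambda>n. norm q ^ n)" using q by (intro summable_geometric) simp
  then have g: "(\<lambda>n. norm q ^ n) summable_on UNIV" by (intro summable_nonneg_imp_summable_on) auto
  have "(\<lambda>x. norm (case x of (m, k) \<Rightarrow> norm q ^ m * norm q ^ k)) summable_on (UNIV \<times> UNIV)"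
  proof (subst Infinite_Sum.abs_summable_on_Sigma_iff, intro conjI ballI)
    show "(\<lambda>n. norm (case (m, n) of (m, k) \<Rightarrow> norm q ^ m * norm q ^ k)) summable_on UNIV" for m
      using summable_on_cmult_right[OF g, of "norm q ^ m"] by simp
    have "(\<Sum>\<^sub>\<infinity>n. norm (case (m, n) of (m, k) \<Rightarrow> norm q ^ m * norm q ^ k)) = norm q ^ m * (\<Sum>\<^sub>\<infinity>n. norm q ^ n)" for m
      using infsum_cmult_right[of "norm q ^ m" "\<lambda>n. norm q ^ n" UNIV] g by simp
    moreover have "norm (norm q ^ m * (\<Sum>\<^sub>\<infinity>n. norm q ^ n)) = norm q ^ m * (\<Sum>\<^sub>\<infinity>n. norm q ^ n)" for m
      using infsum_nonneg[of UNIV "\<lambda>n. norm q ^ n"] by simp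
    ultimately show "(\<lambda>m. norm (\<Sum>\<^sub>\<infinity>n. norm (case (m, n) of (m, k) \<Rightarrow> norm q ^ m * norm q ^ k))) summable_on UNIV"
      using summable_on_cmult_left[OF g, of "\<Sum>\<^sub>\<infinity>n. norm q ^ n"] by (simp only:)
  qed
  then have "(\<lambda>x. norm (case x of (m, k) \<Rightarrow> a m k)) summable_on (UNIV \<times> UNIV)"
  proof (rule Infinite_Sum.abs_summable_on_comparison_test)
    fix x :: "nat \<times> nat"
    obtain m k where x: "x = (m, k)" by fastforce
    have "norm (a m k) = norm q ^ (Suc m * Suc k) / real (Suc k)"
      by (simp only: a_def norm_minus_cancel norm_divide norm_power power_mult norm_of_nat)
    also have "\<dots> \<le> norm q ^ (Suc m * Suc k) / 1"
      by (intro divide_left_mono) auto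
    also have "\<dots> \<le> norm q ^ (m + k)"
      using q by (simp only: div_by_1, intro power_decreasing) auto
    finally show "norm (case x of (m, k) \<Rightarrow> a m k) \<le> norm (case x of (m, k) \<Rightarrow> norm q ^ m * norm q ^ k)"
      by (simp add: x power_add)
  qed
  then have summ: "(\<lambda>(m, k). a m k) summable_on (UNIV \<times> UNIV)" by (rule Infinite_Sum.abs_summable_summable)
  then have summ': "(\<lambda>(k, m). a m k) summable_on (UNIV \<times> UNIV)"
    by (subst summable_on_swap) (simp add: case_prod_unfold o_def)
  have row: "(\<Sum>\<^sub>\<infinity>k. a m k) = Ln (1 - q ^ Suc m)" for m
  proof -
    have "(\<lambda>k. a m k) summable_on UNIV" using summable_on_SigmaD1[OF summ] by simp
    then have "a m sums infsum (a m) UNIV" by (intro has_sum_imp_sums) simp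
    moreover have "norm (- (q ^ Suc m)) < 1"
      using norm_power_Suc_less_one[OF q] by (simp only: norm_minus_cancel)
    then have "(\<lambda>n. - ((q ^ Suc m) ^ n) / of_nat n) sums Ln (1 - q ^ Suc m)"
      using Ln_series'[of "- (q ^ Suc m)"] by simp
    then have "(\<lambda>n. - ((q ^ Suc m) ^ Suc n) / of_nat (Suc n)) sums (Ln (1 - q ^ Suc m) - - ((q ^ Suc m) ^ 0) / of_nat 0)"
      by (subst sums_Suc_iff) simp
    ultimately show ?thesis by (simp add: a_def[abs_def] sums_iff)
  qed
  have col: "(\<Sum>\<^sub>\<infinity>m. a m k) = - (q ^ Suc k / (of_nat (Suc k) * (1 - q ^ Suc k)))" for k
  proof -
    have "(\<lambda>m. a m k) summable_on UNIV" using summable_on_SigmaD1[OF summ'] by simp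
    then have "(\<lambda>m. a m k) sums infsum (\<lambda>m. a m k) UNIV" by (intro has_sum_imp_sums) simp
    moreover have "norm (q ^ Suc k) < 1" by (rule norm_power_Suc_less_one[OF q])
    then have "(\<lambda>m. (q ^ Suc k) ^ m) sums (1 / (1 - q ^ Suc k))" by (rule geometric_sums)
    then have "(\<lambda>m. - (q ^ Suc k / of_nat (Suc k)) * (q ^ Suc k) ^ m) sums (- (q ^ Suc k / of_nat (Suc k)) * (1 / (1 - q ^ Suc k)))"
      by (rule sums_mult)
    moreover have "- (q ^ Suc k / of_nat (Suc k)) * (q ^ Suc k) ^ m = a m k" for m
    proof -
      have "(q ^ Suc m) ^ Suc k = q ^ Suc k * (q ^ Suc k) ^ m"
        unfolding power_mult[symmetric] power_add[symmetric] by (simp add: algebra_simps)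
      then show ?thesis by (simp only: a_def) simp
    qed
    ultimately have "infsum (\<lambda>m. a m k) UNIV = - (q ^ Suc k / of_nat (Suc k)) * (1 / (1 - q ^ Suc k))"
      using sums_unique2 by force
    then show ?thesis by (simp del: power_Suc of_nat_Suc)
  qed
  have "(\<lambda>m. \<Sum>\<^sub>\<infinity>k. a m k) summable_on UNIV" using summable_on_Sigma_banach[OF summ] by simp
  then have 1: "(\<lambda>m. Ln (1 - q ^ Suc m)) sums (\<Sum>\<^sub>\<infinity>m. \<Sum>\<^sub>\<infinity>k. a m k)"
    unfolding row by (intro has_sum_imp_sums) simp
  have "(\<lambda>k. \<Sum>\<^sub>\<infinity>m. a m k) summable_on UNIV" using summable_on_Sigma_banach[OF summ'] by simp
  then have "(\<lambda>k. - (q ^ Suc k / (of_nat (Suc k) * (1 - q ^ Suc k)))) sums (\<Sum>\<^sub>\<infinity>k. \<Sum>\<^sub>\<infinity>m. a m k)"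
    unfolding col by (intro has_sum_imp_sums) simp
  then have "euler_log q = (\<Sum>\<^sub>\<infinity>k. \<Sum>\<^sub>\<infinity>m. a m k)" by (simp only: euler_log_def sums_iff)
  also have "\<dots> = (\<Sum>\<^sub>\<infinity>m. \<Sum>\<^sub>\<infinity>k. a m k)" by (rule infsum_swap_banach[OF summ'])
  finally show ?thesis using 1 by simp
qed

lemma exp_euler_log:
  assumes q: "norm q < 1"
  shows "(\<lambda>M. \<Prod>k<M. 1 - q ^ Suc k) \<longlonglongrightarrow> exp (euler_log q)"
proof -
  have "(\<lambda>M. exp (\<Sum>k<M. Ln (1 - q ^ Suc k))) \<longlonglongrightarrow> exp (euler_log q)"
    using euler_log_sums[OF q] unfolding sums_def by (rule tendsto_exp)
  also have "(\<lambda>M. exp (\<Sum>k<M. Ln (1 - q ^ Suc k))) = (\<lambda>M. \<Prod>k<M. 1 - q ^ Suc k)"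
    using one_minus_power_nonzero[OF q] by (simp add: exp_sum del: power_Suc)
  finally show ?thesis .
qed

text \<open>The partial products are integer polynomials converging uniformly near 0. Each Taylor
  coefficient is therefore a limit of integers, and Z is closed.\<close>

lemma euler_product_expansion:
  obtains \<Phi> where "(\<lambda>q. exp (euler_log q)) has_fps_expansion \<Phi>" "coeffs_in \<int> \<Phi>"
    "fps_nth \<Phi> 0 = 1" "fps_nth \<Phi> 1 = -1"
proof -
  define f where "f M q = (\<Prod>k<M. 1 - q ^ Suc k)" for M and q :: complex
  define F where "F M = (\<Prod>k<M. 1 - fps_X ^ Suc k :: complex fps)" for M
  let ?B = "cball 0 (1/2) :: complex set"
  have "uniformly_convergent_on ?B (\<lambda>M q. \<Prod>k<M. 1 - q ^ Suc k)"
  proof (rule uniformly_convergent_on_prod')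
    show "uniformly_convergent_on ?B (\<lambda>N q. \<Sum>n<N. norm (1 - q ^ Suc n - 1))"
    proof (rule Weierstrass_m_test')
      show "norm (norm (1 - q ^ Suc n - 1)) \<le> (1/2) ^ Suc n" if "q \<in> ?B" for n q
      proof -
        have "norm q ^ Suc n \<le> (1/2) ^ Suc n" using that by (intro power_mono) auto
        moreover have "1 - q ^ Suc n - 1 = - (q ^ Suc n)" by simp
        ultimately show ?thesis by (simp only: norm_minus_cancel norm_power real_norm_def abs_norm_cancel power_abs)
      qed
      show "summable (\<lambda>n. (1/2 :: real) ^ Suc n)" by (subst summable_Suc_iff) (intro summable_geometric, simp)
    qed
  qed (auto intro!: continuous_intros)
  then obtain g where g: "uniform_limit ?B f g sequentially"
    unfolding uniformly_convergent_on_def f_def by blast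
  have "g q = exp (euler_log q)" if "q \<in> ?B" for q
  proof -
    have "(\<lambda>M. f M q) \<longlonglongrightarrow> g q" using g that by (rule tendsto_uniform_limitI)
    moreover have "(\<lambda>M. f M q) \<longlonglongrightarrow> exp (euler_log q)"
      unfolding f_def using that by (intro exp_euler_log) auto
    ultimately show ?thesis by (rule LIMSEQ_unique)
  qed
  then have "uniform_limit ?B f (\<lambda>q. exp (euler_log q)) sequentially"
    using g by (subst uniform_limit_cong'[of ?B f f _ g]) auto
  then have ul: "uniform_limit (ball 0 (1/2)) f (\<lambda>q. exp (euler_log q)) sequentially"
    by (rule uniform_limit_on_subset) auto
  have hf: "f M holomorphic_on A" for M A unfolding f_def by (intro holomorphic_intros)
  have fF: "f M has_fps_expansion F M" for M
    unfolding f_def F_def by (intro fps_expansion_intros)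
  have F_int: "coeffs_in \<int> (F M)" for M
  proof (induction M)
    case 0
    show ?case by (simp add: F_def coeffs_in_1[OF closed_coeffs_Ints])
  next
    case (Suc M)
    have "coeffs_in \<int> (F M * (1 - fps_X ^ Suc M))"
      using closed_coeffs_Ints Suc by (intro coeffs_in_mult coeffs_in_diff coeffs_in_power coeffs_in_X coeffs_in_1)
    then show ?case by (simp add: F_def)
  qed
  have F0: "fps_nth (F M) 0 = 1" for M
    by (induction M) (auto simp: F_def)
  have F1: "fps_nth (F (Suc M)) 1 = -1" for M
  proof (induction M)
    case (Suc M)
    have "F (Suc (Suc M)) = F (Suc M) * (1 - fps_X ^ Suc (Suc M))" by (simp add: F_def)
    then show ?case using Suc F0[of "Suc M"] by (simp only: fps_mult_nth_1) (simp add: fps_X_power_iff)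
  qed (simp add: F_def)
  have "(\<lambda>q. exp (euler_log q)) holomorphic_on ball 0 1"
    by (intro holomorphic_on_exp' holomorphic_euler_log | intro holomorphic_intros holomorphic_euler_log)+
  then have "(\<lambda>q. exp (euler_log q)) analytic_on {0}"
    by (auto simp: analytic_at intro!: exI[of _ "ball 0 1"])
  then obtain \<Phi> where \<Phi>: "(\<lambda>q. exp (euler_log q)) has_fps_expansion \<Phi>"
    using analytic_at_imp_has_fps_expansion_0 by blast
  have lim: "(\<lambda>M. fps_nth (F M) j) \<longlonglongrightarrow> fps_nth \<Phi> j" for j
  proof -
    have "(\<lambda>M. (deriv ^^ j) (f M) 0) \<longlonglongrightarrow> (deriv ^^ j) (\<lambda>q. exp (euler_log q)) 0"
      by (rule higher_deriv_complex_uniform_limit[OF ul]) (auto intro!: hf always_eventually)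
    then have "(\<lambda>M. (deriv ^^ j) (f M) 0 / fact j) \<longlonglongrightarrow> (deriv ^^ j) (\<lambda>q. exp (euler_log q)) 0 / fact j"
      by (intro tendsto_divide) auto
    then show ?thesis by (simp add: fps_nth_fps_expansion[OF fF] fps_nth_fps_expansion[OF \<Phi>])
  qed
  have "fps_nth \<Phi> j \<in> \<int>" for j
    using closed_sequentially[OF closed_Ints _ lim[of j]] F_int by (auto simp: coeffs_in_def)
  moreover have "fps_nth \<Phi> 0 = 1" using LIMSEQ_unique[OF lim[of 0]] by (simp add: F0)
  moreover have "fps_nth \<Phi> 1 = -1"
    using LIMSEQ_unique[OF LIMSEQ_Suc[OF lim[of 1]]] by (simp only: F1) simp
  ultimately show ?thesis using that \<Phi> by (auto simp: coeffs_in_def)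
qed

text \<open>Presents \<open>euler_dlog\<close> as the logarithmic derivative of an integral series
  with constant coefficient 1, which makes the coefficients of E_2 integral without any divisor
  sums.\<close>

lemma euler_dlog_expansion:
  assumes \<Phi>: "(\<lambda>q. exp (euler_log q)) has_fps_expansion \<Phi>" "fps_nth \<Phi> 0 = 1"
  shows "euler_dlog has_fps_expansion (fps_deriv \<Phi> * inverse \<Phi>)"
proof -
  have nhds: "\<forall>\<^sub>F q in nhds 0. q \<in> ball (0 :: complex) 1"
    by (intro eventually_nhds_in_open) auto
  have "(\<lambda>q. deriv (\<lambda>q. exp (euler_log q)) q * inverse (exp (euler_log q))) has_fps_expansion (fps_deriv \<Phi> * inverse \<Phi>)"
    using \<Phi> by (intro fps_expansion_intros) auto
  moreover have "\<forall>\<^sub>F q in nhds 0. deriv (\<lambda>q. exp (euler_log q)) q * inverse (exp (euler_log q)) = euler_dlog q"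
    using nhds
  proof eventually_elim
    case (elim q)
    have "((\<lambda>q. exp (euler_log q)) has_field_derivative (exp (euler_log q) * euler_dlog q)) (at q)"
      using elim by (intro DERIV_chain2[OF DERIV_exp] has_field_derivative_euler_log) auto
    then show ?case by (simp add: DERIV_imp_deriv exp_minus[symmetric] mult_ac exp_add[symmetric])
  qed
  ultimately show ?thesis using has_fps_expansion_cong[OF _ refl] by fast
qed

section \<open>E_2, the logarithm of eta, and their inversion formulas\<close>

definition nome :: "complex \<Rightarrow> complex" where
  "nome \<tau> = exp (2 * of_real pi * \<i> * \<tau>)"

lemma nome_nonzero [simp]: "nome \<tau> \<noteq> 0"
  by (simp add: nome_def)

lemma norm_nome: "norm (nome \<tau>) = exp (- 2 * pi * Im \<tau>)"
  by (simp add: nome_def norm_exp_eq_Re)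

lemma norm_nome_less_1: "norm (nome \<tau>) < 1 \<longleftrightarrow> Im \<tau> > 0"
  unfolding nome_def by (rule norm_exp_upper)

lemma nome_add_1 [simp]: "nome (\<tau> + 1) = nome \<tau>"
  by (simp add: nome_def distrib_left exp_add exp_two_pi_i')

lemma nome_minus_1 [simp]: "nome (\<tau> - 1) = nome \<tau>"
  using nome_add_1[of "\<tau> - 1"] by (simp del: nome_add_1)

lemma nome_double: "nome (2 * \<tau>) = nome \<tau> ^ 2"
  by (simp add: nome_def power2_eq_square exp_add[symmetric] mult_ac)

lemma has_field_derivative_nome [derivative_intros]:
  "(nome has_field_derivative 2 * of_real pi * \<i> * nome \<tau>) (at \<tau> within A)"
  unfolding nome_def[abs_def] by (auto intro!: derivative_eq_intros)

text \<open>This is E_2 = 1 - 24 (sigma(1) q + sigma(2) q^2 + ...), written through the Euler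
  product so that it is, up to a constant, the derivative of log eta.\<close>

definition eisenstein2 :: "complex \<Rightarrow> complex" where
  "eisenstein2 \<tau> = 1 + 24 * nome \<tau> * euler_dlog (nome \<tau>)"

lemma eisenstein2_eq_sin_sum:
  assumes \<tau>: "Im \<tau> > 0"
  shows "eisenstein2 \<tau> = 1 + 3 * sin_sum \<tau> / of_real pi^2"
proof -
  let ?q = "nome \<tau>"
  have "(\<lambda>k. ?q ^ Suc k / (1 - ?q ^ Suc k)^2) sums (- sin_sum \<tau> / (8 * of_real pi^2))"
    using sin_sum_q_series[OF \<tau>] unfolding nome_def .
  then have "(\<lambda>k. - (1 / ?q) * (?q ^ Suc k / (1 - ?q ^ Suc k)^2)) sums (- (1 / ?q) * (- sin_sum \<tau> / (8 * of_real pi^2)))"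
    by (rule sums_mult)
  moreover have "- (1 / ?q) * (?q ^ Suc k / (1 - ?q ^ Suc k)^2) = - (?q ^ k / (1 - ?q ^ Suc k)^2)" for k
    by simp
  ultimately have "(\<lambda>k. - (?q ^ k / (1 - ?q ^ Suc k)^2)) sums (- (1 / ?q) * (- sin_sum \<tau> / (8 * of_real pi^2)))"
    by (simp only:)
  then have "euler_dlog ?q = - (1 / ?q) * (- sin_sum \<tau> / (8 * of_real pi^2))"
    unfolding euler_dlog_def by (rule sums_unique[symmetric])
  then show ?thesis by (simp add: eisenstein2_def)
qed

lemma eisenstein2_inversion:
  assumes \<tau>: "Im \<tau> > 0"
  shows "eisenstein2 (- 1 / \<tau>) = \<tau>^2 * eisenstein2 \<tau> - 6 * \<i> * \<tau> / of_real pi"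
proof -
  have \<tau>0: "\<tau> \<noteq> 0" using \<tau> by auto
  define S where "S = sin_sum (- 1 / \<tau>)"
  define P where "P = (of_real pi :: complex)"
  have P0: "P \<noteq> 0" by (simp add: P_def)
  have "sin_sum \<tau> = 2 * P * \<i> / \<tau> + P^2 / 3 / \<tau>^2 + S / \<tau>^2 - P^2 / 3"
    using sin_sum_inversion[OF \<tau>] by (simp add: S_def P_def)
  then have "\<tau>^2 * sin_sum \<tau> = \<tau>^2 * (2 * P * \<i> / \<tau>) + P^2 / 3 + S - \<tau>^2 * (P^2 / 3)"
    using \<tau>0 by (simp add: distrib_left right_diff_distrib)
  also have "\<tau>^2 * (2 * P * \<i> / \<tau>) = 2 * P * \<i> * \<tau>" using \<tau>0 by (simp add: power2_eq_square)
  finally have t: "\<tau>^2 * sin_sum \<tau> = 2 * P * \<i> * \<tau> + P^2 / 3 + S - \<tau>^2 * (P^2 / 3)" .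
  have "\<tau>^2 * eisenstein2 \<tau> = \<tau>^2 + 3 * (\<tau>^2 * sin_sum \<tau>) / P^2"
    using eisenstein2_eq_sin_sum[OF \<tau>] by (simp add: P_def distrib_left)
  also have "3 * (\<tau>^2 * sin_sum \<tau>) / P^2 = 6 * \<i> * \<tau> / P + 1 + 3 * S / P^2 - \<tau>^2"
    unfolding t using P0 by (simp add: distrib_left right_diff_distrib add_divide_distrib diff_divide_distrib power2_eq_square)
  finally have "\<tau>^2 * eisenstein2 \<tau> = 6 * \<i> * \<tau> / P + (1 + 3 * S / P^2)" by simp
  also have "1 + 3 * S / P^2 = eisenstein2 (- 1 / \<tau>)"
    using eisenstein2_eq_sin_sum[OF Im_minus_inverse_pos[OF \<tau>]] by (simp add: S_def P_def)
  finally show ?thesis by (simp add: P_def)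
qed

definition eta_log :: "complex \<Rightarrow> complex" where
  "eta_log \<tau> = of_real pi * \<i> * \<tau> / 12 + euler_log (nome \<tau>)"

lemma has_field_derivative_eta_log:
  assumes "Im \<tau> > 0"
  shows "(eta_log has_field_derivative of_real pi * \<i> / 12 * eisenstein2 \<tau>) (at \<tau>)"
proof -
  have "((\<lambda>\<tau>. euler_log (nome \<tau>)) has_field_derivative euler_dlog (nome \<tau>) * (2 * of_real pi * \<i> * nome \<tau>)) (at \<tau>)"
    using assms by (intro DERIV_chain2[of euler_log] has_field_derivative_euler_log has_field_derivative_nome)
      (simp add: norm_nome_less_1)
  then show ?thesis
    unfolding eta_log_def[abs_def] eisenstein2_def
    by (auto intro!: derivative_eq_intros simp: algebra_simps)
qed

lemma eta_log_add_1: "eta_log (\<tau> + 1) = eta_log \<tau> + of_real pi * \<i> / 12"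
  unfolding eta_log_def nome_add_1 by (simp add: distrib_left add_divide_distrib)

text \<open>By the inversion of E_2 the difference of the two sides has derivative 0. The constant
  is read off at the fixed point i of the inversion, where the argument of \<open>Ln\<close> is
  1.\<close>

theorem eta_log_inversion:
  assumes \<tau>: "Im \<tau> > 0"
  shows "eta_log (- 1 / \<tau>) = eta_log \<tau> + Ln (- \<i> * \<tau>) / 2"
proof -
  define g where "g \<tau> = eta_log (- 1 / \<tau>) - eta_log \<tau> - Ln (- \<i> * \<tau>) / 2" for \<tau>
  let ?H = "{\<tau>. Im \<tau> > 0}"
  have g': "(g has_field_derivative 0) (at z)" if z: "z \<in> ?H" for z
  proof -
    have z': "Im z > 0" "z \<noteq> 0" using z by auto
    have "((\<lambda>z. - 1 / z) has_field_derivative 1 / z^2) (at z)"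
      using z' by (auto intro!: derivative_eq_intros simp: power2_eq_square)
    then have 1: "((\<lambda>z. eta_log (- 1 / z)) has_field_derivative
        of_real pi * \<i> / 12 * eisenstein2 (- 1 / z) * (1 / z^2)) (at z)"
      by (intro DERIV_chain2[of eta_log] has_field_derivative_eta_log Im_minus_inverse_pos z')
    have "- \<i> * z \<notin> \<real>\<^sub>\<le>\<^sub>0" using z' by (auto simp: complex_nonpos_Reals_iff)
    then have 2: "((\<lambda>z. Ln (- \<i> * z)) has_field_derivative 1 / z) (at z)"
      using z' by (auto intro!: derivative_eq_intros simp: divide_simps)
    have "(g has_field_derivative of_real pi * \<i> / 12 * eisenstein2 (- 1 / z) * (1 / z^2)
        - of_real pi * \<i> / 12 * eisenstein2 z - (1 / z) / 2) (at z)"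
      unfolding g_def[abs_def]
      by (intro DERIV_diff 1 DERIV_cdivide 2 has_field_derivative_eta_log z')
    moreover have "of_real pi * \<i> / 12 * eisenstein2 (- 1 / z) * (1 / z^2)
        - of_real pi * \<i> / 12 * eisenstein2 z - (1 / z) / 2 = 0"
      unfolding eisenstein2_inversion[OF z'(1)] using z'(2)
      by (simp add: field_simps power2_eq_square)
    ultimately show ?thesis by simp
  qed
  have "\<exists>c. \<forall>x\<in>?H. g x = c"
    by (rule has_field_derivative_zero_constant)
      (auto intro: has_field_derivative_at_within g' convex_halfspace_Im_gt)
  moreover have "g \<i> = 0" by (simp add: g_def)
  ultimately have "g \<tau> = 0" using \<tau> by force
  then show ?thesis by (simp add: g_def algebra_simps)
qed

section \<open>Invariants of the Fricke group\<close>

abbreviation UH :: "complex set" where "UH \<equiv> {\<tau>. Im \<tau> > 0}"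

text \<open>The involution that normalises Gamma_0(2) and exchanges its two cusps.\<close>

definition fricke :: "complex \<Rightarrow> complex" where "fricke \<tau> = - 1 / (2 * \<tau>)"

lemma fricke_UH [simp]: "Im \<tau> > 0 \<Longrightarrow> Im (fricke \<tau>) > 0"
  using Im_minus_inverse_pos[of "2 * \<tau>"] by (simp add: fricke_def)

lemma fricke_fricke: "Im \<tau> > 0 \<Longrightarrow> fricke (fricke \<tau>) = \<tau>"
  by (auto simp: fricke_def field_simps)

text \<open>As a transformation U is W T^-1 W, with W the Fricke involution. All statements about U
  are reduced to translation in this way.\<close>

lemma U_eq_fricke:
  assumes "Im \<tau> > 0"
  shows "\<tau> / (2 * \<tau> + 1) = fricke (fricke \<tau> - 1)" "2 * \<tau> + 1 \<noteq> 0"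
proof -
  have t: "\<tau> \<noteq> 0" using assms by auto
  show t1: "2 * \<tau> + 1 \<noteq> 0"
  proof
    assume "2 * \<tau> + 1 = 0"
    then have "Im (2 * \<tau> + 1) = 0" by simp
    then show False using assms by simp
  qed
  have "fricke \<tau> - 1 = - (2 * \<tau> + 1) / (2 * \<tau>)" using t by (simp add: fricke_def field_simps)
  then show "\<tau> / (2 * \<tau> + 1) = fricke (fricke \<tau> - 1)"
  proof -
    have "- 1 / (2 * (- a / (2 * \<tau>))) = \<tau> / a" if "a \<noteq> 0" for a using t that by (simp add: field_simps)
    from this[OF t1] show ?thesis
      unfolding \<open>fricke \<tau> - 1 = - (2 * \<tau> + 1) / (2 * \<tau>)\<close>
      by (simp only: fricke_def[of "- (2 * \<tau> + 1) / (2 * \<tau>)"])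
  qed
qed

lemma fricke_holomorphic: "fricke holomorphic_on UH"
  unfolding fricke_def[abs_def] by (intro holomorphic_intros) auto

text \<open>If \<open>\<bar>Re \<tau>\<bar> \<le> 1/2\<close> and \<open>Im \<tau> < 1/4\<close> then the Fricke involution multiplies
  the imaginary part by \<open>1 / (2 \<bar>\<tau>\<bar>\<^sup>2) \<ge> 8/5\<close>.\<close>

lemma fricke_reduction:
  assumes base: "\<And>\<tau>. Im \<tau> \<ge> 1/4 \<Longrightarrow> P \<tau>"
    and shift: "\<And>\<tau>. Im \<tau> > 0 \<Longrightarrow> P (\<tau> + 1) \<longleftrightarrow> P \<tau>"
    and fr: "\<And>\<tau>. Im \<tau> > 0 \<Longrightarrow> P (fricke \<tau>) \<Longrightarrow> P \<tau>"
    and \<tau>: "Im \<tau> > 0"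
  shows "P \<tau>"
proof -
  have shift_int: "P (\<tau> + of_int m) \<longleftrightarrow> P \<tau>" if "Im \<tau> > 0" for \<tau> m
  proof (induction m rule: int_induct[of _ 0])
    case (step1 i)
    then show ?case using shift[of "\<tau> + of_int i"] that by (simp add: add_ac)
  next
    case (step2 i)
    then show ?case using shift[of "\<tau> + of_int (i - 1)"] that by (simp add: add_ac)
  qed simp
  \<comment> \<open>Every use of the involution raises the point by a factor of at least 8/5, so
    \<open>n\<close> rounds suffice from height (1/4) (5/8)^n.\<close>
  have main: "P \<tau>" if "Im \<tau> > 0" "Im \<tau> \<ge> (1/4) * (5/8) ^ n" for \<tau> n
    using that
  proof (induction n arbitrary: \<tau>)
    case 0
    then show ?case using base by simp
  next
    case (Suc n)
    define \<sigma> where "\<sigma> = \<tau> + of_int (- round (Re \<tau>))"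
    have Im: "Im \<sigma> = Im \<tau>" by (simp add: \<sigma>_def)
    have "P \<sigma>"
    proof (cases "Im \<sigma> \<ge> 1/4")
      case True
      then show ?thesis by (rule base)
    next
      case False
      have s0: "Im \<sigma> > 0" using Suc.prems Im by simp
      then have "\<sigma> \<noteq> 0" by auto
      have "\<bar>Re \<sigma>\<bar> \<le> 1/2"
        using of_int_round_abs_le[of "Re \<tau>"] by (simp add: \<sigma>_def abs_minus_commute)
      then have "\<bar>Re \<sigma>\<bar>^2 \<le> (1/2)^2" by (intro power_mono) auto
      moreover have "Im \<sigma> ^ 2 \<le> (1/4)^2" using False s0 by (intro power_mono) auto
      ultimately have "norm \<sigma> ^ 2 \<le> 5/16" unfolding cmod_power2 by (simp add: power2_eq_square)
      moreover have "norm \<sigma> ^ 2 > 0" using \<open>\<sigma> \<noteq> 0\<close> by simp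
      ultimately have "8/5 \<le> 1 / (2 * norm \<sigma> ^ 2)" by (simp add: pos_le_divide_eq)
      then have "Im \<sigma> * (8/5) \<le> Im \<sigma> * (1 / (2 * norm \<sigma> ^ 2))"
        using s0 by (intro mult_left_mono) auto
      then have "Im \<sigma> * (8/5) \<le> Im \<sigma> / (2 * norm \<sigma> ^ 2)" by simp
      also have "Im \<sigma> / (2 * norm \<sigma> ^ 2) = Im (fricke \<sigma>)"
      proof -
        have "norm (2 * \<sigma>) ^ 2 = 2 * (2 * norm \<sigma> ^ 2)" by (simp add: norm_mult power_mult_distrib)
        moreover have "Im (- 1 / z) = Im z / norm z ^ 2" for z by (simp add: Im_divide cmod_power2)
        ultimately show ?thesis by (simp only: fricke_def) simp
      qed
      finally have "Im (fricke \<sigma>) \<ge> (1/4) * (5/8) ^ n" using Suc.prems(2) Im by simp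
      then have "P (fricke \<sigma>)" using s0 by (intro Suc.IH) auto
      then show ?thesis by (rule fr[OF s0])
    qed
    then show ?case using shift_int Suc.prems(1) unfolding \<sigma>_def by blast
  qed
  have "(\<lambda>n. (1/4) * (5/8 :: real) ^ n) \<longlonglongrightarrow> (1/4) * 0"
    by (intro tendsto_intros LIMSEQ_power_zero) simp
  then have "\<forall>\<^sub>F n in sequentially. (1/4) * (5/8 :: real) ^ n < Im \<tau>"
    using \<tau> by (intro order_tendstoD(2)) auto
  then obtain n where "(1/4) * (5/8 :: real) ^ n < Im \<tau>" by (auto simp: eventually_sequentially)
  then show ?thesis using main[of \<tau> n] \<tau> by simp
qed

section \<open>Periodic functions on the disc of q, and the maximum principle\<close>

lemma nome_eq_imp:
  assumes "nome \<tau> = nome \<sigma>"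
  obtains m :: int where "\<tau> = \<sigma> + of_int m"
proof -
  obtain m :: int where "2 * of_real pi * \<i> * \<tau> = 2 * of_real pi * \<i> * \<sigma> + of_int (2 * m) * (of_real pi * \<i>)"
    using assms unfolding nome_def by (auto simp: exp_eq)
  then have "2 * of_real pi * \<i> * \<tau> = 2 * of_real pi * \<i> * (\<sigma> + of_int m)" by (simp add: algebra_simps)
  then show ?thesis using that by simp
qed

lemma nome_surj:
  assumes "norm q < 1" "q \<noteq> 0"
  shows "nome (Ln q / (2 * of_real pi * \<i>)) = q" "Im (Ln q / (2 * of_real pi * \<i>)) > 0"
proof -
  show "nome (Ln q / (2 * of_real pi * \<i>)) = q" using assms by (simp add: nome_def)
  then show "Im (Ln q / (2 * of_real pi * \<i>)) > 0"
    using norm_nome_less_1 assms by metis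
qed

lemma periodic_int:
  assumes "\<And>\<tau>. Im \<tau> > 0 \<Longrightarrow> F (\<tau> + 1) = (F \<tau> :: complex)" and "Im \<tau> > 0"
  shows "F (\<tau> + of_int m) = F \<tau>"
proof (induction m rule: int_induct[of _ 0])
  case (step1 i)
  then show ?case using assms(1)[of "\<tau> + of_int i"] assms(2) by (simp add: add_ac)
next
  case (step2 i)
  then show ?case using assms(1)[of "\<tau> + of_int (i - 1)"] assms(2) by (simp add: add_ac)
qed simp

text \<open>Away from 0 local logarithms make F a holomorphic function of q. The bound for Im tau >=
  1/4 makes 0 a removable singularity.\<close>

lemma periodic_descent:
  assumes F: "F holomorphic_on UH" and per: "\<And>\<tau>. Im \<tau> > 0 \<Longrightarrow> F (\<tau> + 1) = F \<tau>"
    and bd: "\<And>\<tau>. Im \<tau> \<ge> 1/4 \<Longrightarrow> norm (F \<tau>) \<le> C"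
  obtains \<phi> where "\<phi> holomorphic_on ball 0 1" "\<And>\<tau>. Im \<tau> > 0 \<Longrightarrow> F \<tau> = \<phi> (nome \<tau>)"
proof -
  define \<psi> where "\<psi> q = F (Ln q / (2 * of_real pi * \<i>))" for q
  have well: "F \<tau> = \<psi> (nome \<tau>)" if \<tau>: "Im \<tau> > 0" for \<tau>
  proof -
    define \<sigma> where "\<sigma> = Ln (nome \<tau>) / (2 * of_real pi * \<i>)"
    have "nome \<sigma> = nome \<tau>" "Im \<sigma> > 0"
      unfolding \<sigma>_def using \<tau> by (auto intro!: nome_surj simp: norm_nome_less_1)
    then obtain m :: int where "\<tau> = \<sigma> + of_int m" using nome_eq_imp by metis
    then show ?thesis using periodic_int[of F \<sigma> m] per \<open>Im \<sigma> > 0\<close> by (simp add: \<psi>_def \<sigma>_def)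
  qed
  have hol: "\<psi> holomorphic_on (ball 0 1 - {0})"
  proof (rule analytic_imp_holomorphic, subst analytic_on_analytic_at, intro ballI)
    fix q0 :: complex assume q0: "q0 \<in> ball 0 1 - {0}"
    define N where "N = {q. Re (q / q0) > 0} \<inter> (ball 0 1 - {0})"
    \<comment> \<open>A branch of the logarithm near \<open>q0\<close> that avoids the cut of
      \<open>Ln\<close>; by periodicity of F the choice of branch does not matter.\<close>
    define L where "L q = (Ln (q / q0) + Ln q0) / (2 * of_real pi * \<i>)" for q
    have "open {q. Re (q / q0) > 0}" using q0 by (intro open_Collect_less continuous_intros) auto
    then have N: "open N" "q0 \<in> N" "N \<subseteq> ball 0 1 - {0}" using q0 by (auto simp: N_def)
    have nomeL: "nome (L q) = q" if "q \<in> N" for q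
      using that q0 by (simp add: nome_def L_def exp_add N_def)
    have ImL: "Im (L q) > 0" if "q \<in> N" for q
    proof -
      have "norm (nome (L q)) < 1" using nomeL[OF that] that by (auto simp: N_def)
      then show ?thesis by (simp add: norm_nome_less_1)
    qed
    have "L holomorphic_on N"
      unfolding L_def using q0
      by (intro holomorphic_intros) (auto simp: N_def complex_nonpos_Reals_iff)
    then have "(F \<circ> L) holomorphic_on N"
      by (rule holomorphic_on_compose_gen[OF _ F]) (use ImL in auto)
    moreover have "(F \<circ> L) q = \<psi> q" if "q \<in> N" for q
      using well[OF ImL[OF that]] nomeL[OF that] by simp
    ultimately have "\<psi> holomorphic_on N" by (metis holomorphic_cong)
    then show "\<psi> analytic_on {q0}" unfolding analytic_at using N by blast
  qed
  have "\<forall>\<^sub>F q in at 0. norm (\<psi> q) \<le> C"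
  proof -
    have "\<forall>\<^sub>F q in at (0::complex). q \<in> ball 0 (exp (- pi / 2)) - {0}"
      by (intro eventually_at_in_open) auto
    then show ?thesis
    proof eventually_elim
      case (elim q)
      have e1: "exp (- pi / 2) < 1" by simp
      moreover have qe: "norm q < exp (- pi / 2)" "q \<noteq> 0" using elim by auto
      ultimately have q: "norm q < 1" "q \<noteq> 0" by linarith+
      define \<sigma> where "\<sigma> = Ln q / (2 * of_real pi * \<i>)"
      have "nome \<sigma> = q" unfolding \<sigma>_def by (rule nome_surj[OF q])
      then have "exp (- 2 * pi * Im \<sigma>) < exp (- pi / 2)" using qe(1) norm_nome[of \<sigma>] by metis
      then have "pi * (1/4) < pi * Im \<sigma>" by simp
      then have "1/4 < Im \<sigma>" by (simp only: mult_less_cancel_left_pos[OF pi_gt_zero])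
      then show ?case using bd[of \<sigma>] by (simp add: \<psi>_def \<sigma>_def)
    qed
  qed
  then have "\<exists>\<phi>. \<phi> holomorphic_on ball 0 1 \<and> (\<forall>z\<in>ball 0 1 - {0}. \<phi> z = \<psi> z)"
    by (subst holomorphic_on_extend_bounded[OF hol]) auto
  then obtain \<phi> where \<phi>: "\<phi> holomorphic_on ball 0 1" "\<And>z. z \<in> ball 0 1 - {0} \<Longrightarrow> \<phi> z = \<psi> z"
    by blast
  show ?thesis
  proof (rule that[OF \<phi>(1)])
    show "F \<tau> = \<phi> (nome \<tau>)" if "Im \<tau> > 0" for \<tau>
      using \<phi>(2)[of "nome \<tau>"] well[OF that] that by (simp add: norm_nome_less_1)
  qed
qed

text \<open>The image of Im tau >= 1/4, the height reached by \<open>fricke_reduction\<close>,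
  together with q = 0.\<close>

definition half_disc :: "complex set" where "half_disc = cball 0 (exp (- pi / 2))"

lemma half_disc: "compact half_disc" "half_disc \<subseteq> ball 0 1" "0 \<in> half_disc"
proof -
  show "half_disc \<subseteq> ball 0 1"
  proof
    fix x assume "x \<in> half_disc"
    then have "norm x \<le> exp (- pi / 2)" by (simp add: half_disc_def)
    also have "\<dots> < 1" by simp
    finally show "x \<in> ball 0 1" by simp
  qed
qed (auto simp: half_disc_def)

lemma nome_half_disc: "Im \<tau> \<ge> 1/4 \<Longrightarrow> nome \<tau> \<in> half_disc"
  by (simp add: half_disc_def norm_nome)

lemma disc_bounded:
  assumes "\<phi> holomorphic_on ball 0 1"
  obtains x where "x \<in> half_disc" "\<And>y. y \<in> half_disc \<Longrightarrow> norm (\<phi> y) \<le> norm (\<phi> x :: complex)"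
proof -
  have "continuous_on half_disc (\<lambda>x. norm (\<phi> x))"
    using assms half_disc(2) by (intro continuous_on_norm) (meson continuous_on_subset holomorphic_on_imp_continuous_on)
  then show ?thesis
    using continuous_attains_sup[OF half_disc(1)] half_disc(3) that by (metis empty_iff)
qed

lemma max_in_half_disc_const:
  assumes \<phi>: "\<phi> holomorphic_on ball 0 1" and x: "x \<in> half_disc"
    and max: "\<And>y. y \<in> ball 0 1 \<Longrightarrow> norm (\<phi> y) \<le> norm (\<phi> x)"
  shows "\<exists>c. \<forall>y\<in>ball 0 1. \<phi> y = c"
proof -
  have "\<phi> constant_on ball 0 1"
    by (rule maximum_modulus_principle[OF \<phi>, of "ball 0 1" x]) (use x half_disc max in auto)
  then show ?thesis by (auto simp: constant_on_def)
qed

lemma U_invariant_fricke_periodic: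
  assumes U: "\<And>\<tau>. Im \<tau> > 0 \<Longrightarrow> F (\<tau> / (2 * \<tau> + 1)) = F \<tau>" and \<tau>: "Im \<tau> > 0"
  shows "F (fricke (\<tau> + 1)) = F (fricke \<tau>)"
proof -
  have \<tau>1: "Im (\<tau> + 1) > 0" using \<tau> by simp
  have "F (fricke (\<tau> + 1)) = F (fricke (fricke (fricke (\<tau> + 1)) - 1))"
    using U[OF fricke_UH[OF \<tau>1]] U_eq_fricke(1)[OF fricke_UH[OF \<tau>1]] by simp
  then show ?thesis using fricke_fricke[OF \<tau>1] by simp
qed

text \<open>By \<open>fricke_reduction\<close> the values of |F| are bounded by those at height at
  least 1/4 near one of the two cusps. So the maximum is attained on the compact
  \<open>half_disc\<close> in one of the two q-coordinates, possibly at q = 0, and the maximum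
  principle applies there.\<close>

lemma bounded_invariant_const:
  assumes F: "F holomorphic_on UH"
    and T: "\<And>\<tau>. Im \<tau> > 0 \<Longrightarrow> F (\<tau> + 1) = F \<tau>"
    and U: "\<And>\<tau>. Im \<tau> > 0 \<Longrightarrow> F (\<tau> / (2 * \<tau> + 1)) = F \<tau>"
    and bd: "\<And>\<tau>. Im \<tau> \<ge> 1/4 \<Longrightarrow> norm (F \<tau>) \<le> C" "\<And>\<tau>. Im \<tau> \<ge> 1/4 \<Longrightarrow> norm (F (fricke \<tau>)) \<le> C"
  shows "\<exists>c. \<forall>\<tau>. Im \<tau> > 0 \<longrightarrow> F \<tau> = c"
proof -
  obtain \<phi>1 where \<phi>1: "\<phi>1 holomorphic_on ball 0 1" "\<And>\<tau>. Im \<tau> > 0 \<Longrightarrow> F \<tau> = \<phi>1 (nome \<tau>)"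
    using periodic_descent[OF F T bd(1)] by metis
  have F2: "(\<lambda>\<tau>. F (fricke \<tau>)) holomorphic_on UH"
  proof -
    have "fricke ` UH \<subseteq> UH" by auto
    from holomorphic_on_compose_gen[OF fricke_holomorphic F this] show ?thesis by (simp add: o_def)
  qed
  have T2: "F (fricke (\<tau> + 1)) = F (fricke \<tau>)" if "Im \<tau> > 0" for \<tau>
    using U_invariant_fricke_periodic[of F] U that by blast
  obtain \<phi>2 where \<phi>2: "\<phi>2 holomorphic_on ball 0 1" "\<And>\<tau>. Im \<tau> > 0 \<Longrightarrow> F (fricke \<tau>) = \<phi>2 (nome \<tau>)"
    using periodic_descent[OF F2 T2 bd(2)] by metis
  obtain x1 where x1: "x1 \<in> half_disc" "\<And>y. y \<in> half_disc \<Longrightarrow> norm (\<phi>1 y) \<le> norm (\<phi>1 x1)"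
    using disc_bounded[OF \<phi>1(1)] by metis
  obtain x2 where x2: "x2 \<in> half_disc" "\<And>y. y \<in> half_disc \<Longrightarrow> norm (\<phi>2 y) \<le> norm (\<phi>2 x2)"
    using disc_bounded[OF \<phi>2(1)] by metis
  define m where "m = max (norm (\<phi>1 x1)) (norm (\<phi>2 x2))"
  have all: "norm (F \<tau>) \<le> m \<and> norm (F (fricke \<tau>)) \<le> m" if "Im \<tau> > 0" for \<tau>
  proof (rule fricke_reduction[where P = "\<lambda>\<tau>. norm (F \<tau>) \<le> m \<and> norm (F (fricke \<tau>)) \<le> m", OF _ _ _ that])
    fix \<tau> :: complex assume \<tau>: "Im \<tau> \<ge> 1/4"
    then show "norm (F \<tau>) \<le> m \<and> norm (F (fricke \<tau>)) \<le> m"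
      using x1(2)[OF nome_half_disc[OF \<tau>]] x2(2)[OF nome_half_disc[OF \<tau>]] \<phi>1(2)[of \<tau>] \<phi>2(2)[of \<tau>]
      by (simp add: m_def le_max_iff_disj)
  next
    fix \<tau> :: complex assume \<tau>: "Im \<tau> > 0"
    then show "(norm (F (\<tau> + 1)) \<le> m \<and> norm (F (fricke (\<tau> + 1))) \<le> m) \<longleftrightarrow> (norm (F \<tau>) \<le> m \<and> norm (F (fricke \<tau>)) \<le> m)"
      by (simp add: T T2)
    show "norm (F (fricke \<tau>)) \<le> m \<and> norm (F (fricke (fricke \<tau>))) \<le> m \<Longrightarrow> norm (F \<tau>) \<le> m \<and> norm (F (fricke \<tau>)) \<le> m"
      using fricke_fricke[OF \<tau>] by simp
  qed
  show ?thesis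
  proof (cases "norm (\<phi>2 x2) \<le> norm (\<phi>1 x1)")
    case True
    have "norm (\<phi>1 y) \<le> norm (\<phi>1 x1)" if y: "y \<in> ball 0 1" for y
    proof (cases "y = 0")
      case False
      then show ?thesis
        using all[OF nome_surj(2)[of y]] \<phi>1(2)[OF nome_surj(2)[of y]] nome_surj(1)[of y] y True
        by (simp add: m_def)
    qed (use x1(2) half_disc(3) in auto)
    then obtain c where "\<And>y. y \<in> ball 0 1 \<Longrightarrow> \<phi>1 y = c"
      using max_in_half_disc_const[OF \<phi>1(1) x1(1)] by metis
    then show ?thesis using \<phi>1(2) norm_nome_less_1 by (intro exI[of _ c]) auto
  next
    case False
    have "norm (\<phi>2 y) \<le> norm (\<phi>2 x2)" if y: "y \<in> ball 0 1" for y
    proof (cases "y = 0")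
      case False
      then show ?thesis
        using all[OF nome_surj(2)[of y]] \<phi>2(2)[OF nome_surj(2)[of y]] nome_surj(1)[of y] y \<open>\<not> norm (\<phi>2 x2) \<le> norm (\<phi>1 x1)\<close>
        by (simp add: m_def)
    qed (use x2(2) half_disc(3) in auto)
    then obtain c where c: "\<And>y. y \<in> ball 0 1 \<Longrightarrow> \<phi>2 y = c"
      using max_in_half_disc_const[OF \<phi>2(1) x2(1)] by metis
    have "F \<tau> = c" if "Im \<tau> > 0" for \<tau>
      using \<phi>2(2)[OF fricke_UH[OF that]] fricke_fricke[OF that] c[of "nome (fricke \<tau>)"] that
      by (simp add: norm_nome_less_1)
    then show ?thesis by blast
  qed
qed

section \<open>A Hauptmodul for \<open>\<Gamma>\<^sub>0(2)\<close>\<close>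

lemma Ln_double:
  assumes "Im \<tau> > 0"
  shows "Ln (- \<i> * (2 * \<tau>)) = Ln (- \<i> * \<tau>) + of_real (ln 2)"
proof -
  have "- \<i> * \<tau> \<noteq> 0" using assms by auto
  then have "Ln (of_real 2 * (- \<i> * \<tau>)) = Ln (of_real 2) + Ln (- \<i> * \<tau>)"
    using Ln_times_of_real[of 2 "- \<i> * \<tau>"] by simp
  moreover have "Ln (of_real 2) = of_real (ln 2)" by (rule Ln_of_real) simp
  moreover have "of_real 2 * (- \<i> * \<tau>) = - \<i> * (2 * \<tau>)" by simp
  ultimately show ?thesis by (simp only: add.commute)
qed

lemma eta_log_fricke:
  assumes \<tau>: "Im \<tau> > 0"
  shows "eta_log (fricke \<tau>) = eta_log (2 * \<tau>) + (Ln (- \<i> * \<tau>) + of_real (ln 2)) / 2"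
    and "eta_log (2 * fricke \<tau>) = eta_log \<tau> + Ln (- \<i> * \<tau>) / 2"
proof -
  have "Im (2 * \<tau>) > 0" using \<tau> by simp
  from eta_log_inversion[OF this] show "eta_log (fricke \<tau>) = eta_log (2 * \<tau>) + (Ln (- \<i> * \<tau>) + of_real (ln 2)) / 2"
    unfolding fricke_def Ln_double[OF \<tau>] .
  have "2 * fricke \<tau> = - 1 / \<tau>" by (simp add: fricke_def)
  then show "eta_log (2 * fricke \<tau>) = eta_log \<tau> + Ln (- \<i> * \<tau>) / 2"
    using eta_log_inversion[OF \<tau>] by simp
qed

text \<open>Working with logarithms of the eta quotients \<open>(\<eta>(\<tau>) / \<eta>(2\<tau>))\<^sup>2\<^sup>4\<close> and
  \<open>\<eta>(2\<tau>)\<^sup>8 / \<eta>(\<tau>)\<^sup>4\<close> makes their fractional powers single-valued.\<close>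

definition hmod_log :: "complex \<Rightarrow> complex" where
  "hmod_log \<tau> = 24 * (eta_log \<tau> - eta_log (2 * \<tau>))"

definition hmod :: "complex \<Rightarrow> complex" where "hmod \<tau> = exp (hmod_log \<tau>)"

definition theta_log :: "complex \<Rightarrow> complex" where
  "theta_log \<tau> = 8 * eta_log (2 * \<tau>) - 4 * eta_log \<tau>"

text \<open>Logarithm of eta(tau)^8 / eta(2 tau)^4, to which the Fricke involution sends the theta
  quotient up to the weight factor.\<close>

definition theta_dual_log :: "complex \<Rightarrow> complex" where
  "theta_dual_log \<tau> = 8 * eta_log \<tau> - 4 * eta_log (2 * \<tau>)"

text \<open>The weight two combination in which the inhomogeneous terms of E_2 cancel.\<close>

definition eis :: "complex \<Rightarrow> complex" where
  "eis \<tau> = 2 * eisenstein2 (2 * \<tau>) - eisenstein2 \<tau>"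

lemma eta_log_double_add_1: "eta_log (2 * (\<tau> + 1)) = eta_log (2 * \<tau>) + of_real pi * \<i> / 6"
proof -
  have "2 * (\<tau> + 1) = 2 * \<tau> + 1 + 1" by simp
  then show ?thesis by (simp only: eta_log_add_1) simp
qed

lemma hmod_log_add_1: "hmod_log (\<tau> + 1) = hmod_log \<tau> - 2 * of_real pi * \<i>"
  unfolding hmod_log_def eta_log_add_1 eta_log_double_add_1 by (simp add: algebra_simps)

text \<open>The theta quotient changes sign under T, whereas \<open>eis\<close> is invariant under
  it. Under U both have the same factor, so their quotient realises the sign character of T.\<close>

lemma theta_log_add_1: "theta_log (\<tau> + 1) = theta_log \<tau> + of_real pi * \<i>"
  unfolding theta_log_def eta_log_add_1 eta_log_double_add_1 by (simp add: algebra_simps)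

lemma theta_dual_log_add_1: "theta_dual_log (\<tau> + 1) = theta_dual_log \<tau>"
  unfolding theta_dual_log_def eta_log_add_1 eta_log_double_add_1 by (simp add: algebra_simps)

lemma eisenstein2_add_1: "eisenstein2 (\<tau> + 1) = eisenstein2 \<tau>"
  by (simp only: eisenstein2_def nome_add_1)

lemma eis_add_1: "eis (\<tau> + 1) = eis \<tau>"
proof -
  have "2 * (\<tau> + 1) = 2 * \<tau> + 1 + 1" by simp
  then show ?thesis unfolding eis_def by (simp only: eisenstein2_add_1)
qed

lemma hmod_log_fricke:
  assumes "Im \<tau> > 0"
  shows "hmod_log (fricke \<tau>) = of_real (12 * ln 2) - hmod_log \<tau>"
  unfolding hmod_log_def eta_log_fricke[OF assms] by (simp add: algebra_simps)

lemma theta_log_fricke: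
  assumes "Im \<tau> > 0"
  shows "theta_log (fricke \<tau>) = theta_dual_log \<tau> + 2 * Ln (- \<i> * \<tau>) - of_real (2 * ln 2)"
  unfolding theta_log_def theta_dual_log_def eta_log_fricke[OF assms] by (simp add: algebra_simps)

lemma exp_theta_log_fricke:
  assumes \<tau>: "Im \<tau> > 0"
  shows "exp (theta_log (fricke \<tau>)) = - 1 / 4 * \<tau>^2 * exp (theta_dual_log \<tau>)"
proof -
  have "\<tau> \<noteq> 0" using \<tau> by auto
  then have 1: "exp (2 * Ln (- \<i> * \<tau>)) = - (\<tau>^2)"
    by (simp add: exp_double power_mult_distrib)
  have 2: "exp (complex_of_real (2 * ln 2)) = 4"
    unfolding exp_of_real by (simp add: exp_double)
  show ?thesis unfolding theta_log_fricke[OF \<tau>] exp_diff exp_add 1 2 by simp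
qed

lemma eis_fricke:
  assumes \<tau>: "Im \<tau> > 0"
  shows "eis (fricke \<tau>) = - 2 * \<tau>^2 * eis \<tau>"
proof -
  have "Im (2 * \<tau>) > 0" using \<tau> by simp
  from eisenstein2_inversion[OF this]
  have "eisenstein2 (fricke \<tau>) = 4 * \<tau>^2 * eisenstein2 (2 * \<tau>) - 12 * \<i> * \<tau> / of_real pi"
    by (simp add: fricke_def power_mult_distrib)
  moreover have "2 * fricke \<tau> = - 1 / \<tau>" by (simp add: fricke_def)
  then have "eisenstein2 (2 * fricke \<tau>) = \<tau>^2 * eisenstein2 \<tau> - 6 * \<i> * \<tau> / of_real pi"
    by (simp only: eisenstein2_inversion[OF \<tau>])
  ultimately show ?thesis unfolding eis_def by (simp only:) (simp add: algebra_simps)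
qed

text \<open>Apply U = W T^-1 W: with sigma = W tau the weight factors are c (sigma - 1)^2 and c
  sigma^2, and sigma - 1 = (2 tau + 1) sigma.\<close>

lemma weight_two_U:
  assumes fr: "\<And>\<tau>. Im \<tau> > 0 \<Longrightarrow> G (fricke \<tau>) = c * \<tau>^2 * G' \<tau>"
    and per: "\<And>\<tau>. G' (\<tau> + 1) = (G' \<tau> :: complex)" and \<tau>: "Im \<tau> > 0"
  shows "G (\<tau> / (2 * \<tau> + 1)) = (2 * \<tau> + 1)^2 * G \<tau>"
proof -
  define \<sigma> where "\<sigma> = fricke \<tau>"
  have \<sigma>: "Im \<sigma> > 0" "\<sigma> \<noteq> 0" using fricke_UH[OF \<tau>] by (auto simp: \<sigma>_def)
  have s1: "Im (\<sigma> - 1) > 0" using \<sigma> by simp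
  have \<tau>0: "\<tau> \<noteq> 0" using \<tau> by auto
  have "G \<tau> = c * \<sigma>^2 * G' \<sigma>" using fr[OF \<sigma>(1)] fricke_fricke[OF \<tau>] by (simp add: \<sigma>_def)
  moreover have "G (\<tau> / (2 * \<tau> + 1)) = c * (\<sigma> - 1)^2 * G' (\<sigma> - 1)"
    unfolding U_eq_fricke(1)[OF \<tau>] using fr[OF s1] by (simp add: \<sigma>_def)
  moreover have "G' (\<sigma> - 1) = G' \<sigma>" using per[of "\<sigma> - 1"] by simp
  moreover have "\<sigma> - 1 = (2 * \<tau> + 1) * \<sigma>" using \<tau>0 by (simp add: \<sigma>_def fricke_def field_simps)
  ultimately show ?thesis by (simp add: power_mult_distrib)
qed

lemma exp_theta_log_U:
  assumes "Im \<tau> > 0"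
  shows "exp (theta_log (\<tau> / (2 * \<tau> + 1))) = (2 * \<tau> + 1)^2 * exp (theta_log \<tau>)"
  by (rule weight_two_U[of "\<lambda>\<tau>. exp (theta_log \<tau>)" "- 1 / 4" "\<lambda>\<tau>. exp (theta_dual_log \<tau>)"])
    (auto simp: exp_theta_log_fricke theta_dual_log_add_1 assms)

lemma eis_U:
  assumes "Im \<tau> > 0"
  shows "eis (\<tau> / (2 * \<tau> + 1)) = (2 * \<tau> + 1)^2 * eis \<tau>"
  by (rule weight_two_U[of eis "- 2" eis]) (auto simp: eis_fricke eis_add_1 assms)

text \<open>W negates \<open>hmod_log\<close> up to a constant, so T^-1 between two copies of W acts
  on it like T. Consequently h^(a/n) has the multiplier exp(-2 pi i a / n) under both T and U and
  cancels lambda in each.\<close>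

lemma hmod_log_U:
  assumes \<tau>: "Im \<tau> > 0"
  shows "hmod_log (\<tau> / (2 * \<tau> + 1)) = hmod_log \<tau> - 2 * of_real pi * \<i>"
proof -
  have f: "Im (fricke \<tau>) > 0" using \<tau> by simp
  then have f1: "Im (fricke \<tau> - 1) > 0" by simp
  have "hmod_log (fricke \<tau> - 1) = hmod_log (fricke \<tau>) + 2 * of_real pi * \<i>"
    using hmod_log_add_1[of "fricke \<tau> - 1"] by simp
  then show ?thesis
    unfolding U_eq_fricke(1)[OF \<tau>] hmod_log_fricke[OF f1] by (simp add: hmod_log_fricke[OF \<tau>])
qed

lemma hmod_nonzero [simp]: "hmod \<tau> \<noteq> 0" by (simp add: hmod_def)

lemma exp_minus_2_pi_i: "exp (x - 2 * of_real pi * \<i>) = exp x"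
  by (simp add: exp_diff exp_two_pi_i')

lemma hmod_add_1: "hmod (\<tau> + 1) = hmod \<tau>"
  unfolding hmod_def hmod_log_add_1 by (rule exp_minus_2_pi_i)

lemma hmod_U: "Im \<tau> > 0 \<Longrightarrow> hmod (\<tau> / (2 * \<tau> + 1)) = hmod \<tau>"
  unfolding hmod_def using hmod_log_U exp_minus_2_pi_i by metis

lemma hmod_fricke: "Im \<tau> > 0 \<Longrightarrow> hmod (fricke \<tau>) = of_real (exp (12 * ln 2)) / hmod \<tau>"
  unfolding hmod_def hmod_log_fricke exp_diff exp_of_real ..

lemma eta_log_holomorphic: "eta_log holomorphic_on UH"
  unfolding holomorphic_on_def field_differentiable_def
proof (intro ballI exI)
  fix \<tau> :: complex assume "\<tau> \<in> UH"
  then show "(eta_log has_field_derivative of_real pi * \<i> / 12 * eisenstein2 \<tau>) (at \<tau> within UH)"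
    by (intro has_field_derivative_at_within[OF has_field_derivative_eta_log]) simp
qed

lemma double_holomorphic: "F holomorphic_on UH \<Longrightarrow> (\<lambda>\<tau>. F (2 * \<tau>)) holomorphic_on UH"
proof -
  assume F: "F holomorphic_on UH"
  have "(\<lambda>\<tau>. 2 * \<tau>) holomorphic_on UH" by (intro holomorphic_intros)
  moreover have "(\<lambda>\<tau>. 2 * \<tau>) ` UH \<subseteq> UH" by auto
  ultimately show ?thesis using holomorphic_on_compose_gen[OF _ F] by (simp add: o_def)
qed

lemma hmod_log_holomorphic: "hmod_log holomorphic_on UH"
  and theta_log_holomorphic: "theta_log holomorphic_on UH"
  unfolding hmod_log_def[abs_def] theta_log_def[abs_def]
  by (intro holomorphic_intros eta_log_holomorphic double_holomorphic[OF eta_log_holomorphic])+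

lemma hmod_holomorphic: "hmod holomorphic_on UH"
  unfolding hmod_def[abs_def] using holomorphic_on_compose[OF hmod_log_holomorphic holomorphic_on_exp]
  by (simp add: o_def)

section \<open>Functions of q and growth at the cusps\<close>

definition eis_q :: "complex \<Rightarrow> complex" where
  "eis_q q = 1 - 24 * q * euler_dlog q + 48 * q^2 * euler_dlog (q^2)"

lemma euler_dlog_holomorphic: "euler_dlog holomorphic_on ball 0 1"
proof -
  have "deriv euler_log holomorphic_on ball 0 1"
    by (intro holomorphic_deriv holomorphic_euler_log) auto
  moreover have "deriv euler_log q = euler_dlog q" if "q \<in> ball 0 1" for q
    using has_field_derivative_euler_log[of q] that by (simp add: DERIV_imp_deriv)
  ultimately show ?thesis by (metis holomorphic_cong)
qed

lemma square_ball: "(\<lambda>q. q^2) ` ball 0 1 \<subseteq> (ball 0 1 :: complex set)"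
  by (auto simp: norm_power power_less_one_iff)

lemma square_holomorphic: "F holomorphic_on ball 0 1 \<Longrightarrow> (\<lambda>q. F (q^2)) holomorphic_on ball (0::complex) 1"
proof -
  assume F: "F holomorphic_on ball 0 1"
  have "(\<lambda>q :: complex. q^2) holomorphic_on ball 0 1" by (intro holomorphic_intros)
  from holomorphic_on_compose_gen[OF this F square_ball] show ?thesis by (simp add: o_def)
qed

lemma eis_q_holomorphic: "eis_q holomorphic_on ball 0 1"
  unfolding eis_q_def[abs_def]
  by (intro holomorphic_intros euler_dlog_holomorphic square_holomorphic)

lemma eis_eq: "eis \<tau> = eis_q (nome \<tau>)"
  by (simp add: eis_def eisenstein2_def eis_q_def nome_double)

lemma nome_holomorphic: "nome holomorphic_on A"
  unfolding nome_def[abs_def] by (intro holomorphic_intros)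

lemma nome_compose_holomorphic:
  assumes "\<phi> holomorphic_on ball 0 1"
  shows "(\<lambda>\<tau>. \<phi> (nome \<tau>)) holomorphic_on UH"
proof -
  have "nome ` UH \<subseteq> ball 0 1" by (auto simp: norm_nome_less_1)
  from holomorphic_on_compose_gen[OF nome_holomorphic assms this] show ?thesis by (simp add: o_def)
qed

lemma eis_holomorphic: "eis holomorphic_on UH"
  unfolding eis_eq[abs_def] by (rule nome_compose_holomorphic[OF eis_q_holomorphic])

definition hmod_q :: "complex \<Rightarrow> complex" where
  "hmod_q q = exp (24 * (euler_log q - euler_log (q^2)))"

lemma hmod_q_holomorphic: "hmod_q holomorphic_on ball 0 1"
proof -
  have "(\<lambda>q. 24 * (euler_log q - euler_log (q^2))) holomorphic_on ball 0 1"
    by (intro holomorphic_intros holomorphic_euler_log square_holomorphic)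
  from holomorphic_on_compose[OF this holomorphic_on_exp] show ?thesis
    by (simp add: hmod_q_def[abs_def] o_def)
qed

lemma hmod_q_nonzero [simp]: "hmod_q q \<noteq> 0" and hmod_q_0 [simp]: "hmod_q 0 = 1"
  by (simp_all add: hmod_q_def)

lemma hmod_log_eq: "hmod_log \<tau> = - (2 * of_real pi * \<i> * \<tau>) + 24 * (euler_log (nome \<tau>) - euler_log (nome \<tau> ^ 2))"
  unfolding hmod_log_def eta_log_def nome_double[symmetric] by (simp add: algebra_simps)

lemma hmod_nome: "hmod \<tau> * nome \<tau> = hmod_q (nome \<tau>)"
  unfolding hmod_def hmod_log_eq exp_add hmod_q_def
  by (simp add: nome_def exp_minus field_simps)

text \<open>Exponential growth in Im tau amounts to at most a pole in q at infinity. Unlike an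
  expansion in q, the notion also applies to fractional powers of h, and it is stable under
  products.\<close>

definition moderate :: "(complex \<Rightarrow> complex) \<Rightarrow> bool" where
  "moderate G \<longleftrightarrow> (\<exists>C M. \<forall>\<tau>. Im \<tau> \<ge> 1/4 \<longrightarrow> norm (G \<tau>) \<le> C * exp (M * Im \<tau>))"

lemma moderateI:
  "(\<And>\<tau>. Im \<tau> \<ge> 1/4 \<Longrightarrow> norm (G \<tau>) \<le> C * exp (M * Im \<tau>)) \<Longrightarrow> moderate G"
  unfolding moderate_def by blast

lemma moderateE:
  assumes "moderate G"
  obtains C M where "C \<ge> 0" "M \<ge> 0" "\<And>\<tau>. Im \<tau> \<ge> 1/4 \<Longrightarrow> norm (G \<tau>) \<le> C * exp (M * Im \<tau>)"
proof -
  obtain C M where CM: "\<And>\<tau>. Im \<tau> \<ge> 1/4 \<Longrightarrow> norm (G \<tau>) \<le> C * exp (M * Im \<tau>)"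
    using assms unfolding moderate_def by blast
  have "norm (G \<tau>) \<le> \<bar>C\<bar> * exp (\<bar>M\<bar> * Im \<tau>)" if "Im \<tau> \<ge> 1/4" for \<tau>
  proof -
    have "M * Im \<tau> \<le> \<bar>M\<bar> * Im \<tau>" using that by (intro mult_right_mono) auto
    then have "C * exp (M * Im \<tau>) \<le> \<bar>C\<bar> * exp (\<bar>M\<bar> * Im \<tau>)" by (intro mult_mono) auto
    then show ?thesis using CM[OF that] by linarith
  qed
  then show ?thesis using that[of "\<bar>C\<bar>" "\<bar>M\<bar>"] by auto
qed

lemma moderate_mult: "moderate F \<Longrightarrow> moderate G \<Longrightarrow> moderate (\<lambda>\<tau>. F \<tau> * G \<tau>)"
proof (elim moderateE)
  fix C M D N
  assume *: "C \<ge> 0" "\<And>\<tau>. Im \<tau> \<ge> 1/4 \<Longrightarrow> norm (F \<tau>) \<le> C * exp (M * Im \<tau>)"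
    "\<And>\<tau>. Im \<tau> \<ge> 1/4 \<Longrightarrow> norm (G \<tau>) \<le> D * exp (N * Im \<tau>)"
  show ?thesis
  proof (rule moderateI[of _ "C * D" "M + N"])
    fix \<tau> :: complex assume \<tau>: "Im \<tau> \<ge> 1/4"
    have "norm (F \<tau> * G \<tau>) \<le> (C * exp (M * Im \<tau>)) * (D * exp (N * Im \<tau>))"
      unfolding norm_mult using * \<tau> by (intro mult_mono) auto
    moreover have "exp ((M + N) * Im \<tau>) = exp (M * Im \<tau>) * exp (N * Im \<tau>)"
      by (simp add: distrib_right exp_add)
    ultimately show "norm (F \<tau> * G \<tau>) \<le> C * D * exp ((M + N) * Im \<tau>)" by (simp only: mult_ac)
  qed
qed

lemma moderate_const: "moderate (\<lambda>_. c)"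
  by (rule moderateI[of _ "norm c" 0]) simp

lemma moderate_power: "moderate F \<Longrightarrow> moderate (\<lambda>\<tau>. F \<tau> ^ k)"
  by (induction k) (auto intro: moderate_const moderate_mult)

lemma moderate_cong:
  "moderate F \<Longrightarrow> (\<And>\<tau>. Im \<tau> > 0 \<Longrightarrow> G \<tau> = F \<tau>) \<Longrightarrow> moderate G"
  unfolding moderate_def by (metis less_le_trans zero_less_divide_1_iff zero_less_numeral)

lemma moderate_double: "moderate F \<Longrightarrow> moderate (\<lambda>\<tau>. F (2 * \<tau>))"
proof (elim moderateE)
  fix C M assume *: "\<And>\<tau>. Im \<tau> \<ge> 1/4 \<Longrightarrow> norm (F \<tau>) \<le> C * exp (M * Im \<tau>)"
  show ?thesis
  proof (rule moderateI[of _ C "2 * M"])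
    fix \<tau> :: complex assume "Im \<tau> \<ge> 1/4"
    then show "norm (F (2 * \<tau>)) \<le> C * exp (2 * M * Im \<tau>)" using *[of "2 * \<tau>"] by (simp add: mult_ac)
  qed
qed

lemma moderate_nome:
  assumes "\<phi> holomorphic_on ball 0 1"
  shows "moderate (\<lambda>\<tau>. \<phi> (nome \<tau>))"
proof -
  obtain x where "\<And>y. y \<in> half_disc \<Longrightarrow> norm (\<phi> y) \<le> norm (\<phi> x)" using disc_bounded[OF assms] by metis
  then show ?thesis by (intro moderateI[of _ "norm (\<phi> x)" 0]) (simp add: nome_half_disc)
qed

text \<open>The growth comes from exp(a pi i tau / 12) alone; the remaining factor is a function of
  q holomorphic on the disc. Both signs of \<open>a\<close> are allowed since eta has no
  zeros.\<close>

lemma moderate_exp_eta_log: "moderate (\<lambda>\<tau>. exp (of_real a * eta_log \<tau>))"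
proof -
  have "(\<lambda>q. of_real a * euler_log q) holomorphic_on ball 0 1"
    by (intro holomorphic_intros holomorphic_euler_log)
  from holomorphic_on_compose[OF this holomorphic_on_exp]
  have "moderate (\<lambda>\<tau>. exp (of_real a * euler_log (nome \<tau>)))"
    using moderate_nome[of "\<lambda>q. exp (of_real a * euler_log q)"] by (simp add: o_def)
  moreover have "moderate (\<lambda>\<tau>. exp (of_real a * (of_real pi * \<i> * \<tau> / 12)))"
    by (rule moderateI[of _ 1 "- a * pi / 12"]) (simp add: norm_exp_eq_Re)
  ultimately show ?thesis
    unfolding eta_log_def distrib_left exp_add by (intro moderate_mult)
qed

lemma moderate_exp_eta_pair:
  "moderate (\<lambda>\<tau>. exp (of_real a * eta_log \<tau> + of_real b * eta_log (2 * \<tau>)))"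
  unfolding exp_add by (intro moderate_mult moderate_exp_eta_log moderate_double[OF moderate_exp_eta_log])

lemma moderate_exp_hmod_log: "moderate (\<lambda>\<tau>. exp (of_real a * hmod_log \<tau>))"
  using moderate_exp_eta_pair[of "24 * a" "- 24 * a"] by (simp add: hmod_log_def algebra_simps)

lemma moderate_exp_theta_log: "moderate (\<lambda>\<tau>. exp (of_real a * theta_log \<tau>))"
  using moderate_exp_eta_pair[of "- 4 * a" "8 * a"] by (simp add: theta_log_def algebra_simps)

lemma moderate_exp_theta_dual_log: "moderate (\<lambda>\<tau>. exp (of_real a * theta_dual_log \<tau>))"
  using moderate_exp_eta_pair[of "8 * a" "- 4 * a"] by (simp add: theta_dual_log_def algebra_simps)

lemma hmod_eq: "hmod \<tau> = hmod_q (nome \<tau>) / nome \<tau>"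
  using hmod_nome[of \<tau>] by (simp add: field_simps)

text \<open>h is \<open>hmod_q\<close> divided by q, and \<open>hmod_q\<close> is free of zeros, so
  1/h decays like q.\<close>

lemma inverse_hmod_bound:
  obtains C where "C \<ge> 0" "\<And>\<tau>. Im \<tau> \<ge> 1/4 \<Longrightarrow> norm (1 / hmod \<tau>) \<le> C * exp (- 2 * pi * Im \<tau>)"
proof -
  have "(\<lambda>q. inverse (hmod_q q)) holomorphic_on ball 0 1"
    by (intro holomorphic_intros hmod_q_holomorphic) simp
  then obtain x where x: "\<And>y. y \<in> half_disc \<Longrightarrow> norm (inverse (hmod_q y)) \<le> norm (inverse (hmod_q x))"
    using disc_bounded by metis
  show ?thesis
  proof (rule that[of "norm (inverse (hmod_q x))"])
    fix \<tau> :: complex assume "Im \<tau> \<ge> 1/4"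
    have "norm (1 / hmod \<tau>) = norm (inverse (hmod_q (nome \<tau>))) * norm (nome \<tau>)"
      by (simp add: hmod_eq norm_divide norm_inverse norm_mult divide_inverse)
    also have "\<dots> \<le> norm (inverse (hmod_q x)) * norm (nome \<tau>)"
      using x[OF nome_half_disc[OF \<open>Im \<tau> \<ge> 1/4\<close>]] by (intro mult_right_mono) auto
    finally show "norm (1 / hmod \<tau>) \<le> norm (inverse (hmod_q x)) * exp (- 2 * pi * Im \<tau>)"
      by (simp only: norm_nome)
  qed simp
qed

text \<open>Induction on the order of the pole at infinity: the leading term is removed by
  subtracting a multiple of a power of the Hauptmodul, which has a simple pole at infinity and
  a zero at the other cusp.\<close>

lemma poly_in_hmod:
  assumes F: "F holomorphic_on UH"
    and T: "\<And>\<tau>. Im \<tau> > 0 \<Longrightarrow> F (\<tau> + 1) = F \<tau>"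
    and U: "\<And>\<tau>. Im \<tau> > 0 \<Longrightarrow> F (\<tau> / (2 * \<tau> + 1)) = F \<tau>"
    and bd: "\<And>\<tau>. Im \<tau> \<ge> 1/4 \<Longrightarrow> norm (F (fricke \<tau>)) \<le> C"
      "\<And>\<tau>. Im \<tau> \<ge> 1/4 \<Longrightarrow> norm (F \<tau> * nome \<tau> ^ M) \<le> C"
  shows "\<exists>p :: complex poly. \<forall>\<tau>. Im \<tau> > 0 \<longrightarrow> F \<tau> = poly p (hmod \<tau>)"
  using assms
proof (induction M arbitrary: F C)
  case 0
  obtain c where c: "\<forall>\<tau>. Im \<tau> > 0 \<longrightarrow> F \<tau> = c"
    using bounded_invariant_const[OF 0(1) 0(2) 0(3) _ 0(4)] 0(5) by auto
  show ?case by (rule exI[of _ "[:c:]"]) (use c in simp)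
next
  case (Suc M)
  note F = Suc.prems(1) and T = Suc.prems(2) and U = Suc.prems(3) and bd = Suc.prems(4,5)
  have hol: "(\<lambda>\<tau>. F \<tau> * nome \<tau> ^ Suc M) holomorphic_on UH"
    by (intro holomorphic_intros F nome_holomorphic)
  have per: "F (\<tau> + 1) * nome (\<tau> + 1) ^ Suc M = F \<tau> * nome \<tau> ^ Suc M" if "Im \<tau> > 0" for \<tau>
    by (simp only: T[OF that] nome_add_1)
  obtain \<phi> where \<phi>: "\<phi> holomorphic_on ball 0 1"
      "\<And>\<tau>. Im \<tau> > 0 \<Longrightarrow> F \<tau> * nome \<tau> ^ Suc M = \<phi> (nome \<tau>)"
    by (rule periodic_descent[OF hol per bd(2)]) (assumption, assumption, rule that)
  \<comment> \<open>As \<open>hmod_q\<close> is 1 at 0, subtracting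
    \<open>c * hmod \<tau> ^ Suc M\<close> cancels the leading term; \<open>\<theta>1\<close> below
    is the remainder divided by q.\<close>
  define c where "c = \<phi> 0"
  define \<theta> where "\<theta> q = \<phi> q - c * hmod_q q ^ Suc M" for q
  have \<theta>: "\<theta> holomorphic_on ball 0 1"
    unfolding \<theta>_def[abs_def] by (intro holomorphic_intros \<phi>(1) hmod_q_holomorphic)
  have "\<theta> 0 = 0" by (simp add: \<theta>_def c_def)
  define \<theta>1 where "\<theta>1 z = (if z = 0 then deriv \<theta> 0 else (\<theta> z - \<theta> 0) / (z - 0))" for z
  have "\<theta>1 holomorphic_on ball 0 1"
    unfolding \<theta>1_def[abs_def] by (rule pole_lemma_open[OF \<theta> open_ball])
  then obtain x where x: "\<And>y. y \<in> half_disc \<Longrightarrow> norm (\<theta>1 y) \<le> norm (\<theta>1 x)"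
    using disc_bounded by metis
  have \<theta>1: "\<theta> q = q * \<theta>1 q" if "q \<noteq> 0" for q using that by (simp add: \<theta>1_def \<open>\<theta> 0 = 0\<close>)
  define F' where "F' \<tau> = F \<tau> - c * hmod \<tau> ^ Suc M" for \<tau>
  obtain B where B: "B \<ge> 0" "\<And>\<tau>. Im \<tau> \<ge> 1/4 \<Longrightarrow> norm (1 / hmod \<tau>) \<le> B * exp (- 2 * pi * Im \<tau>)"
    using inverse_hmod_bound by metis
  \<comment> \<open>At the other cusp h is 2^12 over h and hence bounded, so the subtraction does
    not spoil the bound there.\<close>
  define C' where "C' = max (C + norm c * (exp (12 * ln 2) * B) ^ Suc M) (norm (\<theta>1 x))"
  have "\<exists>p :: complex poly. \<forall>\<tau>. Im \<tau> > 0 \<longrightarrow> F' \<tau> = poly p (hmod \<tau>)"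
  proof (rule Suc.IH[of F' C'])
    show "F' holomorphic_on UH"
      unfolding F'_def[abs_def] by (intro holomorphic_intros F hmod_holomorphic)
    show "F' (\<tau> + 1) = F' \<tau>" if "Im \<tau> > 0" for \<tau>
      by (simp only: F'_def T[OF that] hmod_add_1)
    show "F' (\<tau> / (2 * \<tau> + 1)) = F' \<tau>" if "Im \<tau> > 0" for \<tau>
      by (simp only: F'_def U[OF that] hmod_U[OF that])
    show "norm (F' (fricke \<tau>)) \<le> C'" if \<tau>: "Im \<tau> \<ge> 1/4" for \<tau>
    proof -
      have \<tau>': "Im \<tau> > 0" using \<tau> by linarith
      have "exp (- 2 * pi * Im \<tau>) \<le> 1" using \<tau>' by simp
      then have "B * exp (- 2 * pi * Im \<tau>) \<le> B * 1" using B(1) by (intro mult_left_mono)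
      then have "norm (1 / hmod \<tau>) \<le> B" using B(2)[OF \<tau>] by linarith
      moreover have "norm (hmod (fricke \<tau>)) = exp (12 * ln 2) * norm (1 / hmod \<tau>)"
        unfolding hmod_fricke[OF \<tau>'] norm_divide norm_of_real by simp
      ultimately have "norm (hmod (fricke \<tau>)) \<le> exp (12 * ln 2) * B"
        by (simp only:) (intro mult_left_mono, auto)
      then have "norm (hmod (fricke \<tau>)) ^ Suc M \<le> (exp (12 * ln 2) * B) ^ Suc M"
        by (intro power_mono) auto
      then have "norm c * norm (hmod (fricke \<tau>)) ^ Suc M \<le> norm c * (exp (12 * ln 2) * B) ^ Suc M"
        by (intro mult_left_mono) auto
      moreover have "norm (F' (fricke \<tau>)) \<le> norm (F (fricke \<tau>)) + norm c * norm (hmod (fricke \<tau>)) ^ Suc M"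
        unfolding F'_def norm_power[symmetric] norm_mult[symmetric] by (rule norm_triangle_ineq4)
      ultimately have "norm (F' (fricke \<tau>)) \<le> C + norm c * (exp (12 * ln 2) * B) ^ Suc M"
        using bd(1)[OF \<tau>] by linarith
      also have "\<dots> \<le> C'" unfolding C'_def by (rule max.cobounded1)
      finally show ?thesis .
    qed
    show "norm (F' \<tau> * nome \<tau> ^ M) \<le> C'" if \<tau>: "Im \<tau> \<ge> 1/4" for \<tau>
    proof -
      have \<tau>': "Im \<tau> > 0" using \<tau> by linarith
      have "F' \<tau> * nome \<tau> ^ Suc M = F \<tau> * nome \<tau> ^ Suc M - c * (hmod \<tau> * nome \<tau>) ^ Suc M"
        by (simp only: F'_def left_diff_distrib power_mult_distrib mult.assoc)
      also have "\<dots> = \<theta> (nome \<tau>)" by (simp only: hmod_nome \<phi>(2)[OF \<tau>'] \<theta>_def)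
      also have "\<dots> = nome \<tau> * \<theta>1 (nome \<tau>)" by (rule \<theta>1) simp
      finally have "nome \<tau> * (F' \<tau> * nome \<tau> ^ M) = nome \<tau> * \<theta>1 (nome \<tau>)" by (simp add: mult_ac)
      then have "F' \<tau> * nome \<tau> ^ M = \<theta>1 (nome \<tau>)" by (simp only: mult_cancel_left nome_nonzero simp_thms)
      then show ?thesis using x[OF nome_half_disc[OF \<tau>]] by (simp add: C'_def le_max_iff_disj)
    qed
  qed
  then obtain p where p: "\<And>\<tau>. Im \<tau> > 0 \<Longrightarrow> F' \<tau> = poly p (hmod \<tau>)" by blast
  have "F \<tau> = poly (p + monom c (Suc M)) (hmod \<tau>)" if "Im \<tau> > 0" for \<tau>
    using p[OF that] by (simp only: F'_def poly_add poly_monom) (simp add: diff_eq_eq)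
  then show ?case by blast
qed

text \<open>A power of h, which vanishes at the cusp 0, removes the pole of F there. The product has
  its only pole at infinity, where \<open>poly_in_hmod\<close> takes over.\<close>

theorem moderate_invariant_poly:
  assumes F: "F holomorphic_on UH"
    and T: "\<And>\<tau>. Im \<tau> > 0 \<Longrightarrow> F (\<tau> + 1) = F \<tau>"
    and U: "\<And>\<tau>. Im \<tau> > 0 \<Longrightarrow> F (\<tau> / (2 * \<tau> + 1)) = F \<tau>"
    and mod: "moderate F" "moderate (\<lambda>\<tau>. F (fricke \<tau>))"
  shows "\<exists>N. \<exists>p :: complex poly. \<forall>\<tau>. Im \<tau> > 0 \<longrightarrow> F \<tau> * hmod \<tau> ^ N = poly p (hmod \<tau>)"
proof -
  obtain C M where CM: "C \<ge> 0" "\<And>\<tau>. Im \<tau> \<ge> 1/4 \<Longrightarrow> norm (F (fricke \<tau>)) \<le> C * exp (M * Im \<tau>)"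
    using moderateE[OF mod(2)] by metis
  obtain B where B: "B \<ge> 0" "\<And>\<tau>. Im \<tau> \<ge> 1/4 \<Longrightarrow> norm (1 / hmod \<tau>) \<le> B * exp (- 2 * pi * Im \<tau>)"
    using inverse_hmod_bound by metis
  \<comment> \<open>Each factor h contributes the decay exp(-2 pi Im tau) at the cusp 0, against
    growth exp(M Im tau).\<close>
  define N where "N = nat \<lceil>M / (2 * pi)\<rceil>"
  have "M / (2 * pi) \<le> real N" unfolding N_def by linarith
  then have N: "M \<le> 2 * pi * real N" by (simp add: field_simps)
  define G where "G \<tau> = F \<tau> * hmod \<tau> ^ N" for \<tau>
  have 1: "norm (G (fricke \<tau>)) \<le> C * (exp (12 * ln 2) * B) ^ N" if \<tau>: "Im \<tau> \<ge> 1/4" for \<tau>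
  proof -
    have \<tau>': "Im \<tau> > 0" using \<tau> by linarith
    have "norm (hmod (fricke \<tau>)) = exp (12 * ln 2) * norm (1 / hmod \<tau>)"
      unfolding hmod_fricke[OF \<tau>'] norm_divide norm_of_real by simp
    also have "\<dots> \<le> exp (12 * ln 2) * (B * exp (- 2 * pi * Im \<tau>))"
      using B(2)[OF \<tau>] by (intro mult_left_mono) auto
    finally have "norm (hmod (fricke \<tau>)) ^ N \<le> (exp (12 * ln 2) * (B * exp (- 2 * pi * Im \<tau>))) ^ N"
      by (intro power_mono) auto
    also have "\<dots> = (exp (12 * ln 2) * B) ^ N * exp (- (2 * pi * real N * Im \<tau>))"
      by (simp add: power_mult_distrib exp_of_nat_mult[symmetric] mult_ac)
    finally have h: "norm (hmod (fricke \<tau>)) ^ N \<le> (exp (12 * ln 2) * B) ^ N * exp (- (2 * pi * real N * Im \<tau>))" .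
    have "norm (G (fricke \<tau>)) \<le> (C * exp (M * Im \<tau>)) * ((exp (12 * ln 2) * B) ^ N * exp (- (2 * pi * real N * Im \<tau>)))"
      unfolding G_def norm_mult norm_power using CM(1) CM(2)[OF \<tau>] h by (intro mult_mono) auto
    also have "\<dots> = C * (exp (12 * ln 2) * B) ^ N * exp (M * Im \<tau> + - (2 * pi * real N * Im \<tau>))"
      unfolding exp_add by (simp only: mult_ac)
    also have "\<dots> \<le> C * (exp (12 * ln 2) * B) ^ N * 1"
    proof (intro mult_left_mono)
      have "M * Im \<tau> \<le> 2 * pi * real N * Im \<tau>" using N \<tau>' by (intro mult_right_mono) auto
      then show "exp (M * Im \<tau> + - (2 * pi * real N * Im \<tau>)) \<le> 1" by simp
    qed (use CM(1) B(1) in simp)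
    finally show ?thesis by simp
  qed
  have "moderate hmod" using moderate_exp_hmod_log[of 1] by (simp add: hmod_def[abs_def])
  then have "moderate G" unfolding G_def[abs_def] by (intro moderate_mult moderate_power mod(1))
  then obtain D K where DK: "D \<ge> 0" "\<And>\<tau>. Im \<tau> \<ge> 1/4 \<Longrightarrow> norm (G \<tau>) \<le> D * exp (K * Im \<tau>)"
    using moderateE by metis
  define L where "L = nat \<lceil>K / (2 * pi)\<rceil>"
  have "K / (2 * pi) \<le> real L" unfolding L_def by linarith
  then have L: "K \<le> 2 * pi * real L" by (simp add: field_simps)
  have 2: "norm (G \<tau> * nome \<tau> ^ L) \<le> D" if \<tau>: "Im \<tau> \<ge> 1/4" for \<tau>
  proof -
    have "norm (G \<tau> * nome \<tau> ^ L) \<le> (D * exp (K * Im \<tau>)) * exp (- 2 * pi * Im \<tau>) ^ L"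
      unfolding norm_mult norm_power norm_nome using DK(2)[OF \<tau>] by (intro mult_right_mono) auto
    also have "\<dots> = D * exp (K * Im \<tau> + - (2 * pi * real L * Im \<tau>))"
      unfolding exp_add by (simp add: exp_of_nat_mult[symmetric] mult_ac)
    also have "\<dots> \<le> D * 1"
    proof (intro mult_left_mono)
      have "K * Im \<tau> \<le> 2 * pi * real L * Im \<tau>" using L \<tau> by (intro mult_right_mono) auto
      then show "exp (K * Im \<tau> + - (2 * pi * real L * Im \<tau>)) \<le> 1" by simp
    qed (use DK(1) in simp)
    finally show ?thesis by simp
  qed
  have "\<exists>p :: complex poly. \<forall>\<tau>. Im \<tau> > 0 \<longrightarrow> G \<tau> = poly p (hmod \<tau>)"
  proof (rule poly_in_hmod[of G "max (C * (exp (12 * ln 2) * B) ^ N) D" L])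
    show "G holomorphic_on UH" unfolding G_def[abs_def] by (intro holomorphic_intros F hmod_holomorphic)
    show "G (\<tau> + 1) = G \<tau>" if "Im \<tau> > 0" for \<tau> by (simp only: G_def T[OF that] hmod_add_1)
    show "G (\<tau> / (2 * \<tau> + 1)) = G \<tau>" if "Im \<tau> > 0" for \<tau> by (simp only: G_def U[OF that] hmod_U[OF that])
  qed (use 1 2 in \<open>simp_all add: le_max_iff_disj\<close>)
  then show ?thesis unfolding G_def by blast
qed

section \<open>Fourier expansions\<close>

text \<open>Functions with an expansion in 1 + q Z[[q]]. They are closed under products and
  inverses, and all factors of the unit \<open>C\<close> are of this kind.\<close>

definition unit_series :: "(complex \<Rightarrow> complex) \<Rightarrow> complex fps \<Rightarrow> bool" where
  "unit_series \<psi> \<Psi> \<longleftrightarrow> \<psi> has_fps_expansion \<Psi> \<and> coeffs_in \<int> \<Psi> \<and> fps_nth \<Psi> 0 = 1"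

lemma unit_series_mult:
  "unit_series f F \<Longrightarrow> unit_series g G \<Longrightarrow> unit_series (\<lambda>q. f q * g q) (F * G)"
  by (auto simp: unit_series_def intro: has_fps_expansion_mult coeffs_in_mult[OF closed_coeffs_Ints])

lemma unit_series_inverse:
  "unit_series f F \<Longrightarrow> unit_series (\<lambda>q. inverse (f q)) (inverse F)"
  by (auto simp: unit_series_def intro: has_fps_expansion_inverse coeffs_in_inverse[OF closed_coeffs_Ints])

lemma unit_series_power:
  "unit_series f F \<Longrightarrow> unit_series (\<lambda>q. f q ^ k) (F ^ k)"
  by (auto simp: unit_series_def fps_power_zeroth
      intro: has_fps_expansion_power coeffs_in_power[OF closed_coeffs_Ints])

lemma unit_series_powi:
  assumes "unit_series f F"
  shows "\<exists>G. unit_series (\<lambda>q. f q powi k) G"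
proof (cases "k \<ge> 0")
  case True
  then show ?thesis using unit_series_power[OF assms, of "nat k"] by (auto simp: power_int_def)
next
  case False
  then show ?thesis
    using unit_series_power[OF unit_series_inverse[OF assms], of "nat (- k)"] by (auto simp: power_int_def)
qed

lemma coeffs_in_compose_X_power:
  assumes "closed_coeffs S" "coeffs_in S F" "k > 0"
  shows "coeffs_in S (fps_compose F (fps_X ^ k))"
  using assms by (auto simp: coeffs_in_def fps_nth_compose_X_power closed_coeffs_def)

lemma has_fps_expansion_compose_X_power:
  assumes "f has_fps_expansion (F :: complex fps)" "k > 0"
  shows "(\<lambda>q. f (q ^ k)) has_fps_expansion (fps_compose F (fps_X ^ k))"
proof -
  have "(\<lambda>q :: complex. q ^ k) has_fps_expansion fps_X ^ k" by (intro fps_expansion_intros)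
  from has_fps_expansion_compose[OF assms(1) this] show ?thesis
    using assms(2) by (simp add: o_def)
qed

lemma unit_series_square:
  "unit_series f F \<Longrightarrow> unit_series (\<lambda>q. f (q^2)) (fps_compose F (fps_X ^ 2))"
  by (auto simp: unit_series_def intro: has_fps_expansion_compose_X_power
      coeffs_in_compose_X_power[OF closed_coeffs_Ints])

definition euler_series :: "complex fps" where
  "euler_series = (SOME \<Phi>. unit_series (\<lambda>q. exp (euler_log q)) \<Phi> \<and> fps_nth \<Phi> 1 = -1)"

lemma euler_series: "unit_series (\<lambda>q. exp (euler_log q)) euler_series" "fps_nth euler_series 1 = -1"
proof -
  have "\<exists>\<Phi>. unit_series (\<lambda>q. exp (euler_log q)) \<Phi> \<and> fps_nth \<Phi> 1 = -1"
    using euler_product_expansion unfolding unit_series_def by metis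
  from someI_ex[OF this] show "unit_series (\<lambda>q. exp (euler_log q)) euler_series" "fps_nth euler_series 1 = -1"
    unfolding euler_series_def by auto
qed

definition euler_quotient :: "complex \<Rightarrow> complex" where
  "euler_quotient q = exp (euler_log q - euler_log (q^2))"

definition euler_quotient_series :: "complex fps" where
  "euler_quotient_series = euler_series * inverse (fps_compose euler_series (fps_X ^ 2))"

lemma fps_nth_1_mult: "fps_nth (F * G) 1 = fps_nth F 0 * fps_nth G 1 + fps_nth F 1 * fps_nth (G :: complex fps) 0"
  by (simp add: fps_mult_nth_1)

lemma euler_quotient_series:
  "unit_series euler_quotient euler_quotient_series" "fps_nth euler_quotient_series 1 = -1"
proof -
  note E = euler_series(1) and E2 = unit_series_square[OF euler_series(1)]
  have "euler_quotient = (\<lambda>q. exp (euler_log q) * inverse (exp (euler_log (q^2))))"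
    by (simp add: euler_quotient_def[abs_def] exp_diff divide_inverse)
  then show "unit_series euler_quotient euler_quotient_series"
    unfolding euler_quotient_series_def using unit_series_mult[OF E unit_series_inverse[OF E2]] by simp
  let ?F = "fps_compose euler_series (fps_X ^ 2)"
  have F: "fps_nth ?F 0 = 1" using E2 by (simp add: unit_series_def)
  have F1: "fps_nth ?F 1 = 0" by (simp add: fps_nth_compose_X_power)
  have "fps_nth (?F * inverse ?F) 1 = 0" using F by (simp add: inverse_mult_eq_1')
  then have "fps_nth (inverse ?F) 1 = 0" using F F1 by (simp only: fps_nth_1_mult) simp
  then show "fps_nth euler_quotient_series 1 = -1"
    unfolding euler_quotient_series_def fps_nth_1_mult using F euler_series(2) by simp
qed

lemma hmod_q_eq: "hmod_q q = euler_quotient q ^ 24"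
  unfolding hmod_q_def euler_quotient_def exp_of_nat_mult[symmetric] by simp

definition theta_q :: "complex \<Rightarrow> complex" where
  "theta_q q = exp (8 * euler_log (q^2) - 4 * euler_log q)"

lemma unit_series_theta_q: "\<exists>G. unit_series theta_q G"
proof -
  have "theta_q = (\<lambda>q. exp (euler_log (q^2)) ^ 8 * inverse (exp (euler_log q)) ^ 4)"
  proof
    fix q
    show "theta_q q = exp (euler_log (q^2)) ^ 8 * inverse (exp (euler_log q)) ^ 4"
      unfolding theta_q_def exp_minus[symmetric] exp_of_nat_mult[symmetric] exp_add[symmetric] by simp
  qed
  then show ?thesis
    using unit_series_mult[OF unit_series_power[OF unit_series_square[OF euler_series(1)]]
        unit_series_power[OF unit_series_inverse[OF euler_series(1)]], of 8 4] by auto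
qed

lemma unit_series_eis_q: "\<exists>G. unit_series eis_q G"
proof -
  have E: "(\<lambda>q. exp (euler_log q)) has_fps_expansion euler_series" "fps_nth euler_series 0 = 1"
    "coeffs_in \<int> euler_series"
    using euler_series(1) by (auto simp: unit_series_def)
  define L where "L = fps_deriv euler_series * inverse euler_series"
  have L: "euler_dlog has_fps_expansion L" unfolding L_def by (rule euler_dlog_expansion[OF E(1,2)])
  have "coeffs_in \<int> (fps_deriv euler_series)" using E(3) by (auto simp: coeffs_in_def)
  then have LZ: "coeffs_in \<int> L"
    unfolding L_def using E by (intro coeffs_in_mult coeffs_in_inverse closed_coeffs_Ints)
  have L2: "(\<lambda>q. euler_dlog (q^2)) has_fps_expansion fps_compose L (fps_X^2)"
    by (rule has_fps_expansion_compose_X_power[OF L]) simp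
  have L2Z: "coeffs_in \<int> (fps_compose L (fps_X^2))"
    by (rule coeffs_in_compose_X_power[OF closed_coeffs_Ints LZ]) simp
  define G where "G = 1 - fps_const 24 * fps_X * L + fps_const 48 * fps_X^2 * fps_compose L (fps_X^2)"
  have "eis_q has_fps_expansion G"
    unfolding eis_q_def[abs_def] G_def by (intro fps_expansion_intros L L2)
  moreover have "coeffs_in \<int> G"
    unfolding G_def using LZ L2Z
    by (intro coeffs_in_add coeffs_in_diff coeffs_in_mult coeffs_in_const coeffs_in_1 coeffs_in_X
        coeffs_in_power closed_coeffs_Ints) auto
  moreover have "fps_nth G 0 = 1" by (simp add: G_def)
  ultimately show ?thesis unfolding unit_series_def by blast
qed

lemma fps_nth_1_power:
  "fps_nth F 0 = 1 \<Longrightarrow> fps_nth (F ^ k) 1 = of_nat k * fps_nth (F :: complex fps) 1"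
proof (induction k)
  case (Suc k)
  then show ?case by (simp only: power_Suc fps_nth_1_mult) (simp add: fps_power_zeroth algebra_simps)
qed simp

lemma inverse_euler_quotient_power:
  "inverse (euler_quotient q) ^ M = exp (- (of_nat M * (euler_log q - euler_log (q^2))))"
proof -
  have "exp (- (of_nat M * (euler_log q - euler_log (q^2)))) = exp (of_nat M * (- (euler_log q - euler_log (q^2))))"
    by (simp only: mult_minus_right)
  also have "\<dots> = exp (- (euler_log q - euler_log (q^2))) ^ M" by (rule exp_of_nat_mult)
  finally show ?thesis by (simp only: euler_quotient_def exp_minus)
qed

text \<open>For \<open>r = a / n\<close> the \<open>n\<close>-th power of \<open>exp (- 24 r (\<dots>))\<close> is an integral series.\<close>

lemma root_series:
  assumes n: "n > 0"
  obtains Z V where "(\<lambda>q. exp (- of_real (24 * (real a / real n)) * (euler_log q - euler_log (q^2)))) has_fps_expansion Z"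
    "Z ^ n = V" "coeffs_in \<int> V" "fps_nth Z 0 = 1" "of_nat n * fps_nth Z 1 = of_nat (24 * a)"
    "n dvd 24 \<Longrightarrow> coeffs_in \<int> Z"
proof -
  define z where "z q = exp (- of_real (24 * (real a / real n)) * (euler_log q - euler_log (q^2)))" for q
  have lin: "(\<lambda>q. - of_real (24 * (real a / real n)) * (euler_log q - euler_log (q^2))) holomorphic_on ball 0 1"
    by (intro holomorphic_intros holomorphic_euler_log square_holomorphic)
  have "z holomorphic_on ball 0 1"
    using holomorphic_on_compose[OF lin holomorphic_on_exp] by (simp add: z_def[abs_def] o_def)
  then have "z analytic_on {0}" by (auto simp: analytic_at intro!: exI[of _ "ball 0 1"])
  then obtain Z where Z: "z has_fps_expansion Z" using analytic_at_imp_has_fps_expansion_0 by blast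
  \<comment> \<open>E(q)/E(q^2) has linear coefficient -1 and its inverse has 1. Hence
    \<open>V\<close> has linear coefficient 24 a, and its n-th root \<open>Z\<close> has 24 a /
    n.\<close>
  define V where "V = inverse euler_quotient_series ^ (24 * a)"
  have V: "unit_series (\<lambda>q. inverse (euler_quotient q) ^ (24 * a)) V"
    unfolding V_def by (intro unit_series_power unit_series_inverse euler_quotient_series)
  have "z q ^ n = inverse (euler_quotient q) ^ (24 * a)" for q
  proof -
    have "z q ^ n = exp (of_nat n * (- of_real (24 * (real a / real n)) * (euler_log q - euler_log (q^2))))"
      unfolding z_def by (rule exp_of_nat_mult[symmetric])
    also have "of_nat n * (- of_real (24 * (real a / real n)) * (euler_log q - euler_log (q^2)))
        = - (of_nat (24 * a) * (euler_log q - euler_log (q^2)))" using n by simp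
    finally show ?thesis by (simp only: inverse_euler_quotient_power)
  qed
  then have "(\<lambda>q. inverse (euler_quotient q) ^ (24 * a)) has_fps_expansion Z ^ n"
    using has_fps_expansion_power[OF Z, of n] by simp
  then have ZV: "Z ^ n = V" using V fps_expansion_unique_complex by (auto simp: unit_series_def)
  have "z 0 = 1" by (simp add: z_def)
  then have Z0: "fps_nth Z 0 = 1" using has_fps_expansion_imp_0_eq_fps_nth_0[OF Z] by simp
  have Q: "fps_nth euler_quotient_series 0 = 1" "fps_nth euler_quotient_series 1 = -1"
    using euler_quotient_series by (auto simp: unit_series_def)
  have "fps_nth (euler_quotient_series * inverse euler_quotient_series) 1 = 0"
    using Q by (simp add: inverse_mult_eq_1')
  then have "fps_nth (inverse euler_quotient_series) 1 = 1" using Q by (simp only: fps_nth_1_mult) simp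
  then have "fps_nth V 1 = of_nat (24 * a)"
    unfolding V_def using Q by (subst fps_nth_1_power) auto
  then have Z1: "of_nat n * fps_nth Z 1 = of_nat (24 * a)"
    using fps_nth_1_power[OF Z0, of n] by (simp add: ZV)
  have "coeffs_in \<int> Z" if "n dvd 24"
  proof -
    obtain e where e: "24 = n * e" using \<open>n dvd 24\<close> by (rule dvdE)
    \<comment> \<open>With n e = 24 the exponent 24 a / n is the integer e a, so no root is
      extracted.\<close>
    have "z q = inverse (euler_quotient q) ^ (e * a)" for q
    proof -
      have "(24 :: real) = real n * real e" using e by (metis of_nat_mult of_nat_numeral)
      then have "24 * (real a / real n) = (real n * real e) * (real a / real n)" by (rule arg_cong)
      also have "\<dots> = real (e * a)" using n by simp
      finally have "24 * (real a / real n) = real (e * a)" .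
      then show ?thesis
        unfolding z_def inverse_euler_quotient_power by (simp only: of_real_of_nat_eq mult_minus_left)
    qed
    then have "(\<lambda>q. inverse (euler_quotient q) ^ (e * a)) has_fps_expansion Z" using Z by presburger
    moreover have "unit_series (\<lambda>q. inverse (euler_quotient q) ^ (e * a)) (inverse euler_quotient_series ^ (e * a))"
      by (intro unit_series_power unit_series_inverse euler_quotient_series)
    ultimately show ?thesis using fps_expansion_unique_complex by (auto simp: unit_series_def)
  qed
  then show ?thesis using that[OF Z[unfolded z_def[abs_def]] ZV _ Z0 Z1] V by (auto simp: unit_series_def)
qed

text \<open>As tau runs through the upper half-plane, q^(1/h) runs through the punctured unit disc.
  The Fourier series is thus a power series converging on the whole disc.\<close>

lemma fourier_analytic:
  assumes f: "has_fourier_expansion f h c" and h: "h > 0"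
  obtains g where "g holomorphic_on ball 0 1" "g has_fps_expansion (Abs_fps c)"
    "\<And>\<tau>. Im \<tau> > 0 \<Longrightarrow> f \<tau> = g (nome (\<tau> / of_nat h))"
proof -
  have exp_eq: "exp (2 * of_real pi * \<i> * \<tau> * of_nat m / of_nat h) = nome (\<tau> / of_nat h) ^ m" for \<tau> m
    unfolding nome_def exp_of_nat_mult[symmetric] by (simp add: mult_ac)
  have sums: "(\<lambda>m. c m * nome (\<tau> / of_nat h) ^ m) sums f \<tau>" if "Im \<tau> > 0" for \<tau>
    using f that unfolding has_fourier_expansion_def upper_half_plane_def exp_eq by simp
  define g where "g x = (\<Sum>m. c m * x ^ m)" for x
  have g: "(\<lambda>m. c m * x ^ m) sums g x" if "norm x < 1" for x
  proof (cases "x = 0")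
    case True
    have "(\<lambda>m. c m * 0 ^ m) sums c 0" by (rule powser_sums_zero)
    then show ?thesis using True by (simp add: g_def sums_iff)
  next
    case False
    define \<sigma> where "\<sigma> = Ln x / (2 * of_real pi * \<i>)"
    have \<sigma>: "nome \<sigma> = x" "Im \<sigma> > 0" unfolding \<sigma>_def using nome_surj[OF that False] by auto
    have "Im (of_nat h * \<sigma>) > 0" using \<sigma> h by simp
    from sums[OF this] have "(\<lambda>m. c m * x ^ m) sums f (of_nat h * \<sigma>)" using h \<sigma> by simp
    then show ?thesis by (simp add: g_def sums_iff)
  qed
  show ?thesis
  proof (rule that)
    show "g holomorphic_on ball 0 1"
      by (rule power_series_holomorphic[of 0 1 c]) (use g in auto)
    show "g has_fps_expansion (Abs_fps c)"
    proof (rule has_fps_expansionI)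
      have "\<forall>\<^sub>F u in nhds (0::complex). u \<in> ball 0 1" by (intro eventually_nhds_in_open) auto
      then show "\<forall>\<^sub>F u in nhds 0. (\<lambda>n. fps_nth (Abs_fps c) n * u ^ n) sums g u"
        by eventually_elim (use g in auto)
    qed
    show "f \<tau> = g (nome (\<tau> / of_nat h))" if "Im \<tau> > 0" for \<tau>
      using sums[OF that] by (simp add: g_def sums_iff)
  qed
qed

text \<open>In the coordinate q^(1/h) the region Im tau >= 1/4 lies in a compact disc of radius
  exp(- pi / (2 h)) < 1.\<close>

lemma moderate_fourier:
  assumes f: "has_fourier_expansion f h c" and h: "h > 0"
  shows "moderate f"
proof -
  obtain g where g: "g holomorphic_on ball 0 1" "\<And>\<tau>. Im \<tau> > 0 \<Longrightarrow> f \<tau> = g (nome (\<tau> / of_nat h))"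
    using fourier_analytic[OF assms] by metis
  define \<rho> where "\<rho> = exp (- (pi / (2 * real h)))"
  have \<rho>: "\<rho> < 1" using h by (simp add: \<rho>_def)
  have "continuous_on (cball 0 \<rho>) g"
    using g(1) \<rho> by (intro holomorphic_on_imp_continuous_on) (auto elim!: holomorphic_on_subset)
  then have "bounded (g ` cball 0 \<rho>)" by (intro compact_imp_bounded compact_continuous_image) auto
  then obtain B where B: "\<And>x. x \<in> cball 0 \<rho> \<Longrightarrow> norm (g x) \<le> B" unfolding bounded_iff by blast
  show ?thesis
  proof (rule moderateI[of _ B 0])
    fix \<tau> :: complex assume \<tau>: "Im \<tau> \<ge> 1/4"
    have "2 * pi * (1/4) / real h \<le> 2 * pi * Im \<tau> / real h"
      using \<tau> by (intro divide_right_mono mult_left_mono) auto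
    then have "norm (nome (\<tau> / of_nat h)) \<le> \<rho>"
      using h by (simp add: norm_nome \<rho>_def field_simps)
    then show "norm (f \<tau>) \<le> B * exp (0 * Im \<tau>)"
      using B[of "nome (\<tau> / of_nat h)"] g(2)[of \<tau>] \<tau> by simp
  qed
qed

text \<open>The factor h^(a/n) cancels \<open>lam\<close> under T and U. The theta power cancels the
  weight k = 2 l and leaves the sign eps (-1)^l under T. The quotient of \<open>eis\<close> by theta
  has weight 0, is invariant under U and odd under T, so its exponent s in {0, 1} removes that
  sign.\<close>

lemma weight_zero_polynomial:
  fixes lam eps :: complex and k :: int and a n :: nat
  assumes n: "n > 0" and lam: "lam = exp (2 * of_real pi * \<i> * of_real (real a / real n))"
    and eps: "eps \<in> {1, -1}" and k: "even k"
    and f: "f holomorphic_on UH"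
    and T: "\<And>\<tau>. Im \<tau> > 0 \<Longrightarrow> f (\<tau> + 1) = eps * lam * f \<tau>"
    and U: "\<And>\<tau>. Im \<tau> > 0 \<Longrightarrow> f (\<tau> / (2 * \<tau> + 1)) = lam * (2 * \<tau> + 1) powi k * f \<tau>"
    and mod: "moderate f" "moderate (\<lambda>\<tau>. \<tau> powi (- k) * f (- 1 / \<tau>))"
  obtains l :: int and s N p where
    "\<And>\<tau>. Im \<tau> > 0 \<Longrightarrow> f \<tau> * exp (of_real (real a / real n) * hmod_log \<tau>) * exp (theta_log \<tau>) powi (- l)
        * (eis \<tau> / exp (theta_log \<tau>)) ^ s * hmod \<tau> ^ N = poly p (hmod \<tau>)"
proof -
  define r where "r = real a / real n"
  obtain l where l: "k = 2 * l" using k by (rule evenE)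
  define s :: nat where "s = (if eps * (-1) powi l = 1 then 0 else 1)"
  have "(-1) powi l \<in> {1, -1 :: complex}" by (cases "even l") (auto simp: power_int_minus_left)
  then have sgn: "eps * (-1) powi l * (-1) ^ s = 1" using eps by (auto simp: s_def)
  have sgn': "(-1) powi (- l) = ((-1) powi l :: complex)" by (simp add: power_int_minus_left)
  define t where "t \<tau> = exp (theta_log \<tau>)" for \<tau>
  define td where "td \<tau> = exp (theta_dual_log \<tau>)" for \<tau>
  have t0 [simp]: "t \<tau> \<noteq> 0" "td \<tau> \<noteq> 0" for \<tau> by (simp_all add: t_def td_def)
  define F where "F \<tau> = f \<tau> * exp (of_real r * hmod_log \<tau>) * t \<tau> powi (- l) * (eis \<tau> / t \<tau>) ^ s" for \<tau>
  have t1: "t (\<tau> + 1) = - t \<tau>" for \<tau>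
    by (simp add: t_def theta_log_add_1 exp_add)
  have lam0: "lam \<noteq> 0" by (simp add: lam)
  have h1: "exp (of_real r * (x - 2 * of_real pi * \<i>)) = exp (of_real r * x) / lam" for x
    unfolding lam r_def[symmetric] exp_diff[symmetric] by (simp add: algebra_simps)
  have T': "F (\<tau> + 1) = F \<tau>" if \<tau>: "Im \<tau> > 0" for \<tau>
  proof -
    have "(- t \<tau>) powi (- l) = (-1) powi l * t \<tau> powi (- l)"
      using power_int_mult_distrib[of "-1" "t \<tau>" "- l"] sgn' by simp
    moreover have "(eis \<tau> / - t \<tau>) ^ s = (-1) ^ s * (eis \<tau> / t \<tau>) ^ s"
      using power_mult_distrib[of "-1" "eis \<tau> / t \<tau>" s] by simp
    ultimately have "F (\<tau> + 1) = (eps * lam * f \<tau>) * (exp (of_real r * hmod_log \<tau>) / lam)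
        * ((-1) powi l * t \<tau> powi (- l)) * ((-1) ^ s * (eis \<tau> / t \<tau>) ^ s)"
      by (simp only: F_def T[OF \<tau>] hmod_log_add_1 h1 t1 eis_add_1)
    also have "\<dots> = (eps * (-1) powi l * (-1) ^ s) * F \<tau>"
      using lam0 by (simp add: F_def)
    finally show ?thesis using sgn by simp
  qed
  have U': "F (\<tau> / (2 * \<tau> + 1)) = F \<tau>" if \<tau>: "Im \<tau> > 0" for \<tau>
  proof -
    define j where "j = 2 * \<tau> + 1"
    have j: "j \<noteq> 0" unfolding j_def by (rule U_eq_fricke(2)[OF \<tau>])
    have tU: "t (\<tau> / (2 * \<tau> + 1)) = j^2 * t \<tau>" unfolding t_def j_def by (rule exp_theta_log_U[OF \<tau>])
    have eU: "eis (\<tau> / (2 * \<tau> + 1)) = j^2 * eis \<tau>" unfolding j_def by (rule eis_U[OF \<tau>])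
    have "(j^2 * t \<tau>) powi (- l) = (j powi (2 * (- l))) * t \<tau> powi (- l)"
      unfolding power_int_mult_distrib power_int_mult[of j 2] power_int_numeral ..
    also have "2 * (- l) = - k" by (simp add: l)
    finally have tp: "(j^2 * t \<tau>) powi (- l) = j powi (- k) * t \<tau> powi (- l)" .
    have ep: "(j^2 * eis \<tau>) / (j^2 * t \<tau>) = eis \<tau> / t \<tau>" using j by simp
    have "F (\<tau> / (2 * \<tau> + 1)) = (lam * j powi k * f \<tau>) * (exp (of_real r * hmod_log \<tau>) / lam)
        * (j powi (- k) * t \<tau> powi (- l)) * (eis \<tau> / t \<tau>) ^ s"
      by (simp only: F_def U[OF \<tau>] hmod_log_U[OF \<tau>] h1 tU eU tp ep) (simp only: j_def)
    also have "\<dots> = (j powi k * j powi (- k)) * F \<tau>" using lam0 by (simp add: F_def)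
    also have "j powi k * j powi (- k) = 1" using j by (simp add: power_int_minus)
    finally show ?thesis by simp
  qed
  have t_hol: "t holomorphic_on UH"
    using holomorphic_on_compose[OF theta_log_holomorphic holomorphic_on_exp] by (simp add: t_def[abs_def] o_def)
  have "(\<lambda>\<tau>. of_real r * hmod_log \<tau>) holomorphic_on UH" by (intro holomorphic_intros hmod_log_holomorphic)
  from holomorphic_on_compose[OF this holomorphic_on_exp]
  have e_hol: "(\<lambda>\<tau>. exp (of_real r * hmod_log \<tau>)) holomorphic_on UH" by (simp add: o_def)
  have F_hol: "F holomorphic_on UH"
    unfolding F_def[abs_def] by (intro holomorphic_intros f e_hol t_hol eis_holomorphic) auto
  have tpow: "t \<tau> powi i = exp (of_real (real_of_int i) * theta_log \<tau>)"
    and tdpow: "td \<tau> powi i = exp (of_real (real_of_int i) * theta_dual_log \<tau>)" for i \<tau>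
    unfolding t_def td_def by (simp_all add: exp_power_int)
  have m_eis: "moderate eis" unfolding eis_eq[abs_def] by (rule moderate_nome[OF eis_q_holomorphic])
  have m_t: "moderate (\<lambda>\<tau>. t \<tau> powi i)" and m_td: "moderate (\<lambda>\<tau>. td \<tau> powi i)" for i
    unfolding tpow tdpow by (rule moderate_exp_theta_log moderate_exp_theta_dual_log)+
  have m_et: "moderate (\<lambda>\<tau>. eis \<tau> / t \<tau>)" and m_etd: "moderate (\<lambda>\<tau>. eis \<tau> / td \<tau>)"
    using moderate_mult[OF m_eis m_t[of "-1"]] moderate_mult[OF m_eis m_td[of "-1"]]
    by (simp_all add: power_int_minus divide_inverse)
  have F_mod: "moderate F"
    unfolding F_def[abs_def] by (intro moderate_mult mod(1) moderate_exp_hmod_log m_t moderate_power m_et)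
  \<comment> \<open>The growth hypothesis concerns -1/tau, the involution is -1/(2 tau); hence the
    doubled argument. The constants -16 and 8 are (2 tau)^2 and -2 tau^2 divided by -tau^2 / 4, the
    factor of theta.\<close>
  have F_fricke: "F (fricke \<tau>) = ((-16) powi l * exp (of_real (r * (12 * ln 2))) * 8 ^ s) *
      (((2 * \<tau>) powi (- k) * f (- 1 / (2 * \<tau>))) * (exp (of_real (- r) * hmod_log \<tau>) * (td \<tau> powi (- l) * (eis \<tau> / td \<tau>) ^ s)))"
    if \<tau>: "Im \<tau> > 0" for \<tau>
  proof -
    have \<tau>0: "\<tau> \<noteq> 0" using \<tau> by auto
    have tf: "t (fricke \<tau>) = (- 1 / 4 * \<tau>^2) * td \<tau>" unfolding t_def td_def by (rule exp_theta_log_fricke[OF \<tau>])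
    have ef: "eis (fricke \<tau>) / t (fricke \<tau>) = 8 * (eis \<tau> / td \<tau>)"
      unfolding tf eis_fricke[OF \<tau>] using \<tau>0 by (simp add: field_simps)
    have hf: "exp (of_real r * hmod_log (fricke \<tau>)) = exp (of_real (r * (12 * ln 2))) * exp (of_real (- r) * hmod_log \<tau>)"
      unfolding hmod_log_fricke[OF \<tau>] exp_add[symmetric] by (simp add: algebra_simps)
    have "(- 1 / 4 * \<tau>^2) powi (- l) = (-16) powi l * (2 * \<tau>) powi (- k)"
    proof -
      have "(2 * \<tau>) powi (- k) = ((2 * \<tau>) powi 2) powi (- l)" unfolding l mult_minus_right[symmetric] by (rule power_int_mult)
      also have "(2 * \<tau>) powi 2 = (-16) * (- 1 / 4 * \<tau>^2)" by (simp add: power_mult_distrib)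
      also have "\<dots> powi (- l) = (-16) powi (- l) * (- 1 / 4 * \<tau>^2) powi (- l)" by (rule power_int_mult_distrib)
      finally have "(-16) powi l * (2 * \<tau>) powi (- k) = ((-16) powi l * (-16) powi (- l)) * (- 1 / 4 * \<tau>^2) powi (- l)"
        by (simp only: mult.assoc)
      also have "(-16) powi l * (-16) powi (- l) = (1 :: complex)" by (simp add: power_int_minus)
      finally show ?thesis by simp
    qed
    then have tp: "t (fricke \<tau>) powi (- l) = ((-16) powi l * (2 * \<tau>) powi (- k)) * td \<tau> powi (- l)"
      unfolding tf by (simp only: power_int_mult_distrib)
    show ?thesis
      unfolding F_def ef hf tp power_mult_distrib by (simp only: fricke_def mult_ac)
  qed
  have "moderate (\<lambda>\<tau>. F (fricke \<tau>))"
  proof (rule moderate_cong[OF _ F_fricke])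
    show "moderate (\<lambda>\<tau>. ((-16) powi l * exp (of_real (r * (12 * ln 2))) * 8 ^ s) *
      (((2 * \<tau>) powi (- k) * f (- 1 / (2 * \<tau>))) * (exp (of_real (- r) * hmod_log \<tau>) * (td \<tau> powi (- l) * (eis \<tau> / td \<tau>) ^ s))))"
      by (intro moderate_mult[OF moderate_const] moderate_mult[OF moderate_double[OF mod(2)]]
          moderate_mult[OF moderate_exp_hmod_log] moderate_mult[OF m_td moderate_power[OF m_etd]])
  qed
  from moderate_invariant_poly[OF F_hol T' U' F_mod this]
  obtain N p where "\<And>\<tau>. Im \<tau> > 0 \<Longrightarrow> F \<tau> * hmod \<tau> ^ N = poly p (hmod \<tau>)" by blast
  then show ?thesis using that unfolding F_def t_def r_def by blast
qed

text \<open>\<open>R\<close> is a series in q, while \<open>c\<close> belongs to a root of q. Both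
  have the same nonzero coefficients, so statements on denominators pass in either
  direction.\<close>

lemma fps_shift_relation:
  fixes c :: "nat \<Rightarrow> complex"
  assumes eq: "Abs_fps c * fps_X ^ A = fps_X ^ B * fps_compose R (fps_X ^ k)" and k: "k > 0"
  shows "c m = 0 \<or> (\<exists>j. c m = fps_nth R j)" and "fps_nth R j = 0 \<or> (\<exists>m. fps_nth R j = c m)"
proof -
  have eq': "(if i < A then 0 else c (i - A)) = (if i < B then 0 else if k dvd (i - B) then fps_nth R ((i - B) div k) else 0)" for i
    using arg_cong[OF eq, of "\<lambda>F. fps_nth F i"]
    unfolding fps_X_power_mult_right_nth fps_X_power_mult_nth fps_nth_compose_X_power fps_nth_Abs_fps .
  show "c m = 0 \<or> (\<exists>j. c m = fps_nth R j)" using eq'[of "m + A"] by (auto split: if_splits)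
  show "fps_nth R j = 0 \<or> (\<exists>m. fps_nth R j = c m)" using eq'[of "B + k * j"] k
    by (cases "B + k * j < A") (simp, metis add_diff_cancel_left' dvd_triv_left nonzero_mult_div_cancel_left not_add_less1 not_less_zero)
qed

lemma q_series_structure:
  fixes a n :: nat and l :: int
  assumes n: "n > 0" and four: "has_fourier_expansion f (2 * n) c"
    and id: "\<And>\<tau>. Im \<tau> > 0 \<Longrightarrow> f \<tau> * exp (of_real (real a / real n) * hmod_log \<tau>) * exp (theta_log \<tau>) powi (- l)
        * (eis \<tau> / exp (theta_log \<tau>)) ^ s * hmod \<tau> ^ N = poly p (hmod \<tau>)"
    and Z: "(\<lambda>q. exp (- of_real (24 * (real a / real n)) * (euler_log q - euler_log (q^2)))) has_fps_expansion Z"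
  obtains C Y b d H R where "R = Z * C * Y" "coeffs_in \<int> C" "fps_nth C 0 = 1"
    "Y = (\<Sum>i\<le>d. fps_const (b i) * fps_X ^ (d - i) * H i)"
    "\<And>i. coeffs_in \<int> (H i)" "\<And>i. fps_nth (H i) 0 = 1"
    "\<And>m. c m = 0 \<or> (\<exists>j. c m = fps_nth R j)" "\<And>j. fps_nth R j = 0 \<or> (\<exists>m. fps_nth R j = c m)"
proof -
  define z where "z q = exp (- of_real (24 * (real a / real n)) * (euler_log q - euler_log (q^2)))" for q
  obtain Th where Th: "unit_series theta_q Th" using unit_series_theta_q by blast
  obtain Th' where Th': "unit_series (\<lambda>q. theta_q q powi (l + int s)) Th'" using unit_series_powi[OF Th] by blast
  obtain E where E: "unit_series eis_q E" using unit_series_eis_q by blast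
  define Hq where "Hq = euler_quotient_series ^ 24"
  have Hq: "unit_series hmod_q Hq"
    unfolding hmod_q_eq[abs_def] Hq_def by (intro unit_series_power euler_quotient_series)
  define C where "C = Th' * inverse E ^ s * inverse Hq ^ N"
  define Cf where "Cf q = theta_q q powi (l + int s) * inverse (eis_q q) ^ s * inverse (hmod_q q) ^ N" for q
  have C: "unit_series Cf C"
    unfolding Cf_def[abs_def] C_def by (intro unit_series_mult unit_series_power unit_series_inverse Th' E Hq)
  define d where "d = degree p"
  define Y where "Y = (\<Sum>i\<le>d. fps_const (coeff p i) * fps_X ^ (d - i) * Hq ^ i)"
  define Yf where "Yf q = (\<Sum>i\<le>d. coeff p i * q ^ (d - i) * hmod_q q ^ i)" for q
  have Y: "Yf has_fps_expansion Y"
    unfolding Yf_def[abs_def] Y_def using Hq by (intro fps_expansion_intros) (auto simp: unit_series_def)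
  define R where "R = Z * C * Y"
  have R: "(\<lambda>q. z q * Cf q * Yf q) has_fps_expansion R"
    unfolding R_def z_def using C by (intro has_fps_expansion_mult Z Y) (auto simp: unit_series_def)
  obtain g where g: "g has_fps_expansion (Abs_fps c)"
      "\<And>\<tau>. Im \<tau> > 0 \<Longrightarrow> f \<tau> = g (nome (\<tau> / of_nat (2 * n)))"
  proof (rule fourier_analytic[OF four])
    show "2 * n > 0" using n by simp
  qed (rule that)
  define K where "K = 2 * n"
  have K: "K > 0" using n by (simp add: K_def)
  define A where "A = K * d + n * nat \<bar>l\<bar> + 1"
  define B where "B = 2 * a + n * nat (l + \<bar>l\<bar>) + n * s + K * N + 1"
  \<comment> \<open>The identity has to be divided by \<open>eis_q\<close>, which is nonzero near q
    = 0.\<close>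
  have "fps_nth E 0 = 1" "eis_q has_fps_expansion E" using E by (auto simp: unit_series_def)
  then have "eis_q 0 \<noteq> 0" using has_fps_expansion_imp_0_eq_fps_nth_0 by fastforce
  moreover have "isCont eis_q 0"
    using has_fps_expansion_imp_continuous \<open>eis_q has_fps_expansion E\<close> by blast
  ultimately have "\<forall>\<^sub>F q in nhds 0. eis_q q \<noteq> 0"
    unfolding eventually_nhds_conv_at isCont_def using tendsto_imp_eventually_ne by blast
  then obtain U where U: "open U" "0 \<in> U" "\<And>q. q \<in> U \<Longrightarrow> eis_q q \<noteq> 0"
    unfolding eventually_nhds by blast
  have "open ((\<lambda>x. x ^ K) -` U)"
    by (rule open_vimage[OF U(1)], rule continuous_on_power, rule continuous_on_id)
  then have "open ((\<lambda>x. x ^ K) -` U \<inter> ball (0 :: complex) 1)" by (rule open_Int) (rule open_ball)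
  moreover have "0 \<in> (\<lambda>x. x ^ K) -` U \<inter> ball (0 :: complex) 1" using U(2) K by (simp add: zero_power)
  ultimately have "\<forall>\<^sub>F x in nhds 0. x \<in> (\<lambda>x. x ^ K) -` U \<inter> ball (0 :: complex) 1"
    by (rule eventually_nhds_in_open)
  then have ev: "\<forall>\<^sub>F x in nhds 0. g x * x ^ A = x ^ B * (z (x ^ K) * Cf (x ^ K) * Yf (x ^ K))"
  proof eventually_elim
    case (elim x)
    show ?case
    proof (cases "x = 0")
      case True
      then show ?thesis by (simp add: A_def B_def)
    next
      case False
      define \<sigma> where "\<sigma> = Ln x / (2 * of_real pi * \<i>)"
      have \<sigma>: "nome \<sigma> = x" "Im \<sigma> > 0" unfolding \<sigma>_def using nome_surj[of x] False elim by auto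
      define \<tau> where "\<tau> = of_nat K * \<sigma>"
      have \<tau>: "Im \<tau> > 0" "\<tau> / of_nat (2 * n) = \<sigma>" using \<sigma> K by (simp_all add: \<tau>_def K_def)
      define q where "q = x ^ K"
      have xpow: "x ^ j = exp (of_nat j * (2 * of_real pi * \<i> * \<sigma>))" for j
        using \<sigma>(1) exp_of_nat_mult[of j "2 * of_real pi * \<i> * \<sigma>"] by (simp only: nome_def)
      have q: "nome \<tau> = q" "q \<noteq> 0" "eis_q q \<noteq> 0"
      proof -
        show "nome \<tau> = q" unfolding q_def xpow nome_def \<tau>_def by (simp only: mult_ac)
        show "q \<noteq> 0" using False by (simp add: q_def)
        show "eis_q q \<noteq> 0" using elim U(3) by (auto simp: q_def)
      qed
      have fx: "f \<tau> = g x" using g(2)[OF \<tau>(1)] \<tau>(2) \<sigma>(1) by simp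
      have e1: "exp (of_real (real a / real n) * hmod_log \<tau>) = inverse (x ^ (2 * a)) * inverse (z q)"
      proof -
        define D where "D = euler_log q - euler_log (q^2)"
        have "hmod_log \<tau> = - (2 * of_real pi * \<i> * \<tau>) + 24 * D" by (simp add: hmod_log_eq q(1) D_def)
        then have "of_real (real a / real n) * hmod_log \<tau>
            = of_real (real a / real n) * (- (2 * of_real pi * \<i> * (of_nat (2 * n) * \<sigma>)) + 24 * D)"
          by (simp only: \<tau>_def K_def)
        also have "\<dots> = - (of_nat (2 * a) * (2 * of_real pi * \<i> * \<sigma>)) + - (- of_real (24 * (real a / real n)) * D)"
        proof -
          have rn: "complex_of_real (real a / real n) * of_nat (2 * n) = of_nat (2 * a)" using n by simp
          have "w * (- (2 * of_real pi * \<i> * (of_nat (2 * n) * \<sigma>)) + 24 * D)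
              = - (w * of_nat (2 * n) * (2 * of_real pi * \<i> * \<sigma>)) + 24 * w * D" for w
            by (simp only: distrib_left mult_minus_right mult_ac)
          from this[of "complex_of_real (real a / real n)"]
          have "complex_of_real (real a / real n) * (- (2 * of_real pi * \<i> * (of_nat (2 * n) * \<sigma>)) + 24 * D)
              = - (complex_of_real (real a / real n) * of_nat (2 * n) * (2 * of_real pi * \<i> * \<sigma>))
                + 24 * complex_of_real (real a / real n) * D" .
          moreover have "- (- complex_of_real (24 * (real a / real n)) * D) = 24 * complex_of_real (real a / real n) * D"
            unfolding of_real_mult by simp
          ultimately show ?thesis unfolding rn by (simp only:)
        qed
        finally have "of_real (real a / real n) * hmod_log \<tau> = - (of_nat (2 * a) * (2 * of_real pi * \<i> * \<sigma>))
            + - (- of_real (24 * (real a / real n)) * (euler_log q - euler_log (q^2)))"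
          by (simp only: D_def)
        then show ?thesis unfolding z_def xpow by (simp only: exp_add exp_minus)
      qed
      \<comment> \<open>eta(2 tau)^8 / eta(tau)^4 starts with q to the power (16 - 4) / 24 = 1/2,
        which is x^n.\<close>
      have e2: "exp (theta_log \<tau>) = x ^ n * theta_q q"
      proof -
        have "theta_log \<tau> = of_nat n * (2 * of_real pi * \<i> * \<sigma>) + (8 * euler_log (q^2) - 4 * euler_log q)"
          unfolding theta_log_def eta_log_def nome_double q(1) by (simp add: \<tau>_def K_def algebra_simps)
        then show ?thesis unfolding theta_q_def xpow by (simp only: exp_add)
      qed
      define y where "y = x ^ n"
      define \<theta> where "\<theta> = theta_q q"
      define h where "h = hmod_q q"
      have nz: "y \<noteq> 0" "\<theta> \<noteq> 0" "h \<noteq> 0" "z q \<noteq> 0" "x \<noteq> 0"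
        using False by (auto simp: y_def \<theta>_def theta_q_def h_def z_def)
      have e4: "hmod \<tau> = h / q" by (simp add: hmod_eq q h_def)
      have main: "g x * (inverse (x ^ (2 * a)) * inverse (z q)) * (y * \<theta>) powi (- l)
          * (eis_q q / (y * \<theta>)) ^ s * (h / q) ^ N = poly p (h / q)"
        using id[OF \<tau>(1)] unfolding e1 e2 fx e4 eis_eq q(1) y_def \<theta>_def .
      have Yq: "q ^ d * poly p (h / q) = Yf q"
        unfolding poly_altdef Yf_def sum_distrib_left d_def[symmetric]
      proof (intro sum.cong refl)
        fix i assume "i \<in> {..d}"
        then have "q ^ d = q ^ (d - i) * q ^ i" by (simp add: power_add[symmetric])
        then show "q ^ d * (coeff p i * (h / q) ^ i) = coeff p i * q ^ (d - i) * hmod_q q ^ i"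
          using q(2) by (simp add: power_divide h_def)
      qed
      have yl: "y powi l * y ^ nat \<bar>l\<bar> = y ^ nat (l + \<bar>l\<bar>)"
      proof (cases "l \<ge> 0")
        case True
        then have "nat (l + \<bar>l\<bar>) = nat l + nat \<bar>l\<bar>" by (intro nat_add_distrib) auto
        then show ?thesis using True by (simp add: power_int_def power_add)
      next
        case False
        then show ?thesis using nz(1) by (simp add: power_int_def power_mult_distrib[symmetric])
      qed
      have inv_l: "(y * \<theta>) powi (- l) * (y powi l * \<theta> powi l) = 1"
        using nz by (simp add: power_int_mult_distrib[symmetric] power_int_minus)
      have inv_s: "(eis_q q / (y * \<theta>)) ^ s * (y ^ s * \<theta> ^ s * inverse (eis_q q) ^ s) = 1"
        unfolding power_mult_distrib[symmetric] using nz q(3) by (simp add: field_simps)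
      have inv_N: "(h / q) ^ N * (q ^ N * inverse h ^ N) = 1"
        unfolding power_mult_distrib[symmetric] using nz q(2) by (simp add: field_simps)
      have Cf: "Cf q = \<theta> powi l * \<theta> ^ s * inverse (eis_q q) ^ s * inverse h ^ N"
        unfolding Cf_def \<theta>_def[symmetric] h_def[symmetric] using nz(2) by (simp add: power_int_add)
      have "g x = (g x * (inverse (x ^ (2 * a)) * inverse (z q)) * (y * \<theta>) powi (- l)
          * (eis_q q / (y * \<theta>)) ^ s * (h / q) ^ N)
          * (x ^ (2 * a) * z q * (y powi l * \<theta> powi l) * (y ^ s * \<theta> ^ s * inverse (eis_q q) ^ s) * (q ^ N * inverse h ^ N))"
      proof -
        have "(g x * (inverse (x ^ (2 * a)) * inverse (z q)) * (y * \<theta>) powi (- l)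
          * (eis_q q / (y * \<theta>)) ^ s * (h / q) ^ N)
          * (x ^ (2 * a) * z q * (y powi l * \<theta> powi l) * (y ^ s * \<theta> ^ s * inverse (eis_q q) ^ s) * (q ^ N * inverse h ^ N))
          = g x * (inverse (x ^ (2 * a)) * x ^ (2 * a)) * (inverse (z q) * z q)
            * ((y * \<theta>) powi (- l) * (y powi l * \<theta> powi l))
            * ((eis_q q / (y * \<theta>)) ^ s * (y ^ s * \<theta> ^ s * inverse (eis_q q) ^ s))
            * ((h / q) ^ N * (q ^ N * inverse h ^ N))"
          by (simp only: mult_ac)
        also have "\<dots> = g x" unfolding inv_l inv_s inv_N using nz by simp
        finally show ?thesis by (rule sym)
      qed
      then have gx: "g x = poly p (h / q) * (x ^ (2 * a) * z q * (y powi l * \<theta> powi l)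
          * (y ^ s * \<theta> ^ s * inverse (eis_q q) ^ s) * (q ^ N * inverse h ^ N))"
        unfolding main .
      have xA: "x ^ A = q ^ d * y ^ nat \<bar>l\<bar> * x"
        unfolding A_def q_def y_def power_mult[symmetric] power_add by (simp only: power_one_right)
      have xB: "x ^ B = x ^ (2 * a) * y ^ nat (l + \<bar>l\<bar>) * y ^ s * q ^ N * x"
        unfolding B_def q_def y_def power_mult[symmetric] power_add by (simp only: power_one_right)
      have "g x * x ^ A = (q ^ d * poly p (h / q)) * (y powi l * y ^ nat \<bar>l\<bar>)
          * (x ^ (2 * a) * y ^ s * q ^ N * x) * z q * (\<theta> powi l * \<theta> ^ s * inverse (eis_q q) ^ s * inverse h ^ N)"
        unfolding gx xA by (simp only: mult_ac)
      also have "\<dots> = x ^ B * (z q * Cf q * Yf q)"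
        unfolding Yq yl Cf xB by (simp only: mult_ac)
      finally show ?thesis by (simp only: q_def)
    qed
  qed
  have "(\<lambda>x. g x * x ^ A) has_fps_expansion Abs_fps c * fps_X ^ A"
    by (rule has_fps_expansion_mult[OF g(1) has_fps_expansion_fps_X_power])
  moreover have "(\<lambda>x. x ^ B * (z (x ^ K) * Cf (x ^ K) * Yf (x ^ K))) has_fps_expansion fps_X ^ B * fps_compose R (fps_X ^ K)"
    by (rule has_fps_expansion_mult[OF has_fps_expansion_fps_X_power has_fps_expansion_compose_X_power[OF R K]])
  ultimately have eq: "Abs_fps c * fps_X ^ A = fps_X ^ B * fps_compose R (fps_X ^ K)"
    using has_fps_expansion_cong[OF ev refl] fps_expansion_unique_complex by blast
  show ?thesis
  proof (rule that[OF R_def])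
    show "coeffs_in \<int> C" "fps_nth C 0 = 1" using C by (auto simp: unit_series_def)
    show "Y = (\<Sum>i\<le>d. fps_const (coeff p i) * fps_X ^ (d - i) * Hq ^ i)" by (rule Y_def)
    show "coeffs_in \<int> (Hq ^ i)" "fps_nth (Hq ^ i) 0 = 1" for i
      using unit_series_power[OF Hq, of i] by (auto simp: unit_series_def)
    show "c m = 0 \<or> (\<exists>j. c m = fps_nth R j)" "fps_nth R j = 0 \<or> (\<exists>m. fps_nth R j = c m)" for m j
      by (rule fps_shift_relation[OF eq K])+
  qed
qed

section \<open>Arithmetic of n and assembly of the result\<close>

lemma primitive_root_exp:
  assumes "primitive_root_of_unity n z"
  obtains a where "coprime a n" "z = exp (2 * of_real pi * \<i> * of_real (real a / real n))"
proof -
  have n: "n > 0" "z ^ n = 1" using assms by (auto simp: primitive_root_of_unity_def)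
  then have "z \<in> {z. z ^ n = 1}" by simp
  also have "\<dots> = {exp (2 * of_real pi * \<i> * of_nat j / of_nat n) | j. j < n}"
    using n(1) by (intro complex_roots_unity) simp
  finally obtain a where a: "z = exp (2 * of_real pi * \<i> * of_nat a / of_nat n)" by blast
  define g where "g = gcd a n"
  have g: "g > 0" "g dvd a" "g dvd n" using n by (simp_all add: g_def)
  obtain a' where a': "a = g * a'" using g(2) by blast
  obtain n' where n': "n = g * n'" using g(3) by blast
  have "z ^ n' = exp (of_nat n' * (2 * of_real pi * \<i> * of_nat a / of_nat n))"
    unfolding a by (rule exp_of_nat_mult[symmetric])
  also have "of_nat n' * (2 * of_real pi * \<i> * of_nat a / of_nat n) = 2 * of_real pi * \<i> * of_nat a'"
    using n(1) by (simp add: a' n' field_simps)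
  also have "exp \<dots> = 1" using exp_integer_2pi[of "of_nat a'"] by (simp add: mult_ac)
  \<comment> \<open>The order of \<open>z\<close> divides n / g, so the common factor
    \<open>g\<close> is 1.\<close>
  finally have "n dvd n'" using primitive_root_dvd[OF assms] by simp
  then have "g = 1" using n(1) unfolding n' by simp
  then have "coprime a n" by (simp add: g_def coprime_iff_gcd_eq_1)
  moreover have "z = exp (2 * of_real pi * \<i> * of_real (real a / real n))" unfolding a by simp
  ultimately show ?thesis by (rule that)
qed

text \<open>Since 24 = 2^3 times 3, non-divisibility is witnessed by 16, by 9 or by a prime that is
  at least 5.\<close>

lemma not_dvd_24:
  assumes "n > 0" "\<not> n dvd (24 :: nat)"
  obtains p where "prime p" "p dvd n" "p \<ge> 5 \<or> (p = 3 \<and> 9 dvd n) \<or> (p = 2 \<and> 16 dvd n)"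
proof (rule ccontr)
  note witness = that
  assume no: "\<not> thesis"
  have "multiplicity p n \<le> multiplicity p 24" if p: "prime p" for p
  proof -
    have "p \<ge> 2" using prime_ge_2_nat[OF p] .
    have "p \<noteq> 4" using p prime_nat_iff[of p] dvd_triv_left[of 2 "2 :: nat"] by auto
    then consider "p \<ge> 5" | "p = 2" | "p = 3" using \<open>p \<ge> 2\<close> by linarith
    then show ?thesis
    proof cases
      case 1
      then have "\<not> p dvd n" using witness no p by blast
      then show ?thesis by (simp add: not_dvd_imp_multiplicity_0)
    next
      case 2
      have "16 dvd n \<Longrightarrow> even n" using dvd_trans[of 2 16 n] by simp
      then have "\<not> 16 dvd n" using witness no p 2 by blast
      then have "multiplicity 2 n < 4" using assms(1) by (intro multiplicity_lessI) auto
      moreover have "(3::nat) \<le> multiplicity 2 (24 :: nat)" by (intro multiplicity_geI) auto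
      ultimately show ?thesis using 2 by simp
    next
      case 3
      have "9 dvd n \<Longrightarrow> 3 dvd n" using dvd_trans[of 3 9 n] by simp
      then have "\<not> 9 dvd n" using witness no p 3 by blast
      then have "multiplicity 3 n < 2" using assms(1) by (intro multiplicity_lessI) auto
      moreover have "(1::nat) \<le> multiplicity 3 (24 :: nat)" by (intro multiplicity_geI) auto
      ultimately show ?thesis using 3 by simp
    qed
  qed
  then have "n dvd 24" using assms(1) by (intro multiplicity_le_imp_dvd) auto
  then show False using assms(2) by simp
qed

text \<open>For N the multiplicity of \<open>p\<close> in \<open>D\<close>, the numbers p^N c_m and
  D c_m differ by an integer prime to \<open>p\<close>, a unit at every \<open>P\<close> above
  \<open>p\<close>.\<close>

lemma unbounded_imp_not_bounded_denominators:
  assumes p: "prime p" and unb: "unbounded_denominators_at p c"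
  shows "\<not> bounded_denominators c"
proof
  assume "bounded_denominators c"
  then obtain D :: int where D: "D \<noteq> 0" "\<And>m. algebraic_int (of_int D * c m)"
    unfolding bounded_denominators_def by blast
  have pp: "prime (int p)" using p by simp
  then have "\<not> is_unit (int p)" using not_prime_unit by blast
  then obtain t where t: "D = int p ^ multiplicity (int p) D * t" "\<not> int p dvd t"
    by (rule multiplicity_decompose'[OF D(1)])
  define N where "N = multiplicity (int p) D"
  obtain m P where mP: "prime_above p P" "\<not> integral_at P (of_nat p ^ N * c m)"
    using unb unfolding unbounded_denominators_at_def by blast
  have "coprime t (int p)" using t(2) pp prime_imp_coprime coprime_commute by blast
  then have tP: "of_int t \<notin> P" by (rule int_notin_prime_above[OF mP(1)])
  then have t0: "t \<noteq> 0" using prime_aboveD(3)[OF mP(1)] by auto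
  have Dt: "D = int p ^ N * t" using t(1) by (simp only: N_def)
  have "of_nat p ^ N * c m = of_int D * c m / of_int t" using t0 by (simp add: Dt)
  then have "integral_at P (of_nat p ^ N * c m)"
    unfolding integral_at_def using D(2) tP algebraic_int_of_int by blast
  then show False using mP(2) by simp
qed

text \<open>Minus the identity is trivial in the quotient group, so (-1)^k = 1 at a point where
  \<open>f\<close> does not vanish. The matrix with rows (0, -1) and (1, 0) carries infinity to the
  cusp 0 and supplies the growth there.\<close>

lemma modular_form_transformations:
  assumes chi: "finite_order_character barGamma0_2 chi"
    and f: "f \<in> modular_forms_Gamma0_2 k chi" and f0: "Im \<tau>0 > 0" "f \<tau>0 \<noteq> 0"
  shows "\<And>\<tau>. Im \<tau> > 0 \<Longrightarrow> f (\<tau> + 1) = chi (bar mat_V) * chi (bar mat_U) * f \<tau>"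
    and "\<And>\<tau>. Im \<tau> > 0 \<Longrightarrow> f (\<tau> / (2 * \<tau> + 1)) = chi (bar mat_U) * (2 * \<tau> + 1) powi k * f \<tau>"
    and "even k" "moderate (\<lambda>\<tau>. \<tau> powi (- k) * f (- 1 / \<tau>))"
proof -
  have sl: "slash k A f \<tau> = chi (bar A) * f \<tau>" if "A \<in> Gamma0 2" "Im \<tau> > 0" for A \<tau>
    using f that by (auto simp: modular_forms_Gamma0_2_def barGamma0_2_def upper_half_plane_def Gamma0_def)
  show "f (\<tau> + 1) = chi (bar mat_V) * chi (bar mat_U) * f \<tau>" if "Im \<tau> > 0" for \<tau>
    using sl[of "mat2 1 1 0 1" \<tau>] that by (simp add: chi_T[OF chi] mat2_in_Gamma0 slash_def)
  show "f (\<tau> / (2 * \<tau> + 1)) = chi (bar mat_U) * (2 * \<tau> + 1) powi k * f \<tau>" if t: "Im \<tau> > 0" for \<tau>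
  proof -
    have nz: "2 * \<tau> + 1 \<noteq> 0" using t by (auto simp: complex_eq_iff)
    have "(2 * \<tau> + 1) powi (- k) * f (\<tau> / (2 * \<tau> + 1)) = chi (bar mat_U) * f \<tau>"
      using sl[of mat_U \<tau>] t by (simp add: mat_U_eq mat2_in_Gamma0 slash_def)
    then show ?thesis using nz by (simp add: power_int_minus field_simps)
  qed
  show "even k"
  proof (rule ccontr)
    assume "odd k"
    then have "(- 1 :: complex) powi (- k) = - 1" by (simp add: power_int_minus)
    moreover have "chi (bar (mat2 (-1) 0 0 (-1))) = 1"
      using bar_uminus[of "mat2 1 0 0 1"] chi_one[OF chi] by (simp add: uminus_mat2)
    ultimately have "- f \<tau>0 = f \<tau>0"
      using sl[of "mat2 (-1) 0 0 (-1)" \<tau>0] f0(1) by (simp add: mat2_in_Gamma0 slash_def)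
    then show False using f0(2) by simp
  qed
  have "mat2 0 (-1) 1 0 \<in> carrier SL2Z" by (simp add: mat2_in_SL2Z)
  then obtain h c where "h > 0" "has_fourier_expansion (slash k (mat2 0 (-1) 1 0) f) h c"
    using f unfolding modular_forms_Gamma0_2_def holomorphic_at_cusps_def by blast
  then have "moderate (slash k (mat2 0 (-1) 1 0) f)" by (intro moderate_fourier)
  moreover have "slash k (mat2 0 (-1) 1 0) f = (\<lambda>\<tau>. \<tau> powi (- k) * f (- 1 / \<tau>))"
    by (rule ext) (simp add: slash_def)
  ultimately show "moderate (\<lambda>\<tau>. \<tau> powi (- k) * f (- 1 / \<tau>))" by simp
qed

lemma fourier_series_factorization:
  assumes chi: "finite_order_character barGamma0_2 chi"
    and root: "primitive_root_of_unity n (chi (bar mat_U))" and eps: "chi (bar mat_V) \<in> {1, -1}"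
    and f: "f \<in> modular_forms_Gamma0_2 k chi" and f0: "Im \<tau>0 > 0" "f \<tau>0 \<noteq> 0"
    and four: "has_fourier_expansion f (2 * n) c" and alg: "\<And>m. algebraic (c m)"
  obtains a Z V C Y R and D :: int where "coprime a n"
    "Z ^ n = V" "coeffs_in \<int> V" "fps_nth Z 0 = 1" "of_nat n * fps_nth Z 1 = of_nat (24 * a)"
    "n dvd 24 \<Longrightarrow> coeffs_in \<int> Z" "coeffs_in \<int> C" "fps_nth C 0 = 1" "R = Z * C * Y"
    "D \<noteq> 0" "coeffs_in {x. algebraic_int x} (fps_const (of_int D) * Y)" "Y \<noteq> 0"
    "\<And>m. c m = 0 \<or> (\<exists>j. c m = fps_nth R j)" "\<And>j. fps_nth R j = 0 \<or> (\<exists>m. fps_nth R j = c m)"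
proof -
  have n: "n > 0" using root by (simp add: primitive_root_of_unity_def)
  obtain a where a: "coprime a n" "chi (bar mat_U) = exp (2 * of_real pi * \<i> * of_real (real a / real n))"
    using root by (rule primitive_root_exp)
  have hol: "f holomorphic_on UH" using f by (simp add: modular_forms_Gamma0_2_def upper_half_plane_def)
  have mod: "moderate f" using four n by (intro moderate_fourier[of f "2 * n" c]) auto
  note tr = modular_form_transformations[OF chi f f0]
  obtain l s N p where id: "\<And>\<tau>. Im \<tau> > 0 \<Longrightarrow>
      f \<tau> * exp (of_real (real a / real n) * hmod_log \<tau>) * exp (theta_log \<tau>) powi (- l)
        * (eis \<tau> / exp (theta_log \<tau>)) ^ s * hmod \<tau> ^ N = poly p (hmod \<tau>)"
    by (rule weight_zero_polynomial[OF n a(2) eps tr(3) hol tr(1,2) mod tr(4)]) (assumption, assumption, rule that)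
  obtain Z V where Z: "(\<lambda>q. exp (- of_real (24 * (real a / real n)) * (euler_log q - euler_log (q^2)))) has_fps_expansion Z"
      "Z ^ n = V" "coeffs_in \<int> V" "fps_nth Z 0 = 1" "of_nat n * fps_nth Z 1 = of_nat (24 * a)"
      "n dvd 24 \<Longrightarrow> coeffs_in \<int> Z"
    by (rule root_series[OF n, of a]) (rule that)
  show ?thesis
  proof (rule q_series_structure[OF n four id Z(1)])
    fix C Y :: "complex fps" and b and d :: nat and H R
    assume R: "R = Z * C * Y" and C: "coeffs_in \<int> C" "fps_nth C 0 = 1"
      and Y: "Y = (\<Sum>i\<le>d. fps_const (b i) * fps_X ^ (d - i) * H i)"
      and H: "\<And>i. coeffs_in \<int> (H i)" "\<And>i. fps_nth (H i) 0 = 1"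
      and cR: "\<And>m. c m = 0 \<or> (\<exists>j. c m = fps_nth R j)" and Rc: "\<And>j. fps_nth R j = 0 \<or> (\<exists>m. fps_nth R j = c m)"
    have "coeffs_in {x. algebraic x} V"
      using Z(3) closed_coeffs_algebraic by (auto intro: coeffs_in_mono simp: closed_coeffs_def)
    then have Zalg: "coeffs_in {x. algebraic x} Z" by (rule coeffs_algebraic_root[OF Z(2) n _ Z(4)])
    have "algebraic (fps_nth R j)" for j
      using Rc[of j] alg by (metis algebraic_0)
    then have "coeffs_in {x. algebraic x} R" by (simp add: coeffs_in_def)
    from bounded_triangular[OF R Y H C Zalg Z(4) this]
    obtain D :: int where D: "D \<noteq> 0" "coeffs_in {x. algebraic_int x} (fps_const (of_int D) * Y)" by blast
    have Y0: "Y \<noteq> 0"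
    proof
      assume "Y = 0"
      then have "c m = 0" for m using cR[of m] by (auto simp: R)
      moreover have "(\<lambda>m. c m * exp (2 * of_real pi * \<i> * \<tau>0 * of_nat m / of_nat (2 * n))) sums f \<tau>0"
        using four f0(1) by (simp add: has_fourier_expansion_def upper_half_plane_def)
      ultimately have "(\<lambda>m. 0) sums f \<tau>0" by simp
      then show False using f0(2) sums_unique2 sums_zero by blast
    qed
    show ?thesis
      by (rule that[OF a(1) Z(2-6) C R D Y0 cR Rc])
  qed
qed

theorem theorem5p1:
  fixes chi :: "(int^2^2) set \<Rightarrow> complex" and lam eps :: complex and n :: nat and k :: int
    and f :: "complex \<Rightarrow> complex" and c :: "nat \<Rightarrow> complex"
  assumes "finite_order_character barGamma0_2 chi"
    and "n \<ge> 1"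
    and "chi (bar mat_U) = lam" and "primitive_root_of_unity n lam"
    and "chi (bar mat_V) = eps" and "eps \<in> {1, -1}"
    and "f \<in> modular_forms_Gamma0_2 k chi"
    and "\<exists>\<tau>\<in>upper_half_plane. f \<tau> \<noteq> 0"
    and "has_fourier_expansion f (2 * n) c"
    and "\<forall>m. algebraic (c m)"
  shows "(\<forall>p. prime p \<and> p dvd n \<and> (p \<ge> 5 \<or> (p = 3 \<and> 9 dvd n) \<or> (p = 2 \<and> 16 dvd n)) \<longrightarrow>
            unbounded_denominators_at p c)
       \<and> (bounded_denominators c \<longleftrightarrow> n dvd 24)
       \<and> (n dvd 24 \<longleftrightarrow> congruence_modular_form k f)"
proof -
  note chi = assms(1)
  have n: "n > 0" using assms(2) by simp
  have root: "primitive_root_of_unity n (chi (bar mat_U))" using assms(3,4) by simp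
  have eps: "chi (bar mat_V) \<in> {1, -1}" using assms(5,6) by simp
  note f = assms(7)
  obtain \<tau>0 where f0: "Im \<tau>0 > 0" "f \<tau>0 \<noteq> 0" using assms(8) by (auto simp: upper_half_plane_def)
  have alg: "algebraic (c m)" for m using assms(10) by simp
  obtain a Z V C Y R and D :: int where a: "coprime a n"
    and Z: "Z ^ n = V" "coeffs_in \<int> V" "fps_nth Z 0 = 1" "of_nat n * fps_nth Z 1 = of_nat (24 * a)"
      "n dvd 24 \<Longrightarrow> coeffs_in \<int> Z"
    and C: "coeffs_in \<int> C" "fps_nth C 0 = 1" and R: "R = Z * C * Y"
    and D: "D \<noteq> 0" "coeffs_in {x. algebraic_int x} (fps_const (of_int D) * Y)" and Y: "Y \<noteq> 0"
    and cR: "\<And>m. c m = 0 \<or> (\<exists>j. c m = fps_nth R j)" and Rc: "\<And>j. fps_nth R j = 0 \<or> (\<exists>m. fps_nth R j = c m)"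
    by (rule fourier_series_factorization[OF chi root eps f f0 assms(9) alg]) (rule that)
  have unb: "unbounded_denominators_at p c"
    if p: "prime p" "p dvd n" and cases: "p \<ge> 5 \<or> (p = 3 \<and> 9 dvd n) \<or> (p = 2 \<and> 16 dvd n)" for p
  proof -
    obtain P where P: "prime_above p P" using prime_above_exists prime_gt_1_nat[OF p(1)] by blast
    have "\<not> p dvd a" using a p by (metis coprime_common_divisor_nat not_prime_1 nat_dvd_1_iff_1)
    then have pa: "coprime (int a) (int p)"
      using p(1) prime_imp_coprime coprime_commute coprime_int_iff by blast
    have copr: "coprime (int w * int a) (int p)" if "coprime w p" for w
      using pa that by (simp add: coprime_mult_left_iff)
    \<comment> \<open>In n times the linear coefficient = 24 a, the part of 24 shared with n is
      cancelled. The right side becomes 24 a, 8 a or 3 a, prime to \<open>p\<close>, while the left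
      side keeps a factor \<open>p\<close>.\<close>
    obtain u t where ut: "of_int (int p * u) * fps_nth Z 1 = of_int t" "coprime t (int p)"
      using cases
    proof (elim disjE conjE)
      assume p5: "p \<ge> 5"
      obtain u where u: "n = p * u" using p(2) by blast
      have "\<not> p dvd 2 ^ 3 * 3"
        using p5 prime_dvd_multD[OF p(1), of "2 ^ 3" 3] prime_dvd_power[OF p(1), of 2 3] dvd_imp_le[of p 2] dvd_imp_le[of p 3]
        by auto
      then have "coprime 24 p" using p(1) prime_imp_coprime[of p 24] by (simp add: coprime_commute)
      then show ?thesis using that[of "int u" "24 * int a"] Z(4) copr[of 24] by (simp add: u)
    next
      assume p3: "p = 3" and "9 dvd n"
      then obtain u where u: "n = 9 * u" by blast
      have "coprime 8 p" unfolding p3 by (simp add: coprime_iff_gcd_eq_1 gcd_non_0_nat)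
      moreover have "of_nat 9 * of_nat u * fps_nth Z 1 = 24 * of_nat a" using Z(4) by (simp add: u)
      then have "9 * of_nat u * fps_nth Z 1 = 24 * of_nat a" by simp
      ultimately show ?thesis using that[of "int u" "8 * int a"] copr[of 8] by (simp add: p3 algebra_simps)
    next
      assume p2: "p = 2" and "16 dvd n"
      then obtain u where u: "n = 16 * u" by blast
      have "coprime 3 p" unfolding p2 by simp
      moreover have "of_nat 16 * of_nat u * fps_nth Z 1 = 24 * of_nat a" using Z(4) by (simp add: u)
      then have "16 * of_nat u * fps_nth Z 1 = 24 * of_nat a" by simp
      ultimately show ?thesis using that[of "int u" "3 * int a"] copr[of 3] by (simp add: p2 algebra_simps)
    qed
    have "\<exists>m. \<not> integral_at P (of_nat p ^ N * c m)" for N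
    proof -
      obtain j where j: "\<not> integral_at P (of_nat p ^ N * fps_nth R j)"
        using unbounded_root[OF p(1) P Z(1) n Z(2,3) ut C D Y R] by blast
      \<comment> \<open>The non-integral coefficient of \<open>R\<close> is not 0 and therefore
        occurs among the \<open>c m\<close>.\<close>
      have "integral_at P 0" by (rule integral_at_algebraic_int[OF P]) (rule algebraic_int_0)
      then have "fps_nth R j \<noteq> 0" using j by auto
      then show ?thesis using Rc[of j] j by auto
    qed
    then show ?thesis unfolding unbounded_denominators_at_def using P by blast
  qed
  have bounded: "bounded_denominators c" if "n dvd 24"
  proof -
    have S: "closed_coeffs {x. algebraic_int (x :: complex)}" by (rule closed_coeffs_algebraic_int)
    then have ints: "\<int> \<subseteq> {x. algebraic_int (x :: complex)}" by (simp add: closed_coeffs_def)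
    have "coeffs_in {x. algebraic_int x} (Z * C * (fps_const (of_int D) * Y))"
      by (intro coeffs_in_mult[OF S] coeffs_in_mono[OF Z(5)[OF that] ints] coeffs_in_mono[OF C(1) ints] D(2))
    also have "Z * C * (fps_const (of_int D) * Y) = fps_const (of_int D) * R" unfolding R by (simp only: mult_ac)
    finally have "algebraic_int (of_int D * fps_nth R j)" for j by (simp add: coeffs_in_def)
    then have "algebraic_int (of_int D * c m)" for m using cR[of m] by auto
    then show ?thesis unfolding bounded_denominators_def using D(1) by blast
  qed
  have not_bounded: "\<not> bounded_denominators c" if ndvd: "\<not> n dvd 24"
  proof -
    obtain p where "prime p" "p dvd n" "p \<ge> 5 \<or> (p = 3 \<and> 9 dvd n) \<or> (p = 2 \<and> 16 dvd n)"
      by (rule not_dvd_24[OF n ndvd])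
    then show ?thesis using unb unbounded_imp_not_bounded_denominators by blast
  qed
  have sl: "slash k A f \<tau> = chi (bar A) * f \<tau>" if "A \<in> Gamma0 2" "Im \<tau> > 0" for A \<tau>
    using f that by (auto simp: modular_forms_Gamma0_2_def barGamma0_2_def upper_half_plane_def Gamma0_def)
  have "congruence_modular_form k f" if "n dvd 24"
  proof -
    have "chi (bar mat_U) ^ 24 = 1" using primitive_root_dvd[OF root] that by simp
    note triv = chi_trivial_on_principal_Gamma_48[OF chi this eps]
    have "\<forall>A\<in>principal_Gamma 48. \<forall>\<tau>\<in>upper_half_plane. slash k A f \<tau> = f \<tau>"
      using sl triv by (simp add: upper_half_plane_def)
    moreover have "congruence_subgroup (principal_Gamma 48)" by (rule congruence_subgroup_principal_Gamma) simp
    ultimately show ?thesis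
      using f unfolding congruence_modular_form_def modular_forms_Gamma0_2_def by blast
  qed
  moreover have "n dvd 24" if "congruence_modular_form k f"
  proof -
    obtain G N where G: "N \<ge> 1" "principal_Gamma N \<subseteq> G" "\<forall>A\<in>G. \<forall>\<tau>\<in>upper_half_plane. slash k A f \<tau> = f \<tau>"
      using \<open>congruence_modular_form k f\<close> unfolding congruence_modular_form_def congruence_subgroup_def by blast
    \<comment> \<open>Two transformation laws for \<open>f\<close> are compared at a point where
      \<open>f\<close> does not vanish.\<close>
    have triv: "chi (bar A) = 1" if "A \<in> principal_Gamma N" "A \<in> Gamma0 2" for A
    proof -
      have "chi (bar A) * f \<tau>0 = f \<tau>0"
        using sl[OF that(2) f0(1)] G(2,3) that(1) f0(1) by (auto simp: upper_half_plane_def)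
      then show ?thesis using f0(2) by simp
    qed
    have "chi (bar mat_U) ^ 24 = 1" by (rule chi_U_power_24[OF chi triv G(1) eps]) assumption+
    then show ?thesis using primitive_root_dvd[OF root] by simp
  qed
  ultimately show ?thesis using unb bounded not_bounded by blast
qed

end
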